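(* Let $k\in\mathbb{N}$, $N+1=2k$, let $q\in\mathcal{Q}^{odd}$ and $\|q\|\to 0$. Then for every $n=1,\dots,N$ the following asymptotics hold: $$(\lambda_n^{\pm}(q)-\lambda_n^{\pm}(0))^2=\frac{2^{\delta_{k,n}}}{4k}\,\hat q_n^2+O(\|q\|^3),$$ $$h_n^2(q)=\frac{2^{\delta_{k,n}}\,k}{4\sin^2\frac{\pi n}{2k}}\,\hat q_n^2+O(\|q\|^4),$$ where $\lambda_n^\pm(0)=-2\cos\frac{\pi n}{N+1}$ and, for $k<n\le N$, $\hat q_n:=\hat q_{2k-n}$.
   Context: Fix $k\in\mathbb{N}$ and $N+1=2k$. Let $\mathcal{Q}^{odd}=\{q=(q_1,\dots,q_{N+1})\in\mathbb{R}^{N+1}: q_{N+2-n}=-q_n,\ n=1,\dots,N\}$, with Euclidean norm $\|q\|^2=\sum_{n=1}^{N+1}q_n^2$ and standard scalar product $(\cdot,\cdot)$. Extend $q$ to an $(N+1)$-periodic sequence on $\mathbb{Z}$ and consider the operator $(Ly)_n=y_{n-1}+y_{n+1}+q_ny_n$ on $\ell^2(\mathbb{Z})$. Its spectrum consists of $N+1$ intervals $[\lambda_n^+,\lambda_{n+1}^-]$, $n=0,\dots,N$, with $\lambda_0^+<\lambda_1^-\le\lambda_1^+<\dots<\lambda_N^-\le\lambda_N^+<\lambda_{N+1}^-$, where $\lambda_n^\pm=\lambda_n^\pm(q)$. Let $\varphi_n(\lambda,q),\vartheta_n(\lambda,q)$, $n\in\mathbb{Z}$, be the solutions of $y_{n-1}+y_{n+1}+q_ny_n=\lambda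 y_n$ with $\varphi_0=\vartheta_1=0$, $\varphi_1=\vartheta_0=1$, and let $\Delta(\lambda,q)=\varphi_{N+2}(\lambda,q)+\vartheta_{N+1}(\lambda,q)$ be the Lyapunov function. The spectrum equals $\{\lambda\in\mathbb{R}:|\Delta(\lambda,q)|\le2\}$ and $(-1)^{N+1-n}\Delta(\lambda_n^\pm,q)=2$. Write $'=\partial/\partial\lambda$. For each $n=1,\dots,N$ there is a unique $\lambda_n=\lambda_n(q)\in[\lambda_n^-,\lambda_n^+]$ with $\Delta'(\lambda_n,q)=0$; it satisfies $(-1)^{N+1-n}\Delta(\lambda_n,q)\ge2$. The number $h_n=h_n(q)\ge0$ is defined by $\Delta(\lambda_n,q)=2(-1)^{N+1-n}\cosh h_n$. An orthonormal basis of $\mathcal{Q}^{odd}$ is given by $\hat e_m=\frac{2^{-\delta_{k,m}/2}}{\sqrt k}\left\{\sin\frac{(2n-1)m\pi}{2k}\right\}_{n=1}^{N+1}$, $m=1,\dots,k$, where $\delta_{k,m}$ is the Kronecker symbol; the coordinates $\hat q_m$ are defined by $q=\sum_{m=1}^k\hat q_m\hat e_m$. *)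

theory Defs
  imports "HOL-Analysis.Analysis" "HOL-Library.Landau_Symbols"
begin

text \<open>
  Throughout the period is \<open>N + 1 = 2 * k\<close>. A vector \<open>(q\<^sub>1, \<dots>, q\<^sub>N\<^sub>+\<^sub>1)\<close> is a function
  on \<open>nat\<close> vanishing outside \<open>{1..2 * k}\<close>, so that equality of vectors is equality of functions.
\<close>

definition Qodd :: "nat \<Rightarrow> (nat \<Rightarrow> real) set" where
  "Qodd k = {q. (\<forall>n. n \<notin> {1..2 * k} \<longrightarrow> q n = 0) \<and>
                (\<forall>n\<in>{1..2 * k - 1}. q (2 * k + 1 - n) = - q n)}"

definition qnorm :: "nat \<Rightarrow> (nat \<Rightarrow> real) \<Rightarrow> real" where
  "qnorm k q = sqrt (\<Sum>n=1..2 * k. (q n)\<^sup>2)"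

text \<open>The filter of the limit \<open>\<parallel>q\<parallel> \<rightarrow> 0\<close> within \<open>Qodd k\<close>.\<close>

definition Qodd_to_0 :: "nat \<Rightarrow> (nat \<Rightarrow> real) filter" where
  "Qodd_to_0 k = inf (filtercomap (qnorm k) (nhds 0)) (principal (Qodd k))"

definition ehat :: "nat \<Rightarrow> nat \<Rightarrow> nat \<Rightarrow> real" where
  "ehat k m n = (if n \<in> {1..2 * k}
     then 2 powr (- of_bool (k = m) / 2) / sqrt (real k)
            * sin ((2 * real n - 1) * real m * pi / (2 * real k))
     else 0)"

text \<open>The \<open>m\<close>-th coordinate (\<open>1 \<le> m \<le> k\<close>) of \<open>q \<in> Qodd k\<close> in the basis \<open>ehat k 1, \<dots>, ehat k k\<close>.\<close>

definition qhat :: "nat \<Rightarrow> (nat \<Rightarrow> real) \<Rightarrow> nat \<Rightarrow> real" where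
  "qhat k q m = (THE x. \<exists>c :: nat \<Rightarrow> real. q = (\<lambda>n. \<Sum>j=1..k. c j * ehat k j n) \<and> x = c m)"

definition periodic_ext :: "nat \<Rightarrow> (nat \<Rightarrow> real) \<Rightarrow> int \<Rightarrow> real" where
  "periodic_ext k q n = q (nat ((n - 1) mod (2 * int k)) + 1)"

definition ell2 :: "(int \<Rightarrow> complex) set" where
  "ell2 = {y. (\<lambda>n. (cmod (y n))\<^sup>2) summable_on UNIV}"

definition ell2_norm :: "(int \<Rightarrow> complex) \<Rightarrow> real" where
  "ell2_norm y = sqrt (\<Sum>\<^sub>\<infinity>n. (cmod (y n))\<^sup>2)"

definition jacobi_op :: "nat \<Rightarrow> (nat \<Rightarrow> real) \<Rightarrow> (int \<Rightarrow> complex) \<Rightarrow> int \<Rightarrow> complex" where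
  "jacobi_op k q y n = y (n - 1) + y (n + 1) + of_real (periodic_ext k q n) * y n"

text \<open>The complement of the set of \<open>z\<close> for which \<open>L - z\<close> has a bounded inverse on \<open>ell2\<close>.\<close>

definition jacobi_spectrum :: "nat \<Rightarrow> (nat \<Rightarrow> real) \<Rightarrow> complex set" where
  "jacobi_spectrum k q =
     {z. \<not> (let A = (\<lambda>y n. jacobi_op k q y n - z * y n) in
              bij_betw A ell2 ell2 \<and>
              (\<exists>C. \<forall>y\<in>ell2. ell2_norm y \<le> C * ell2_norm (A y)))}"

text \<open>The solution of the difference equation on all of \<open>\<int>\<close> with \<open>y\<^sub>0 = a\<close> and \<open>y\<^sub>1 = b\<close>.\<close>

definition jacobi_sol :: "nat \<Rightarrow> (nat \<Rightarrow> real) \<Rightarrow> real \<Rightarrow> real \<Rightarrow> real \<Rightarrow> int \<Rightarrow> real" where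
  "jacobi_sol k q a b l =
     (THE y. (\<forall>n. y (n - 1) + y (n + 1) + periodic_ext k q n * y n = l * y n) \<and>
             y 0 = a \<and> y 1 = b)"

definition phi_sol :: "nat \<Rightarrow> (nat \<Rightarrow> real) \<Rightarrow> real \<Rightarrow> int \<Rightarrow> real" where
  "phi_sol k q = jacobi_sol k q 0 1"

definition theta_sol :: "nat \<Rightarrow> (nat \<Rightarrow> real) \<Rightarrow> real \<Rightarrow> int \<Rightarrow> real" where
  "theta_sol k q = jacobi_sol k q 1 0"

definition lyapunov :: "nat \<Rightarrow> (nat \<Rightarrow> real) \<Rightarrow> real \<Rightarrow> real" where
  "lyapunov k q l = phi_sol k q l (2 * int k + 1) + theta_sol k q l (2 * int k)"

text \<open>
  \<open>lm n\<close> (\<open>1 \<le> n \<le> N + 1\<close>) and \<open>lp n\<close> (\<open>0 \<le> n \<le> N\<close>) are the band edges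
  \<open>\<lambda>\<^sub>n\<^sup>-\<close> and \<open>\<lambda>\<^sub>n\<^sup>+\<close>. The spectrum as a set does not show the closed gaps
  (\<open>\<lambda>\<^sub>n\<^sup>- = \<lambda>\<^sub>n\<^sup>+\<close>); the values of the Lyapunov function make the labelling unique.
\<close>

definition band_edges ::
  "nat \<Rightarrow> (nat \<Rightarrow> real) \<Rightarrow> (nat \<Rightarrow> real) \<Rightarrow> (nat \<Rightarrow> real) \<Rightarrow> bool" where
  "band_edges k q lm lp \<longleftrightarrow>
     jacobi_spectrum k q = complex_of_real ` (\<Union>n\<in>{0..2 * k - 1}. {lp n..lm (n + 1)}) \<and>
     (\<forall>n\<in>{0..2 * k - 1}. lp n < lm (n + 1)) \<and>
     (\<forall>n\<in>{1..2 * k - 1}. lm n \<le> lp n) \<and>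
     (\<forall>n\<in>{0..2 * k - 1}. (-1) ^ (2 * k - n) * lyapunov k q (lp n) = 2) \<and>
     (\<forall>n\<in>{1..2 * k}. (-1) ^ (2 * k - n) * lyapunov k q (lm n) = 2)"

definition lam_minus :: "nat \<Rightarrow> (nat \<Rightarrow> real) \<Rightarrow> nat \<Rightarrow> real" where
  "lam_minus k q n = (THE x. \<exists>lm lp. band_edges k q lm lp \<and> x = lm n)"

definition lam_plus :: "nat \<Rightarrow> (nat \<Rightarrow> real) \<Rightarrow> nat \<Rightarrow> real" where
  "lam_plus k q n = (THE x. \<exists>lm lp. band_edges k q lm lp \<and> x = lp n)"

definition lam_crit :: "nat \<Rightarrow> (nat \<Rightarrow> real) \<Rightarrow> nat \<Rightarrow> real" where
  "lam_crit k q n =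
     (THE x. x \<in> {lam_minus k q n..lam_plus k q n} \<and> deriv (lyapunov k q) x = 0)"

definition gap_h :: "nat \<Rightarrow> (nat \<Rightarrow> real) \<Rightarrow> nat \<Rightarrow> real" where
  "gap_h k q n =
     (THE h. h \<ge> 0 \<and> lyapunov k q (lam_crit k q n) = 2 * (-1) ^ (2 * k - n) * cosh h)"

end

theory Submission
  imports Defs
begin

text \<open>
  Let \<open>L\<close> be the Jacobi operator, \<open>\<Delta>(\<lambda>, q)\<close> its Lyapunov function, \<open>c = - 2 cos \<theta>\<close> with
  \<open>\<theta> = \<pi> n / (2 k)\<close> the closed gap of the free operator, \<open>\<sigma> = (-1) ^ n\<close> and \<open>r = \<parallel>q\<parallel>\<close>.

  The asymptotics come from expanding \<open>\<Delta>\<close> in \<open>q\<close>. With \<open>t * q\<close> in place of \<open>q\<close>, \<open>\<Delta>\<close> is a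
  polynomial in \<open>t\<close>. For odd \<open>q\<close> the potential \<open>- q\<close> is \<open>q\<close> read backwards, and \<open>\<Delta>\<close> does not
  change under reversal (\<open>disc_reverse\<close>), so only even powers of \<open>t\<close> occur and
  \<open>\<Delta>(\<lambda>, q) = \<Delta>(\<lambda>, 0) + \<Delta>\<^sub>2(\<lambda>, q) + O(r ^ 4)\<close>, uniformly for \<open>\<bar>\<lambda>\<bar> \<le> 2\<close>. The free part is
  \<open>\<Delta>(2 cos p, 0) = 2 cos (2 k p)\<close>, hence \<open>\<sigma> \<Delta>(c + s, 0) = 2 - B s\<^sup>2 + O(s ^ 3)\<close> with
  \<open>B = k\<^sup>2 / sin\<^sup>2 \<theta>\<close>. At \<open>c\<close> the quadratic part is a double sum of
  \<open>q\<^sub>i q\<^sub>j sin\<^sup>2 ((i - j) \<theta>)\<close>, which for odd \<open>q\<close> collapses to the square of one sine coefficient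
  and gives \<open>\<sigma> \<Delta>\<^sub>2(c, q) = B a\<^sup>2\<close>, where \<open>a\<^sup>2\<close> is the multiple of the squared coordinate in the
  first claim (\<open>coupling_coeff_2_at_band_edge\<close>).

  The \<open>n\<close>-th gap is the interval near \<open>c\<close> on which \<open>\<sigma> \<Delta> \<ge> 2\<close>. At its two ends
  \<open>\<sigma> \<Delta> = 2\<close>, that is \<open>B s\<^sup>2 = B a\<^sup>2 + O(r ^ 3)\<close>; this is the first claim. At the critical
  point \<open>\<sigma> \<Delta>\<close> is maximal. Moving from \<open>c\<close> by \<open>s\<close> raises it by at most
  \<open>O(r\<^sup>2) \<bar>s\<bar> - s\<^sup>2 / 4 + O(r ^ 4) = O(r ^ 4)\<close>, so the maximum is \<open>2 + B a\<^sup>2 + O(r ^ 4)\<close>, and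
  \<open>2 cosh h - 2 = h\<^sup>2 + O(h ^ 4)\<close> turns this into the second claim (\<open>gap_asymptotics\<close>).

  It remains to see that the numbers in question are the ones that the spectrum defines. The
  spectrum is \<open>{\<bar>\<Delta>\<bar> \<le> 2}\<close> (\<open>jacobi_spectrum_eq\<close>): with \<open>T\<close> the shift by one period,
  \<open>\<Delta>(L) = T + inverse T\<close>, so \<open>L - z\<close> divides \<open>T + inverse T - \<Delta>(z)\<close>, which is invertible unless
  \<open>\<Delta>(z) \<in> [-2, 2]\<close>; and if \<open>\<Delta>(z) \<in> [-2, 2]\<close> there is a bounded Floquet solution, whose
  truncations are approximate eigenvectors. At a Dirichlet eigenvalue the Wronskian gives
  \<open>\<bar>\<Delta>\<bar> \<ge> 2\<close>. For small \<open>q\<close> these eigenvalues interlace the points at which the free discriminant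
  vanishes, which forces \<open>2 k\<close> sign changes of \<open>\<Delta>\<close>; as its degree is \<open>2 k\<close>, all its zeros and critical
  points are accounted for, it is monotone between consecutive critical points, and the band
  edges and the critical point in each gap exist and are unique (\<open>band_structure\<close>).
\<close>

section \<open>Three-term recurrences and their discriminant\<close>

text \<open>
  The coefficients range over an arbitrary commutative ring because three instances are needed:
  numbers, polynomials in the spectral parameter, and polynomials in the coupling constant.
\<close>

fun recsol :: "(nat \<Rightarrow> 'a::comm_ring_1) \<Rightarrow> 'a \<Rightarrow> 'a \<Rightarrow> nat \<Rightarrow> 'a" where
  "recsol c a b 0 = a"
| "recsol c a b (Suc 0) = b"
| "recsol c a b (Suc (Suc n)) = c (Suc n) * recsol c a b (Suc n) - recsol c a b n"

text \<open>
  The trace of the monodromy matrix over \<open>m\<close> steps; for a periodic potential it is the Lyapunov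
  function.
\<close>

definition disc :: "nat \<Rightarrow> (nat \<Rightarrow> 'a::comm_ring_1) \<Rightarrow> 'a" where
  "disc m c = recsol c 0 1 (Suc m) + recsol c 1 0 m"

lemma recsol_linear:
  "recsol c a b n = b * recsol c 0 1 n + a * recsol c 1 0 n"
  by (induction c a b n rule: recsol.induct) (simp_all add: algebra_simps)

lemma recsol_hom:
  assumes "\<And>x y. h (x - y) = h x - h y" "\<And>x y. h (x * y) = h x * h y"
  shows "h (recsol c a b n) = recsol (\<lambda>j. h (c j)) (h a) (h b) n"
  by (induction c a b n rule: recsol.induct) (simp_all add: assms)

lemma disc_hom:
  assumes diff: "\<And>x y. h (x - y) = h x - h y" and mult: "\<And>x y. h (x * y) = h x * h y"
    and one: "h 1 = 1"
  shows "h (disc m c) = disc m (\<lambda>j. h (c j))"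
proof -
  have zero: "h 0 = 0" using diff[of 0 0] by simp
  have "h (0 - y) = - h y" for y using diff[of 0 y] zero by simp
  then have "h (x + y) = h x + h y" for x y using diff[of x "0 - y"] by simp
  then show ?thesis
    by (simp add: disc_def recsol_hom[of h, OF diff mult] zero one)
qed

lemma recsol_cong:
  assumes "\<And>j. 1 \<le> j \<Longrightarrow> j < n \<Longrightarrow> c j = d j"
  shows "recsol c a b n = recsol d a b n"
  using assms by (induction c a b n rule: recsol.induct) simp_all

lemma disc_cong:
  assumes "\<And>j. 1 \<le> j \<Longrightarrow> j \<le> m \<Longrightarrow> c j = d j"
  shows "disc m c = disc m d"
  unfolding disc_def using assms
  by (intro arg_cong2[of _ _ _ _ "(+)"] recsol_cong) simp_all

lemma recsol_Suc_shift:
  "recsol c a b (Suc n) = recsol (\<lambda>j. c (Suc j)) b (c 1 * b - a) n"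
proof (induction n rule: less_induct)
  case (less n)
  consider "n = 0" | "n = 1" | m where "n = Suc (Suc m)"
    by (metis One_nat_def not0_implies_Suc)
  then show ?case
  proof cases
    case 3
    then show ?thesis using less[of "Suc m"] less[of m] by (simp only: recsol.simps)
  qed simp_all
qed

text \<open>
  Each transfer matrix has determinant \<open>1\<close>, and so has their product.
\<close>

lemma wronskian_recsol:
  "recsol c 0 1 (Suc n) * recsol c 1 0 n - recsol c 0 1 n * recsol c 1 0 (Suc n) = 1"
  by (induction n) (simp_all add: algebra_simps)

text \<open>
  \<open>recsol c 0 1 (n + 1)\<close> is the continuant \<open>K(c\<^sub>1, \<dots>, c\<^sub>n)\<close>, the determinant of a tridiagonal
  matrix. The defining recurrence expands it along the last row; this is the expansion along the
  first one.
\<close>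

lemma continuant_left:
  "recsol c 0 1 (Suc (Suc (Suc n)))
     = c 1 * recsol (\<lambda>j. c (Suc j)) 0 1 (Suc (Suc n)) - recsol (\<lambda>j. c (Suc (Suc j))) 0 1 (Suc n)"
proof -
  have "recsol c 0 1 (Suc (Suc (Suc n))) = recsol (\<lambda>j. c (Suc j)) 1 (c 1) (Suc (Suc n))"
    by (subst recsol_Suc_shift) simp
  also have "\<dots> = c 1 * recsol (\<lambda>j. c (Suc j)) 0 1 (Suc (Suc n))
                  + recsol (\<lambda>j. c (Suc j)) 1 0 (Suc (Suc n))"
    by (subst recsol_linear) simp
  also have "recsol (\<lambda>j. c (Suc j)) 1 0 (Suc (Suc n)) = recsol (\<lambda>j. c (Suc (Suc j))) 0 (-1) (Suc n)"
    by (subst recsol_Suc_shift) simp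
  also have "\<dots> = - recsol (\<lambda>j. c (Suc (Suc j))) 0 1 (Suc n)"
    by (subst recsol_linear) simp
  finally show ?thesis by simp
qed

text \<open>
  The expansion along the last row of the reversed sequence is the expansion along the first row of
  the original one.
\<close>

lemma continuant_reverse:
  "recsol (\<lambda>j. c (Suc n - j)) 0 1 (Suc n) = recsol c 0 1 (Suc n)"
proof (induction n rule: less_induct)
  case (less n)
  consider "n = 0" | "n = 1" | m where "n = Suc (Suc m)"
    by (metis One_nat_def not0_implies_Suc)
  then show ?case
  proof cases
    case 3
    have "recsol (\<lambda>j. c (Suc n - j)) 0 1 (Suc n)
        = c n * recsol (\<lambda>j. c (Suc (Suc m) - j)) 0 1 (Suc (Suc m))
          - recsol (\<lambda>j. c (Suc m - j)) 0 1 (Suc m)"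
      unfolding 3 by (subst continuant_left) simp
    also have "\<dots> = c n * recsol c 0 1 (Suc (Suc m)) - recsol c 0 1 (Suc m)"
      using less[of "Suc m"] less[of m] 3 by (simp del: recsol.simps)
    finally show ?thesis unfolding 3 by simp
  qed simp_all
qed

text \<open>
  Writing the discriminant as \<open>K(c\<^sub>1, \<dots>, c\<^sub>m) - K(c\<^sub>2, \<dots>, c\<^sub>m\<^sub>-\<^sub>1)\<close> makes its symmetries visible:
  both continuants are invariant under reversal.
\<close>

lemma disc_continuant:
  "disc (Suc (Suc m)) c
     = recsol c 0 1 (Suc (Suc (Suc m))) - recsol (\<lambda>j. c (Suc j)) 0 1 (Suc m)"
proof -
  have "recsol c 1 0 (Suc (Suc m)) = recsol (\<lambda>j. c (Suc j)) 0 (- 1) (Suc m)"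
    by (subst recsol_Suc_shift) simp
  also have "\<dots> = - recsol (\<lambda>j. c (Suc j)) 0 1 (Suc m)"
    by (subst recsol_linear) simp
  finally show ?thesis by (simp add: disc_def)
qed

lemma disc_reverse:
  "disc (Suc (Suc m)) (\<lambda>j. c (Suc (Suc (Suc m)) - j)) = disc (Suc (Suc m)) c"
proof -
  have "recsol (\<lambda>j. c (Suc (Suc (Suc m)) - Suc j)) 0 1 (Suc m)
      = recsol (\<lambda>j. c (Suc (Suc m - j))) 0 1 (Suc m)"
    by (rule recsol_cong) (simp add: Suc_diff_le)
  also have "\<dots> = recsol (\<lambda>j. c (Suc j)) 0 1 (Suc m)"
    using continuant_reverse[of "\<lambda>j. c (Suc j)" m] by (simp del: recsol.simps)
  finally show ?thesis
    using continuant_reverse[of c "Suc (Suc m)"] unfolding disc_continuant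
    by (simp del: recsol.simps)
qed

text \<open>
  Cyclic invariance of the trace: both sides expand to
  \<open>c\<^sub>1 K(c\<^sub>2, \<dots>, c\<^sub>m) - K(c\<^sub>2, \<dots>, c\<^sub>m\<^sub>-\<^sub>1) - K(c\<^sub>3, \<dots>, c\<^sub>m)\<close>.
\<close>

lemma disc_cyclic:
  assumes "c (Suc (Suc (Suc m))) = c 1"
  shows "disc (Suc (Suc m)) (\<lambda>j. c (Suc j)) = disc (Suc (Suc m)) c"
  unfolding disc_continuant continuant_left[of c]
  using assms by simp

lemma recsol_linear_factors_monic:
  fixes e :: "nat \<Rightarrow> 'a::{comm_ring_1, ring_1_no_zero_divisors}"
  defines "y \<equiv> recsol (\<lambda>j. [:e j, 1:]) 0 1"
  shows "degree (y (Suc n)) = n \<and> lead_coeff (y (Suc n)) = 1"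
proof (induction n rule: less_induct)
  case (less n)
  consider "n = 0" | "n = 1" | m where "n = Suc (Suc m)"
    by (metis One_nat_def not0_implies_Suc)
  then show ?case
  proof cases
    case 3
    have "Suc m < n" "m < n" using 3 by auto
    then have 1: "degree (y (Suc (Suc m))) = Suc m" "lead_coeff (y (Suc (Suc m))) = 1"
      "degree (y (Suc m)) = m" using less by blast+
    have nz: "y (Suc (Suc m)) \<noteq> 0" using 1 by auto
    have d: "degree ([:e (Suc (Suc m)), 1:] * y (Suc (Suc m))) = n"
      using nz 1 3 by (subst degree_mult_eq) auto
    let ?p = "[:e (Suc (Suc m)), 1:] * y (Suc (Suc m))"
    have lt: "degree (- y (Suc m)) < degree ?p" using 1 3 d by simp
    have e: "y (Suc n) = ?p + - y (Suc m)" by (simp add: y_def 3)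
    have "degree (y (Suc n)) = n" unfolding e degree_add_eq_left[OF lt] by (rule d)
    moreover have "coeff (- y (Suc m)) n = 0" using lt d by (intro coeff_eq_0) simp
    moreover have "lead_coeff ?p = 1" using 1 by (simp only: lead_coeff_mult) simp
    ultimately show ?thesis using d e by (simp only: coeff_add) simp
  qed (simp_all add: y_def)
qed

lemma degree_disc_linear_factors:
  fixes e :: "nat \<Rightarrow> 'a::{comm_ring_1, ring_1_no_zero_divisors}"
  assumes "m \<ge> 2"
  shows "degree (disc m (\<lambda>j. [:e j, 1:])) = m"
proof -
  obtain n where "m = 2 + n" using assms le_Suc_ex by blast
  then have m: "m = Suc (Suc n)" by simp
  define p where "p = recsol (\<lambda>j. [:e j, 1:]) 0 1 (Suc m)"
  define r where "r = recsol (\<lambda>j. [:e (Suc j), 1:]) 0 1 (Suc n)"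
  have e: "disc m (\<lambda>j. [:e j, 1:]) = p + - r"
    unfolding m disc_continuant p_def r_def by simp
  have p: "degree p = m" and r: "degree r = n"
    using recsol_linear_factors_monic[of e m]
      recsol_linear_factors_monic[of "\<lambda>j. e (Suc j)" n]
    by (auto simp: p_def r_def)
  have "degree (- r) < degree p" using p r m by simp
  from degree_add_eq_left[OF this] show ?thesis unfolding e p .
qed

section \<open>Two-sided solutions and the Lyapunov function\<close>

text \<open>
  To the left of \<open>0\<close> the recurrence runs backwards: \<open>n \<mapsto> y (1 - n)\<close> solves a recurrence of the
  same form with reflected coefficients.
\<close>

definition zsol :: "(int \<Rightarrow> 'a::comm_ring_1) \<Rightarrow> 'a \<Rightarrow> 'a \<Rightarrow> int \<Rightarrow> 'a" where
  "zsol c a b n = (if n \<ge> 0 then recsol (\<lambda>j. c (int j)) a b (nat n)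
                   else recsol (\<lambda>j. c (1 - int j)) b a (nat (1 - n)))"

lemma zsol_rec: "zsol c a b (n + 1) = c n * zsol c a b n - zsol c a b (n - 1)"
proof -
  consider m where "n = int (Suc m)" | "n = 0" | m where "n = - int (Suc m)"
    by (metis int_cases not0_implies_Suc of_nat_0)
  then show ?thesis
  proof cases
    case 1
    then have "nat (n + 1) = Suc (Suc m)" "nat n = Suc m" "nat (n - 1) = m" by auto
    then show ?thesis using 1 by (simp add: zsol_def)
  next
    case 2
    then show ?thesis by (simp add: zsol_def numeral_2_eq_2)
  next
    case 3
    then have *: "nat (1 - (n + 1)) = Suc m" "nat (1 - n) = Suc (Suc m)"
      "nat (1 - (n - 1)) = Suc (Suc (Suc m))" by auto
    have **: "1 - int (Suc (Suc m)) = n" using 3 by simp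
    show ?thesis
    proof (cases m)
      case 0
      then show ?thesis using 3 * ** by (simp add: zsol_def)
    next
      case (Suc l)
      then show ?thesis using 3 * ** by (simp add: zsol_def)
    qed
  qed
qed

lemma zsol_init: "zsol c a b 0 = a" "zsol c a b 1 = b"
  by (simp_all add: zsol_def)

lemma zsol_unique:
  fixes c :: "int \<Rightarrow> 'a::comm_ring_1"
  assumes "\<And>n. y (n + 1) = c n * y n - y (n - 1)"
  shows "y n = zsol c (y 0) (y 1) n"
proof -
  let ?z = "zsol c (y 0) (y 1)"
  have fwd: "y (int m) = ?z (int m) \<and> y (int m + 1) = ?z (int m + 1)" for m
  proof (induction m)
    case (Suc m)
    then show ?case
      using assms[of "int m + 1"] zsol_rec[of c "y 0" "y 1" "int m + 1"] by (simp add: add.commute)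
  qed (simp add: zsol_init)
  have bwd: "y (- int m) = ?z (- int m) \<and> y (1 - int m) = ?z (1 - int m)" for m
  proof (induction m)
    case (Suc m)
    have "y (- 1 - int m) = c (- int m) * y (- int m) - y (1 - int m)"
      using assms[of "- int m"] by (simp add: diff_diff_eq2 uminus_add_conv_diff minus_diff_commute)
    moreover have "?z (- 1 - int m) = c (- int m) * ?z (- int m) - ?z (1 - int m)"
      using zsol_rec[of c "y 0" "y 1" "- int m"]
      by (simp add: diff_diff_eq2 uminus_add_conv_diff minus_diff_commute)
    ultimately have "y (- 1 - int m) = ?z (- 1 - int m)" using Suc by metis
    then show ?case using Suc by simp
  qed (simp add: zsol_init)
  show ?thesis
    using fwd bwd by (cases n rule: int_cases2) auto
qed

lemma jacobi_sol_eq: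
  "jacobi_sol k q a b l = zsol (\<lambda>n. l - periodic_ext k q n) a b"
proof -
  let ?c = "\<lambda>n. l - periodic_ext k q n"
  have iff: "(\<forall>n. y (n - 1) + y (n + 1) + periodic_ext k q n * y n = l * y n) \<longleftrightarrow>
    (\<forall>n. y (n + 1) = ?c n * y n - y (n - 1))" for y
    
  proof (intro all_cong1)
    fix n
    have "y (n - 1) + y (n + 1) + periodic_ext k q n * y n - l * y n
        = y (n + 1) - (?c n * y n - y (n - 1))"
      by (simp add: left_diff_distrib)
    then show "(y (n - 1) + y (n + 1) + periodic_ext k q n * y n = l * y n) \<longleftrightarrow>
      (y (n + 1) = ?c n * y n - y (n - 1))" by (metis eq_iff_diff_eq_0)
  qed
  show ?thesis unfolding jacobi_sol_def iff
  proof (rule the_equality)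
    fix y assume y: "(\<forall>n. y (n + 1) = ?c n * y n - y (n - 1)) \<and> y 0 = a \<and> y 1 = b"
    have "y n = zsol ?c (y 0) (y 1) n" for n using y by (intro zsol_unique) blast
    then show "y = zsol ?c a b" using y by auto
  qed (simp add: zsol_rec zsol_init)
qed

lemma periodic_ext_of_nat:
  assumes "1 \<le> j" "j \<le> 2 * k"
  shows "periodic_ext k q (int j) = q j"
proof -
  have "(int j - 1) mod (2 * int k) = int j - 1" using assms by (intro mod_pos_pos_trivial) auto
  then have "nat ((int j - 1) mod (2 * int k)) + 1 = j" using assms by simp
  then show ?thesis by (simp add: periodic_ext_def)
qed

lemma periodic_ext_period: "periodic_ext k q (n + 2 * int k) = periodic_ext k q n"
proof -
  have "(n + 2 * int k - 1) mod (2 * int k) = (n - 1 + 2 * int k) mod (2 * int k)"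
    by (simp add: algebra_simps)
  then show ?thesis by (simp add: periodic_ext_def)
qed

lemma lyapunov_eq_disc:
  "lyapunov k q l = disc (2 * k) (\<lambda>j. l - q j)"
proof -
  have "nat (2 * int k + 1) = Suc (2 * k)" "nat (2 * int k) = 2 * k" by auto
  then have "lyapunov k q l = disc (2 * k) (\<lambda>j. l - periodic_ext k q (int j))"
    by (simp add: lyapunov_def phi_sol_def theta_sol_def jacobi_sol_eq zsol_def disc_def)
  also have "\<dots> = disc (2 * k) (\<lambda>j. l - q j)"
    by (rule disc_cong) (simp add: periodic_ext_of_nat)
  finally show ?thesis .
qed

definition lyap_poly :: "nat \<Rightarrow> (nat \<Rightarrow> real) \<Rightarrow> real poly" where
  "lyap_poly k q = disc (2 * k) (\<lambda>j. [:- q j, 1:])"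

lemma lyapunov_eq_poly: "lyapunov k q = poly (lyap_poly k q)"
proof
  fix l
  have "poly (lyap_poly k q) l = disc (2 * k) (\<lambda>j. poly [:- q j, 1:] l)"
    unfolding lyap_poly_def by (rule disc_hom) simp_all
  then show "lyapunov k q l = poly (lyap_poly k q) l" by (simp add: lyapunov_eq_disc)
qed

section \<open>Square-summable sequences and a constant-coefficient resolvent\<close>

text \<open>
  A bound on all finite partial norms. It says that \<open>y\<close> is square summable with norm at most \<open>C\<close>,
  and it passes to pointwise limits without any discussion of infinite sums.
\<close>

definition ell2_le :: "(int \<Rightarrow> complex) \<Rightarrow> real \<Rightarrow> bool" where
  "ell2_le y C \<longleftrightarrow> (\<forall>F. finite F \<longrightarrow> L2_set (\<lambda>n. cmod (y n)) F \<le> C)"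

lemma ell2_leD: "ell2_le y C \<Longrightarrow> finite F \<Longrightarrow> L2_set (\<lambda>n. cmod (y n)) F \<le> C"
  by (simp add: ell2_le_def)

lemma ell2_le_nonneg: "ell2_le y C \<Longrightarrow> 0 \<le> C"
  using ell2_leD[of y C "{}"] by simp

lemma ell2_le_mono: "ell2_le y C \<Longrightarrow> C \<le> D \<Longrightarrow> ell2_le y D"
  unfolding ell2_le_def by fastforce

lemma ell2_le_imp:
  assumes "ell2_le y C"
  shows "y \<in> ell2" "ell2_norm y \<le> C"
proof -
  have C: "0 \<le> C" using assms by (rule ell2_le_nonneg)
  have le: "(\<Sum>n\<in>F. (cmod (y n))\<^sup>2) \<le> C\<^sup>2" if "finite F" for F
    using ell2_leD[OF assms that] unfolding L2_set_def by (rule sqrt_le_D)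
  have s: "(\<lambda>n. (cmod (y n))\<^sup>2) summable_on UNIV"
    by (rule nonneg_bdd_above_summable_on) (auto intro!: bdd_aboveI[where M = "C\<^sup>2"] le)
  then show "y \<in> ell2" by (simp add: ell2_def)
  have "(\<Sum>\<^sub>\<infinity>n. (cmod (y n))\<^sup>2) \<le> C\<^sup>2"
    using s by (rule infsum_le_finite_sums) (rule le)
  then show "ell2_norm y \<le> C"
    unfolding ell2_norm_def using C by (intro real_le_lsqrt infsum_nonneg) auto
qed

lemma ell2_imp_le:
  assumes "y \<in> ell2"
  shows "ell2_le y (ell2_norm y)"
  unfolding ell2_le_def L2_set_def ell2_norm_def
proof (intro allI impI real_sqrt_le_mono)
  fix F :: "int set" assume "finite F"
  then show "(\<Sum>n\<in>F. (cmod (y n))\<^sup>2) \<le> (\<Sum>\<^sub>\<infinity>n. (cmod (y n))\<^sup>2)"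
    using assms by (intro finite_sum_le_infsum) (auto simp: ell2_def)
qed

lemma ell2_le_add:
  assumes "ell2_le y C" "ell2_le w D"
  shows "ell2_le (\<lambda>n. y n + w n) (C + D)"
  unfolding ell2_le_def
proof (intro allI impI)
  fix F :: "int set" assume F: "finite F"
  have "L2_set (\<lambda>n. cmod (y n + w n)) F \<le> L2_set (\<lambda>n. cmod (y n) + cmod (w n)) F"
    by (rule L2_set_mono) (auto intro: norm_triangle_ineq)
  also have "\<dots> \<le> L2_set (\<lambda>n. cmod (y n)) F + L2_set (\<lambda>n. cmod (w n)) F"
    by (rule L2_set_triangle_ineq)
  also have "\<dots> \<le> C + D" using assms F by (intro add_mono ell2_leD)
  finally show "L2_set (\<lambda>n. cmod (y n + w n)) F \<le> C + D" .
qed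

lemma ell2_le_mult:
  assumes "ell2_le y C" "\<And>n. cmod (a n) \<le> K"
  shows "ell2_le (\<lambda>n. a n * y n) (K * C)"
  unfolding ell2_le_def
proof (intro allI impI)
  fix F :: "int set" assume F: "finite F"
  have K: "0 \<le> K" using assms(2)[of 0] norm_ge_zero order_trans by blast
  have "L2_set (\<lambda>n. cmod (a n * y n)) F \<le> L2_set (\<lambda>n. K * cmod (y n)) F"
    by (rule L2_set_mono) (auto simp: norm_mult intro: mult_right_mono assms)
  also have "\<dots> = K * L2_set (\<lambda>n. cmod (y n)) F" using K by (rule L2_set_right_distrib[symmetric])
  also have "\<dots> \<le> K * C" using K assms(1) F by (intro mult_left_mono ell2_leD)
  finally show "L2_set (\<lambda>n. cmod (a n * y n)) F \<le> K * C" .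
qed

lemma ell2_le_cmult: "ell2_le y C \<Longrightarrow> ell2_le (\<lambda>n. a * y n) (cmod a * C)"
  using ell2_le_mult[of y C "\<lambda>_. a" "cmod a"] by simp

lemma ell2_le_shift:
  assumes "ell2_le y C"
  shows "ell2_le (\<lambda>n. y (n + t)) C"
  unfolding ell2_le_def
proof (intro allI impI)
  fix F :: "int set" assume F: "finite F"
  have "L2_set (\<lambda>n. cmod (y (n + t))) F = L2_set (\<lambda>n. cmod (y n)) ((\<lambda>n. n + t) ` F)"
    by (simp add: L2_set_def sum.reindex)
  also have "\<dots> \<le> C" using F assms by (intro ell2_leD) auto
  finally show "L2_set (\<lambda>n. cmod (y (n + t))) F \<le> C" .
qed

lemma ell2_le_limit:
  assumes "\<And>j. ell2_le (Y j) C" "\<And>n. (\<lambda>j. Y j n) \<longlonglongrightarrow> y n"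
  shows "ell2_le y C"
  unfolding ell2_le_def
proof (intro allI impI)
  fix F :: "int set" assume F: "finite F"
  have "(\<lambda>j. L2_set (\<lambda>n. cmod (Y j n)) F) \<longlonglongrightarrow> L2_set (\<lambda>n. cmod (y n)) F"
    unfolding L2_set_def by (intro tendsto_intros assms)
  then show "L2_set (\<lambda>n. cmod (y n)) F \<le> C"
    by (rule Lim_bounded) (use assms(1) F in \<open>auto intro: ell2_leD\<close>)
qed

lemma ell2_le_point: "ell2_le y C \<Longrightarrow> cmod (y n) \<le> C"
  using ell2_leD[of y C "{n}"] by simp

lemma ell2_le_finite_support:
  assumes "finite S" "\<And>n. n \<notin> S \<Longrightarrow> y n = 0"
  shows "ell2_le y (\<Sum>n\<in>S. cmod (y n))"
  unfolding ell2_le_def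
proof (intro allI impI)
  fix F :: "int set" assume F: "finite F"
  have "L2_set (\<lambda>n. cmod (y n)) F \<le> (\<Sum>n\<in>F. cmod (y n))" by (rule L2_set_le_sum) simp
  also have "\<dots> = (\<Sum>n\<in>F \<inter> S. cmod (y n))"
    using F assms by (intro sum.mono_neutral_right) auto
  also have "\<dots> \<le> (\<Sum>n\<in>S. cmod (y n))" using assms by (intro sum_mono2) auto
  finally show "L2_set (\<lambda>n. cmod (y n)) F \<le> (\<Sum>n\<in>S. cmod (y n))" .
qed

text \<open>
  Neumann series \<open>y = (\<Sum>j. \<mu> ^ j * T ^ j f)\<close> for the shift \<open>T\<close> by \<open>t\<close>. It converges pointwise since
  \<open>f\<close> is bounded, and its partial sums are uniformly bounded in norm since \<open>T\<close> is an isometry.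
\<close>

lemma shift_resolvent_solvable:
  fixes \<mu> :: complex
  assumes mu: "cmod \<mu> < 1" and f: "ell2_le f C"
  shows "\<exists>y. y \<in> ell2 \<and> (\<forall>n. y n - \<mu> * y (n + t) = f n)"
proof -
  define Y where "Y J n = (\<Sum>j<J. \<mu> ^ j * f (n + int j * t))" for J n
  define y where "y n = (\<Sum>j. \<mu> ^ j * f (n + int j * t))" for n
  have C: "0 \<le> C" using f by (rule ell2_le_nonneg)
  have "summable (\<lambda>j. \<mu> ^ j * f (n + int j * t))" for n
  proof (rule summable_comparison_test)
    show "\<exists>N. \<forall>j\<ge>N. norm (\<mu> ^ j * f (n + int j * t)) \<le> cmod \<mu> ^ j * C"
      by (auto simp: norm_mult norm_power intro!: mult_left_mono ell2_le_point f)
    show "summable (\<lambda>j. cmod \<mu> ^ j * C)"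
      using mu by (intro summable_mult2 summable_geometric) simp
  qed
  then have lim: "(\<lambda>J. Y J n) \<longlonglongrightarrow> y n" for n
    unfolding Y_def y_def by (rule summable_LIMSEQ)
  have "ell2_le (Y J) (\<Sum>j<J. cmod \<mu> ^ j * C)" for J
  proof (induction J)
    case 0
    then show ?case by (simp add: Y_def ell2_le_def L2_set_def)
  next
    case (Suc J)
    have "ell2_le (\<lambda>n. \<mu> ^ J * f (n + int J * t)) (cmod (\<mu> ^ J) * C)"
      by (intro ell2_le_cmult ell2_le_shift f)
    from ell2_le_add[OF Suc this] show ?case by (simp add: Y_def norm_power)
  qed
  moreover have "(\<Sum>j<J. cmod \<mu> ^ j * C) \<le> C / (1 - cmod \<mu>)" for J
  proof -
    have "(\<Sum>j<J. cmod \<mu> ^ j) \<le> (\<Sum>j. cmod \<mu> ^ j)"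
      using mu by (intro sum_le_suminf summable_geometric) auto
    also have "\<dots> = 1 / (1 - cmod \<mu>)" using mu by (intro suminf_geometric) auto
    finally have "(\<Sum>j<J. cmod \<mu> ^ j) * C \<le> 1 / (1 - cmod \<mu>) * C"
      using C by (rule mult_right_mono)
    then show ?thesis by (simp add: sum_distrib_right)
  qed
  ultimately have "ell2_le (Y J) (C / (1 - cmod \<mu>))" for J by (rule ell2_le_mono)
  then have "ell2_le y (C / (1 - cmod \<mu>))" using lim by (rule ell2_le_limit)
  moreover have "y n - \<mu> * y (n + t) = f n" for n
  proof -
    have "Y (Suc J) n = f n + \<mu> * Y J (n + t)" for J
      unfolding Y_def sum.lessThan_Suc_shift sum_distrib_left
      by (simp add: algebra_simps)
    then have "(\<lambda>J. Y (Suc J) n) \<longlonglongrightarrow> f n + \<mu> * y (n + t)"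
      by (simp add: tendsto_intros lim)
    moreover have "(\<lambda>J. Y (Suc J) n) \<longlonglongrightarrow> y n" using lim by (rule LIMSEQ_Suc)
    ultimately have "y n = f n + \<mu> * y (n + t)" by (rule LIMSEQ_unique[OF _ _, rotated])
    then show ?thesis by simp
  qed
  ultimately show ?thesis using ell2_le_imp by blast
qed

lemma shift_resolvent_bound:
  fixes \<mu> :: complex
  assumes mu: "cmod \<mu> < 1" and y: "y \<in> ell2" and f: "ell2_le (\<lambda>n. y n - \<mu> * y (n + t)) C"
  shows "ell2_le y (C / (1 - cmod \<mu>))"
proof -
  have "ell2_le (\<lambda>n. (y n - \<mu> * y (n + t)) + \<mu> * y (n + t)) (C + cmod \<mu> * ell2_norm y)"
    by (intro ell2_le_add f ell2_le_cmult ell2_le_shift ell2_imp_le y)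
  then have "ell2_norm y \<le> C + cmod \<mu> * ell2_norm y" by (intro ell2_le_imp) simp
  then have "ell2_norm y \<le> C / (1 - cmod \<mu>)"
    using mu by (simp add: pos_le_divide_eq algebra_simps)
  then show ?thesis using ell2_le_mono[OF ell2_imp_le[OF y]] by simp
qed

text \<open>
  The two roots of \<open>\<mu> + 1 / \<mu> = d\<close> have product \<open>1\<close>. If they lie on the unit circle, they are
  conjugate and their sum \<open>d\<close> is real of modulus at most \<open>2\<close>; otherwise one is inside.
\<close>

lemma joukowski_inside_disc:
  fixes d :: complex
  assumes "\<not> (\<exists>r. \<bar>r\<bar> \<le> 2 \<and> d = complex_of_real r)"
  obtains \<mu> where "cmod \<mu> < 1" "\<mu> \<noteq> 0" "d * \<mu> = 1 + \<mu>\<^sup>2"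
proof -
  define s where "s = csqrt (d\<^sup>2 - 4)"
  define a where "a = (d + s) / 2"
  define b where "b = (d - s) / 2"
  have s: "s\<^sup>2 = d\<^sup>2 - 4" by (simp add: s_def)
  have ab: "a * b = 1" "a + b = d"
    using s by (simp_all add: a_def b_def field_simps power2_eq_square)
  have q: "d * a = 1 + a\<^sup>2" "d * b = 1 + b\<^sup>2"
    using ab by (auto simp: power2_eq_square algebra_simps simp flip: ab(2))
  have nz: "a \<noteq> 0" "b \<noteq> 0" using ab by auto
  have "cmod a \<noteq> 1"
  proof
    assume "cmod a = 1"
    then have "a * cnj a = 1" by (simp add: complex_norm_square[symmetric])
    then have "b = cnj a" using ab(1) nz by (metis mult_left_cancel)
    then have "d = complex_of_real (2 * Re a)" using ab(2) by (simp add: complex_eq_iff)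
    moreover have "\<bar>2 * Re a\<bar> \<le> 2" using abs_Re_le_cmod[of a] \<open>cmod a = 1\<close> by simp
    ultimately show False using assms by blast
  qed
  moreover have "cmod a * cmod b = 1" using ab(1) by (metis norm_mult norm_one)
  ultimately have "cmod a < 1 \<or> cmod b < 1"
    by (metis linorder_neqE_linordered_idom mult.right_neutral mult_strict_left_mono
        norm_ge_zero order.strict_trans2 nz(1) zero_less_norm_iff not_less less_eq_real_def)
  then show ?thesis using that q nz by blast
qed

text \<open>
  With \<open>d = \<mu> + 1 / \<mu>\<close> and \<open>T\<close> the shift by \<open>t\<close>, the operator factors as
  \<open>- (1 / \<mu>) (1 - \<mu> T) (1 - \<mu> (inverse T))\<close>, and for \<open>\<bar>\<mu>\<bar> < 1\<close> both factors are invertible.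
\<close>

lemma laplacian_shift_invertible:
  fixes d :: complex and t :: int
  assumes "\<not> (\<exists>r. \<bar>r\<bar> \<le> 2 \<and> d = complex_of_real r)"
  defines "W \<equiv> \<lambda>y n. y (n + t) + y (n - t) - d * y n"
  obtains K where "\<And>y C. y \<in> ell2 \<Longrightarrow> ell2_le (W y) C \<Longrightarrow> ell2_le y (K * C)"
    and "\<And>f. f \<in> ell2 \<Longrightarrow> \<exists>y\<in>ell2. W y = f"
proof -
  obtain \<mu> where mu: "cmod \<mu> < 1" "\<mu> \<noteq> 0" "d * \<mu> = 1 + \<mu>\<^sup>2"
    using joukowski_inside_disc[OF assms(1)] by blast
  define B where "B y n = y n - \<mu> * y (n - t)" for y and n :: int
  \<comment> \<open>\<open>B\<close> is the factor \<open>1 - \<mu> (inverse T)\<close>, applied first.\<close>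
  have fact: "B y n - \<mu> * B y (n + t) = - \<mu> * W y n" for y n
  proof -
    have "B y n - \<mu> * B y (n + t) = (1 + \<mu>\<^sup>2) * y n - \<mu> * (y (n + t) + y (n - t))"
      by (simp add: B_def power2_eq_square algebra_simps)
    also have "\<dots> = - \<mu> * W y n"
      unfolding mu(3)[symmetric] W_def by (simp add: algebra_simps)
    finally show ?thesis .
  qed
  have Bell: "B y \<in> ell2" if "y \<in> ell2" for y
  proof -
    have "ell2_le (\<lambda>n. y n + (- \<mu>) * y (n + (- t))) (ell2_norm y + cmod (- \<mu>) * ell2_norm y)"
      by (intro ell2_le_add ell2_le_cmult ell2_le_shift ell2_imp_le that)
    then show ?thesis unfolding B_def by (intro ell2_le_imp) simp
  qed
  show ?thesis
  proof
    fix y C assume y: "y \<in> ell2" and W: "ell2_le (W y) C"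
    have "ell2_le (\<lambda>n. B y n - \<mu> * B y (n + t)) (cmod (- \<mu>) * C)"
      unfolding fact using W by (rule ell2_le_cmult)
    from shift_resolvent_bound[OF mu(1) Bell[OF y] this]
    have "ell2_le (\<lambda>n. y n - \<mu> * y (n + (- t))) (cmod (- \<mu>) * C / (1 - cmod \<mu>))"
      by (simp add: B_def[abs_def])
    from shift_resolvent_bound[OF mu(1) y this]
    show "ell2_le y (cmod \<mu> / (1 - cmod \<mu>) / (1 - cmod \<mu>) * C)" by simp
  next
    fix f assume f: "f \<in> ell2"
    have "ell2_le (\<lambda>n. - \<mu> * f n) (cmod (- \<mu>) * ell2_norm f)"
      by (intro ell2_le_cmult ell2_imp_le f)
    from shift_resolvent_solvable[OF mu(1) this, of t]
    obtain u where u: "u \<in> ell2" "\<And>n. u n - \<mu> * u (n + t) = - \<mu> * f n" by blast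
    from shift_resolvent_solvable[OF mu(1) ell2_imp_le[OF u(1)], of "- t"]
    obtain y where y: "y \<in> ell2" "\<And>n. y n - \<mu> * y (n - t) = u n" by auto
    have "B y = u" using y by (auto simp: B_def)
    then have "- \<mu> * W y n = - \<mu> * f n" for n
      using fact[of y n] u(2)[of n] by auto
    then have "W y = f" using mu(2) by auto
    then show "\<exists>y\<in>ell2. W y = f" using y(1) by blast
  qed
qed

section \<open>The discriminant as a function of the operator\<close>

text \<open>
  The sequence \<open>p(L) y\<close> for the Jacobi operator \<open>L\<close>. It makes sense for every sequence \<open>y\<close>, since
  \<open>L\<close> is local.
\<close>

definition poly_act :: "nat \<Rightarrow> (nat \<Rightarrow> real) \<Rightarrow> complex poly \<Rightarrow> (int \<Rightarrow> complex) \<Rightarrow> int \<Rightarrow> complex" where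
  "poly_act k q p y n = (\<Sum>i\<le>degree p. coeff p i * (jacobi_op k q ^^ i) y n)"

lemma poly_act_bound:
  assumes "degree p \<le> N"
  shows "poly_act k q p y n = (\<Sum>i\<le>N. coeff p i * (jacobi_op k q ^^ i) y n)"
  unfolding poly_act_def using assms
  by (intro sum.mono_neutral_left) (auto simp: coeff_eq_0)

lemma poly_act_diff: "poly_act k q (p - r) y n = poly_act k q p y n - poly_act k q r y n"
proof -
  let ?N = "max (degree p) (degree r)"
  have "degree (p - r) \<le> ?N" by (rule degree_diff_le_max)
  then show ?thesis
    using poly_act_bound[of "p - r" ?N] poly_act_bound[of p ?N] poly_act_bound[of r ?N]
    by (simp add: sum_subtractf left_diff_distrib)
qed

lemma poly_act_add: "poly_act k q (p + r) y n = poly_act k q p y n + poly_act k q r y n"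
proof -
  let ?N = "max (degree p) (degree r)"
  have "degree (p + r) \<le> ?N" by (rule degree_add_le_max)
  then show ?thesis
    using poly_act_bound[of "p + r" ?N] poly_act_bound[of p ?N] poly_act_bound[of r ?N]
    by (simp add: sum.distrib distrib_right)
qed

lemma poly_act_smult: "poly_act k q (smult a p) y n = a * poly_act k q p y n"
proof -
  have "poly_act k q (smult a p) y n
      = (\<Sum>i\<le>degree p. coeff (smult a p) i * (jacobi_op k q ^^ i) y n)"
    by (rule poly_act_bound) (rule degree_smult_le)
  then show ?thesis by (simp add: poly_act_def sum_distrib_left mult.assoc)
qed

lemma poly_act_0 [simp]: "poly_act k q 0 y n = 0"
  by (simp add: poly_act_def)

lemma poly_act_pCons:
  "poly_act k q (pCons a p) y n = a * y n + poly_act k q p (jacobi_op k q y) n"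
proof -
  have "poly_act k q (pCons a p) y n
      = (\<Sum>i\<le>Suc (degree p). coeff (pCons a p) i * (jacobi_op k q ^^ i) y n)"
    by (rule poly_act_bound) (rule degree_pCons_le)
  also have "\<dots> = a * y n + (\<Sum>i\<le>degree p. coeff p i * (jacobi_op k q ^^ Suc i) y n)"
    by (subst sum.atMost_Suc_shift) simp
  finally show ?thesis by (simp add: poly_act_def funpow_swap1)
qed

lemma poly_act_1 [simp]: "poly_act k q 1 y n = y n"
  by (simp add: one_pCons poly_act_pCons)

lemma jacobi_op_poly_act: "jacobi_op k q (poly_act k q p y) = poly_act k q p (jacobi_op k q y)"
proof
  fix n
  have "poly_act k q p (jacobi_op k q y) n = (\<Sum>i\<le>degree p. coeff p i * jacobi_op k q ((jacobi_op k q ^^ i) y) n)"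
    by (simp add: poly_act_def funpow_swap1)
  also have "\<dots> = jacobi_op k q (poly_act k q p y) n"
    by (simp add: jacobi_op_def poly_act_def sum.distrib sum_distrib_left algebra_simps)
  finally show "jacobi_op k q (poly_act k q p y) n = poly_act k q p (jacobi_op k q y) n" by simp
qed

lemma poly_act_mult: "poly_act k q (p * r) y n = poly_act k q p (poly_act k q r y) n"
proof (induction p arbitrary: y n)
  case (pCons a p)
  have "poly_act k q (pCons a p * r) y n
      = a * poly_act k q r y n + poly_act k q (p * r) (jacobi_op k q y) n"
    by (simp add: mult_pCons_left poly_act_add poly_act_smult poly_act_pCons)
  also have "\<dots> = poly_act k q (pCons a p) (poly_act k q r y) n"
    by (simp add: poly_act_pCons pCons.IH jacobi_op_poly_act)
  finally show ?case .
qed simp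

text \<open>
  The coefficient \<open>\<lambda> - q\<close> of the recurrence at the site \<open>s + j\<close>, as a polynomial in \<open>\<lambda>\<close>.
\<close>

definition site_poly :: "nat \<Rightarrow> (nat \<Rightarrow> real) \<Rightarrow> int \<Rightarrow> nat \<Rightarrow> complex poly" where
  "site_poly k q s j = [:- of_real (periodic_ext k q (s + int j)), 1:]"

text \<open>
  By the definition of \<open>L\<close>, evaluation at consecutive sites satisfies
  \<open>y (n + 1) = ((L - q\<^sub>n) y) (n) - y (n - 1)\<close>. This is the eigenvalue recurrence with \<open>L\<close> in the role of the
  spectral parameter, so the fundamental solutions, evaluated at \<open>L\<close>, propagate the values of
  an arbitrary sequence.
\<close>

lemma site_value:
  "y (s + int m) = poly_act k q (recsol (site_poly k q s) 0 1 m) y (s + 1)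
                 + poly_act k q (recsol (site_poly k q s) 1 0 m) y s"
proof (induction m arbitrary: y rule: less_induct)
  case (less m)
  consider "m = 0" | "m = 1" | l where "m = Suc (Suc l)"
    by (metis One_nat_def not0_implies_Suc)
  then show ?case
  proof cases
    case 3
    let ?Q = "complex_of_real (periodic_ext k q (s + int (Suc l)))"
    have act: "poly_act k q (site_poly k q s (Suc l) * p) y n
        = poly_act k q p (jacobi_op k q y) n - ?Q * poly_act k q p y n" for p n
      by (simp add: site_poly_def poly_act_add poly_act_smult poly_act_pCons
          poly_act_diff flip: smult_minus_left)
    have "y (s + int m) = jacobi_op k q y (s + int (Suc l)) - ?Q * y (s + int (Suc l)) - y (s + int l)"
      unfolding 3 jacobi_op_def by (simp add: algebra_simps)
    also have "\<dots> = poly_act k q (recsol (site_poly k q s) 0 1 m) y (s + 1)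
                 + poly_act k q (recsol (site_poly k q s) 1 0 m) y s"
      using less.IH[of "Suc l" "jacobi_op k q y"] less.IH[of "Suc l" y] less.IH[of l y]
      by (simp add: 3 poly_act_diff act algebra_simps)
    finally show ?thesis .
  qed simp_all
qed

definition cdisc_poly :: "nat \<Rightarrow> (nat \<Rightarrow> real) \<Rightarrow> complex poly" where
  "cdisc_poly k q = disc (2 * k) (site_poly k q 0)"

lemma site_poly_period: "site_poly k q (s + 2 * int k) = site_poly k q s"
proof
  fix j
  have "s + 2 * int k + int j = (s + int j) + 2 * int k" by simp
  then show "site_poly k q (s + 2 * int k) j = site_poly k q s j"
    by (simp only: site_poly_def periodic_ext_period)
qed

lemma disc_site_poly:
  assumes "k \<ge> 1"
  shows "disc (2 * k) (site_poly k q s) = cdisc_poly k q"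
proof -
  obtain l where "k = 1 + l" using assms le_Suc_ex by blast
  then have k: "2 * k = Suc (Suc (2 * l))" by simp
  have step: "disc (2 * k) (site_poly k q (s + 1)) = disc (2 * k) (site_poly k q s)" for s
  proof -
    have "site_poly k q s (Suc (Suc (Suc (2 * l)))) = site_poly k q (s + 2 * int k) 1"
      using \<open>k = 1 + l\<close> by (simp add: site_poly_def algebra_simps)
    then have "site_poly k q s (Suc (Suc (Suc (2 * l)))) = site_poly k q s 1"
      by (simp only: site_poly_period)
    from disc_cyclic[where c = "site_poly k q s", OF this]
    show ?thesis unfolding k by (simp add: site_poly_def[abs_def] algebra_simps)
  qed
  have "disc (2 * k) (site_poly k q s) = disc (2 * k) (site_poly k q 0)"
  proof (induction s rule: int_induct[where k = 0])
    case (step2 i)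
    then show ?case using step[of "i - 1"] by simp
  qed (simp_all add: step)
  then show ?thesis by (simp add: cdisc_poly_def)
qed

text \<open>
  \<open>\<Delta>(L) = T + inverse T\<close>, where \<open>T\<close> is the shift by one period. The values of \<open>y\<close> at two sites
  are propagated over a period by the monodromy matrix \<open>M\<close> with entries evaluated at \<open>L\<close>
  (\<open>site_value\<close>), and \<open>M\<close>, having determinant \<open>1\<close>, satisfies \<open>M\<^sup>2 + 1 = (tr M) M\<close>. The trace is the same
  polynomial at every base point by cyclic invariance.
\<close>

lemma poly_act_disc:
  assumes "k \<ge> 1"
  shows "poly_act k q (cdisc_poly k q) y n = y (n + 2 * int k) + y (n - 2 * int k)"
proof -
  define s where "s = n - 2 * int k"
  let ?c = "site_poly k q s"
  define a where "a = recsol ?c 0 1 (2 * k)"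
  define b where "b = recsol ?c 1 0 (2 * k)"
  define a' where "a' = recsol ?c 0 1 (Suc (2 * k))"
  define b' where "b' = recsol ?c 1 0 (Suc (2 * k))"
  let ?A = "poly_act k q"
  have 1: "y (s + 2 * int k) = ?A a y (s + 1) + ?A b y s" for y
    using site_value[of y s "2 * k"] by (simp add: a_def b_def)
  have 2: "y (s + 2 * int k + 1) = ?A a' y (s + 1) + ?A b' y s" for y
    using site_value[of y s "Suc (2 * k)"] by (simp add: a'_def b'_def algebra_simps)
  have 3: "y (n + 2 * int k) = ?A a y (n + 1) + ?A b y n" for y
    using site_value[of y "s + 2 * int k" "2 * k" k q] unfolding site_poly_period
    by (simp add: a_def b_def s_def)
  have W: "a' * b - a * b' = 1"
    using wronskian_recsol[of ?c "2 * k"] by (simp only: a_def b_def a'_def b'_def)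
  have "?A a y (n + 1) = ?A a' (?A a y) (s + 1) + ?A b' (?A a y) s"
    using 2[of "?A a y"] by (simp add: s_def)
  moreover have "?A a' y n = ?A a (?A a' y) (s + 1) + ?A b (?A a' y) s"
    using 1[of "?A a' y"] by (simp add: s_def)
  ultimately have "?A a' y n - ?A a y (n + 1) = ?A (a' * b - a * b') y s"
    unfolding poly_act_diff poly_act_mult[symmetric] by (simp add: mult.commute)
  then have "?A a y (n + 1) + y s = ?A a' y n" unfolding W by (simp add: algebra_simps)
  moreover have "cdisc_poly k q = a' + b"
    using disc_site_poly[OF assms, of q s] by (simp add: disc_def a'_def b_def)
  ultimately show ?thesis using 3[of y] by (simp add: poly_act_add s_def)
qed

lemma poly_cdisc_real:
  "poly (cdisc_poly k q) (complex_of_real l) = complex_of_real (lyapunov k q l)"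
proof -
  have "poly (cdisc_poly k q) (complex_of_real l)
      = disc (2 * k) (\<lambda>j. poly (site_poly k q 0 j) (complex_of_real l))"
    unfolding cdisc_poly_def by (rule disc_hom) simp_all
  also have "\<dots> = disc (2 * k) (\<lambda>j. complex_of_real (l - q j))"
    by (rule disc_cong) (simp add: site_poly_def periodic_ext_of_nat)
  also have "\<dots> = complex_of_real (lyapunov k q l)"
    unfolding lyapunov_eq_disc by (rule disc_hom[symmetric]) simp_all
  finally show ?thesis .
qed

lemma jacobi_op_bounded:
  assumes "k \<ge> 1"
  shows "\<exists>K. \<forall>y C. ell2_le y C \<longrightarrow> ell2_le (jacobi_op k q y) (K * C)"
proof -
  define M where "M = (\<Sum>j\<le>2 * k. \<bar>q j\<bar>)"
  have M: "cmod (complex_of_real (periodic_ext k q n)) \<le> M" for n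
  proof -
    have "(n - 1) mod (2 * int k) < 2 * int k" using assms by (intro pos_mod_bound) simp
    moreover have "0 \<le> (n - 1) mod (2 * int k)" using assms by (intro pos_mod_sign) simp
    ultimately have "nat ((n - 1) mod (2 * int k)) < 2 * k" by (subst nat_less_iff) simp_all
    then have "nat ((n - 1) mod (2 * int k)) + 1 \<le> 2 * k" by simp
    then show ?thesis unfolding M_def periodic_ext_def norm_of_real
      by (intro member_le_sum) auto
  qed
  show ?thesis
  proof (intro exI allI impI)
    fix y C assume y: "ell2_le y C"
    have "ell2_le (\<lambda>n. (y (n + (- 1)) + y (n + 1)) + of_real (periodic_ext k q n) * y n) ((C + C) + M * C)"
      by (intro ell2_le_add ell2_le_shift ell2_le_mult y M)
    then show "ell2_le (jacobi_op k q y) ((2 + M) * C)"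
      by (simp add: jacobi_op_def[abs_def] algebra_simps)
  qed
qed

lemma poly_act_bounded:
  assumes "k \<ge> 1"
  shows "\<exists>K. \<forall>y C. ell2_le y C \<longrightarrow> ell2_le (poly_act k q p y) (K * C)"
proof (induction p)
  case 0
  show ?case by (intro exI[of _ 0]) (simp add: ell2_le_def poly_act_def L2_set_def)
next
  case (pCons a p)
  then obtain K where K: "\<And>y C. ell2_le y C \<Longrightarrow> ell2_le (poly_act k q p y) (K * C)" by blast
  obtain J where J: "\<And>y C. ell2_le y C \<Longrightarrow> ell2_le (jacobi_op k q y) (J * C)"
    using jacobi_op_bounded[OF assms] by blast
  have "ell2_le (poly_act k q (pCons a p) y) ((cmod a + K * J) * C)" if "ell2_le y C" for y C
  proof -
    have "ell2_le (\<lambda>n. a * y n + poly_act k q p (jacobi_op k q y) n) (cmod a * C + K * (J * C))"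
      by (intro ell2_le_add ell2_le_cmult that K J)
    then show ?thesis by (simp add: poly_act_pCons[abs_def] algebra_simps)
  qed
  then show ?case by blast
qed

section \<open>The spectrum of a periodic Jacobi operator\<close>

text \<open>
  \<open>\<Delta>(X) - \<Delta>(z) = (X - z) R(X)\<close> as polynomials. At \<open>L\<close> the left side becomes
  \<open>T + inverse T - \<Delta>(z)\<close>, which is invertible with a bounded inverse. As \<open>R(L)\<close> is bounded and
  commutes with \<open>L - z\<close>, the factor \<open>L - z\<close> is itself invertible with a bounded inverse.
\<close>

lemma not_in_jacobi_spectrum:
  assumes k: "k \<ge> 1"
    and z: "\<not> (\<exists>r. \<bar>r\<bar> \<le> 2 \<and> poly (cdisc_poly k q) z = complex_of_real r)"
  shows "z \<notin> jacobi_spectrum k q"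
proof -
  define d where "d = poly (cdisc_poly k q) z"
  define A where "A = (\<lambda>y n. jacobi_op k q y n - z * y n)"
  define W where "W = (\<lambda>(y :: int \<Rightarrow> complex) n. y (n + 2 * int k) + y (n - 2 * int k) - d * y n)"
  define R where "R = synthetic_div (cdisc_poly k q) z"
  obtain K where K: "\<And>y C. y \<in> ell2 \<Longrightarrow> ell2_le (W y) C \<Longrightarrow> ell2_le y (K * C)"
    and solve: "\<And>f. f \<in> ell2 \<Longrightarrow> \<exists>y\<in>ell2. W y = f"
    using laplacian_shift_invertible[OF z, of "2 * int k"] unfolding W_def d_def by blast
  obtain J where J: "\<And>y C. ell2_le y C \<Longrightarrow> ell2_le (poly_act k q R y) (J * C)"
    using poly_act_bounded[OF k] by blast
  obtain L where L: "\<And>y C. ell2_le y C \<Longrightarrow> ell2_le (jacobi_op k q y) (L * C)"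
    using jacobi_op_bounded[OF k] by blast
  have fac: "[:- z, 1:] * R = cdisc_poly k q - smult d 1"
    using synthetic_div_correct'[of z "cdisc_poly k q"]
    by (simp only: R_def d_def one_pCons smult_pCons smult_0_right mult_1_right eq_diff_eq)
  have actW: "poly_act k q (cdisc_poly k q - smult d 1) y n = W y n" for y n
    unfolding poly_act_diff poly_act_disc[OF k] poly_act_smult poly_act_1 W_def ..
  have A_act: "A y = poly_act k q [:- z, 1:] y" for y
    by (auto simp: A_def poly_act_pCons fun_eq_iff)
  have AR: "A (poly_act k q R y) = W y" for y
    unfolding A_act by (auto simp only: fun_eq_iff poly_act_mult[symmetric] fac actW)
  have RA: "poly_act k q R (A y) = W y" for y
    unfolding A_act by (auto simp only: fun_eq_iff poly_act_mult[symmetric] mult.commute[of R] fac actW)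
  have Aell: "A y \<in> ell2" if "y \<in> ell2" for y
  proof -
    have "ell2_le (\<lambda>n. jacobi_op k q y n + (- z) * y n) (L * ell2_norm y + cmod (- z) * ell2_norm y)"
      by (intro ell2_le_add ell2_le_cmult L ell2_imp_le that)
    then show ?thesis unfolding A_def by (intro ell2_le_imp) simp
  qed
  have bound: "ell2_norm y \<le> K * J * ell2_norm (A y)" if "y \<in> ell2" for y
  proof -
    have "ell2_le (W y) (J * ell2_norm (A y))"
      unfolding RA[symmetric] by (intro J ell2_imp_le Aell that)
    then have "ell2_le y (K * (J * ell2_norm (A y)))" using that by (intro K)
    then show ?thesis using ell2_le_imp(2) by (simp add: mult.assoc)
  qed
  have "inj_on A ell2"
  proof (rule inj_onI)
    fix y w assume y: "y \<in> ell2" and w: "w \<in> ell2" and eq: "A y = A w"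
    let ?v = "\<lambda>n. y n + (- 1) * w n"
    have "ell2_le ?v (ell2_norm y + cmod (- 1) * ell2_norm w)"
      by (intro ell2_le_add ell2_le_cmult ell2_imp_le y w)
    then have v: "?v \<in> ell2" by (rule ell2_le_imp)
    have "W y = W w" using RA[of y] RA[of w] eq by simp
    moreover have "W ?v n = W y n - W w n" for n by (simp add: W_def algebra_simps)
    ultimately have "ell2_le (W ?v) 0" by (simp add: ell2_le_def L2_set_def)
    then have "ell2_le ?v 0" using K[OF v, of 0] by simp
    then have "?v n = 0" for n using ell2_le_point[of ?v 0 n] by simp
    then show "y = w" by (auto simp: fun_eq_iff)
  qed
  moreover have "A ` ell2 = ell2"
  proof (intro equalityI subsetI)
    fix f assume "f \<in> ell2"
    then obtain y where y: "y \<in> ell2" "W y = f" using solve by blast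
    have "poly_act k q R y \<in> ell2" using J[OF ell2_imp_le[OF y(1)]] by (rule ell2_le_imp)
    then have "A (poly_act k q R y) \<in> A ` ell2" by (rule imageI)
    then show "f \<in> A ` ell2" by (simp only: AR y)
  qed (use Aell in blast)
  ultimately have "bij_betw A ell2 ell2" by (simp add: bij_betw_def)
  then show ?thesis
    using bound unfolding jacobi_spectrum_def Let_def A_def by blast
qed

text \<open>
  An eigenvector of the monodromy matrix for an eigenvalue \<open>\<mu>\<close> of modulus \<open>1\<close>, continued to all
  of \<open>\<int>\<close>.
\<close>

lemma floquet_solution:
  assumes r: "\<bar>r\<bar> \<le> 2" and z: "poly (cdisc_poly k q) z = complex_of_real r"
  obtains y \<mu> where "cmod \<mu> = 1" "\<And>n. y (n + 2 * int k) = \<mu> * y n"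
    "\<And>n. jacobi_op k q y n = z * y n" "y 0 \<noteq> 0 \<or> y 1 \<noteq> 0"
proof -
  define c where "c n = z - of_real (periodic_ext k q n)" for n
  define \<phi> where "\<phi> = recsol (\<lambda>j. c (int j)) 0 1 (2 * k)"
  define \<phi>' where "\<phi>' = recsol (\<lambda>j. c (int j)) 0 1 (Suc (2 * k))"
  define \<theta> where "\<theta> = recsol (\<lambda>j. c (int j)) 1 0 (2 * k)"
  define \<theta>' where "\<theta>' = recsol (\<lambda>j. c (int j)) 1 0 (Suc (2 * k))"
  \<comment> \<open>The root of \<open>\<mu>\<^sup>2 - r \<mu> + 1\<close> on the upper unit circle.\<close>
  define \<mu> where "\<mu> = Complex (r / 2) (sqrt (1 - (r / 2)\<^sup>2))"
  have r4: "(r / 2)\<^sup>2 \<le> 1" using r by (simp add: abs_square_le_1)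
  have mu1: "cmod \<mu> = 1" using r4 by (simp add: \<mu>_def cmod_def)
  have mu2: "\<mu> * \<mu> = r * \<mu> - 1"
    using r4 by (simp add: \<mu>_def complex_eq_iff power2_eq_square[symmetric])
       (simp add: power2_eq_square)
  have tr: "\<phi>' + \<theta> = r"
  proof -
    have "poly (cdisc_poly k q) z = disc (2 * k) (\<lambda>j. poly (site_poly k q 0 j) z)"
      unfolding cdisc_poly_def by (rule disc_hom) simp_all
    then show ?thesis using z
      by (simp add: site_poly_def disc_def \<phi>'_def \<theta>_def c_def algebra_simps del: recsol.simps)
  qed
  have det: "\<phi>' * \<theta> - \<phi> * \<theta>' = 1"
    using wronskian_recsol[of "\<lambda>j. c (int j)" "2 * k"]
    unfolding \<phi>_def \<phi>'_def \<theta>_def \<theta>'_def .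
  have mu: "\<mu> * \<mu> = (\<phi>' + \<theta>) * \<mu> - (\<phi>' * \<theta> - \<phi> * \<theta>')" using mu2 tr det by simp
  \<comment> \<open>A kernel vector of the singular matrix is read off from one of its rows; if that row may vanish, from the other.\<close>
  have "\<exists>a b. (a \<noteq> 0 \<or> b \<noteq> 0) \<and> \<phi> * b + \<theta> * a = \<mu> * a \<and> \<phi>' * b + \<theta>' * a = \<mu> * b"
  proof (cases "\<phi> = 0")
    case False
    then show ?thesis using mu
      by (intro exI[of _ \<phi>] exI[of _ "\<mu> - \<theta>"]) (simp add: algebra_simps)
  next
    case True
    then have "(\<mu> - \<phi>') * (\<mu> - \<theta>) = 0" using mu by (simp add: algebra_simps)
    then consider "\<mu> = \<phi>'" | "\<mu> = \<theta>" "\<mu> \<noteq> \<phi>'" by auto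
    then show ?thesis
    proof cases
      case 1
      then show ?thesis using True by (intro exI[of _ 0] exI[of _ 1]) simp
    next
      case 2
      then show ?thesis using True
        by (intro exI[of _ "\<mu> - \<phi>'"] exI[of _ \<theta>']) (simp add: algebra_simps)
    qed
  qed
  then obtain a b where ab: "a \<noteq> 0 \<or> b \<noteq> 0" "\<phi> * b + \<theta> * a = \<mu> * a" "\<phi>' * b + \<theta>' * a = \<mu> * b"
    by blast
  define y where "y = zsol c a b"
  have rec: "y (n + 1) = c n * y n - y (n - 1)" for n by (simp add: y_def zsol_rec)
  have cper: "c (n + 2 * int k) = c n" for n by (simp add: c_def periodic_ext_period)
  have y0: "y 0 = a" "y 1 = b" by (simp_all add: y_def zsol_init)
  have "nat (1 + 2 * int k) = Suc (2 * k)" "nat (2 * int k) = 2 * k" by auto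
  then have y2: "y (2 * int k) = \<mu> * a" "y (1 + 2 * int k) = \<mu> * b"
    using ab recsol_linear[of "\<lambda>j. c (int j)" a b "2 * k"]
      recsol_linear[of "\<lambda>j. c (int j)" a b "Suc (2 * k)"]
    by (simp_all add: y_def zsol_def \<phi>_def \<theta>_def \<phi>'_def \<theta>'_def mult.commute del: recsol.simps)
  show ?thesis
  proof (rule that[OF mu1])
    fix n
    have "y (n + 2 * int k) = zsol c (y (0 + 2 * int k)) (y (1 + 2 * int k)) n"
    proof (rule zsol_unique[where y = "\<lambda>n. y (n + 2 * int k)"])
      fix n
      show "y (n + 1 + 2 * int k) = c n * y (n + 2 * int k) - y (n - 1 + 2 * int k)"
        using rec[of "n + 2 * int k"] unfolding cper by (simp add: algebra_simps)
    qed
    moreover have "\<mu> * y n = zsol c (\<mu> * y 0) (\<mu> * y 1) n"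
      by (rule zsol_unique) (simp add: rec algebra_simps)
    ultimately show "y (n + 2 * int k) = \<mu> * y n" using y0 y2 by simp
    show "jacobi_op k q y n = z * y n"
      using rec[of n] by (simp add: jacobi_op_def c_def algebra_simps)
    show "y 0 \<noteq> 0 \<or> y 1 \<noteq> 0" using ab y0 by simp
  qed
qed

lemma sum_period_shift:
  fixes g :: "int \<Rightarrow> complex"
  assumes "g (int m) = g 0"
  shows "(\<Sum>n=1..m. g (int n - 1)) = (\<Sum>n=1..m. g (int n))"
proof -
  have "(\<Sum>n=1..m. g (int n - 1)) = (\<Sum>n<m. g (int n))"
    by (rule sum.reindex_bij_witness[of _ Suc "\<lambda>n. n - 1"]) (auto simp: of_nat_diff)
  moreover have "(\<Sum>n<m. g (int n)) + g (int m) = g 0 + (\<Sum>n=1..m. g (int n))"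
    by (induction m) (simp_all add: algebra_simps)
  ultimately show ?thesis using assms by simp
qed

text \<open>
  On one period with the boundary condition \<open>y (n + 2 k) = \<mu> y (n)\<close>, \<open>\<bar>\<mu>\<bar> = 1\<close>, the operator \<open>L\<close> is
  Hermitian: \<open>cnj (y\<^sub>n) y\<^sub>n\<^sub>+\<^sub>1\<close> is periodic, so the two hopping terms are conjugate to each other.
\<close>

lemma floquet_energy_real:
  assumes mu: "cmod \<mu> = 1" and per: "\<And>n. y (n + 2 * int k) = \<mu> * y n"
    and eq: "\<And>n. jacobi_op k q y n = z * y n" and nz: "(\<Sum>n=1..2*k. (cmod (y (int n)))\<^sup>2) \<noteq> 0"
  shows "Im z = 0"
proof -
  define g where "g n = cnj (y n) * y (n + 1)" for n
  define S where "S = (\<Sum>n=1..2*k. (cmod (y (int n)))\<^sup>2)"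
  define G where "G = (\<Sum>n=1..2*k. g (int n))"
  have mumu: "cnj \<mu> * \<mu> = 1" using mu by (metis complex_norm_square mult.commute of_real_1 power_one)
  have "g (int (2 * k)) = (cnj \<mu> * \<mu>) * g 0"
    using per[of 0] per[of 1] by (simp add: g_def add.commute)
  then have "g (int (2 * k)) = g 0" using mumu by simp
  then have shift: "(\<Sum>n=1..2*k. g (int n - 1)) = G" unfolding G_def by (rule sum_period_shift)
  have "z * S = (\<Sum>n=1..2*k. cnj (y (int n)) * (z * y (int n)))"
    unfolding S_def of_real_sum sum_distrib_left
    by (intro sum.cong refl) (simp only: complex_norm_square mult_ac)
  also have "\<dots> = (\<Sum>n=1..2*k. cnj (g (int n - 1)) + g (int n)
      + of_real (periodic_ext k q (int n) * (cmod (y (int n)))\<^sup>2))"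
    unfolding eq[symmetric] jacobi_op_def g_def of_real_mult complex_norm_square
    by (intro sum.cong refl) (simp add: algebra_simps)
  also have "\<dots> = cnj G + G + of_real (\<Sum>n=1..2*k. periodic_ext k q (int n) * (cmod (y (int n)))\<^sup>2)"
    using shift by (simp add: sum.distrib G_def flip: cnj_sum)
  finally have "Im (z * S) = 0" by simp
  then show ?thesis using nz by (simp add: S_def)
qed

lemma sum_over_periods:
  fixes f :: "nat \<Rightarrow> real"
  assumes "\<And>n. f (n + m) = f n"
  shows "(\<Sum>n=1..M * m. f n) = real M * (\<Sum>n=1..m. f n)"
proof (induction M)
  case (Suc M)
  have per: "f (n + M * m) = f n" for n
  proof (induction M)
    case (Suc M)
    then show ?case using assms[of "n + M * m"] by (simp add: ac_simps)
  qed simp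
  have "(\<Sum>n=1..M * m + m. f n) = (\<Sum>n=1..M * m. f n) + (\<Sum>n=M * m + 1..M * m + m. f n)"
    by (rule sum.ub_add_nat) simp
  also have "(\<Sum>n=M * m + 1..M * m + m. f n) = (\<Sum>n=1..m. f (n + M * m))"
    using sum.shift_bounds_cl_nat_ivl[of f 1 "M * m" m] by (simp add: add.commute)
  also have "\<dots> = (\<Sum>n=1..m. f n)" by (simp only: per)
  finally show ?case using Suc by (simp add: add.commute distrib_right)
qed simp

text \<open>
  Cut a Floquet solution off outside \<open>M\<close> periods. Its squared norm grows like \<open>M\<close>, while \<open>L - z\<close>
  applied to it is supported at the four sites next to the cuts and stays bounded. So no bound
  \<open>\<parallel>y\<parallel> \<le> C \<parallel>(L - z) y\<parallel>\<close> holds.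
\<close>

lemma in_jacobi_spectrum:
  assumes k: "k \<ge> 1" and mu: "cmod \<mu> = 1" and per: "\<And>n. y (n + 2 * int k) = \<mu> * y n"
    and eq: "\<And>n. jacobi_op k q y n = z * y n" and nz: "(\<Sum>n=1..2*k. (cmod (y (int n)))\<^sup>2) \<noteq> 0"
  shows "z \<in> jacobi_spectrum k q"
proof (rule ccontr)
  assume "z \<notin> jacobi_spectrum k q"
  then obtain C where C: "\<And>w. w \<in> ell2 \<Longrightarrow>
      ell2_norm w \<le> C * ell2_norm (\<lambda>n. jacobi_op k q w n - z * w n)"
    unfolding jacobi_spectrum_def Let_def by blast
  define S where "S = (\<Sum>n=1..2*k. (cmod (y (int n)))\<^sup>2)"
  define B where "B = 4 * (cmod (y 0) + cmod (y 1))"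
  have Spos: "S > 0" using nz unfolding S_def by (simp add: order_less_le sum_nonneg)
  have cper: "cmod (y (n + int M * (2 * int k))) = cmod (y n)" for n M
  proof (induction M)
    case (Suc M)
    then show ?case using per[of "n + int M * (2 * int k)"] mu
      by (simp add: norm_mult algebra_simps)
  qed simp
  have bound: "M * S \<le> (\<bar>C\<bar> * B)\<^sup>2" for M :: nat
  proof -
    define T where "T = int M * (2 * int k)"
    define w where "w n = (if 1 \<le> n \<and> n \<le> T then y n else 0)" for n
    define v where "v n = jacobi_op k q w n - z * w n" for n
    have yn: "jacobi_op k q y n - z * y n = 0" for n using eq by simp
    have v: "v n = w (n - 1) + w (n + 1) - (if 1 \<le> n \<and> n \<le> T then y (n - 1) + y (n + 1) else 0)" for n
      using yn[of n] by (simp add: v_def w_def jacobi_op_def algebra_simps)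
    have sum_nat: "(\<Sum>n=1..M * (2 * k). (cmod (y (int n)))\<^sup>2) = M * S"
      unfolding S_def
    proof (rule sum_over_periods)
      fix n
      show "(cmod (y (int (n + 2 * k))))\<^sup>2 = (cmod (y (int n)))\<^sup>2"
        using cper[of "int n" 1] by simp
    qed
    have "ell2_le w (\<Sum>n\<in>{1..T}. cmod (w n))"
      by (rule ell2_le_finite_support) (auto simp: w_def)
    then have w: "w \<in> ell2" by (rule ell2_le_imp)
    have "sqrt (M * S) = L2_set (\<lambda>n. cmod (w n)) (int ` {1..M * (2 * k)})"
      proof -
      have "w (int x) = y (int x)" if "x \<in> {1..M * (2 * k)}" for x
      proof -
        have "int x \<le> int (M * (2 * k))"
          using that by (simp only: of_nat_le_iff atLeastAtMost_iff)
        moreover have "int (M * (2 * k)) = T" by (simp add: T_def)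
        ultimately have "int x \<le> T" by (simp only:)
        then show ?thesis using that by (simp add: w_def)
      qed
      then show ?thesis unfolding L2_set_def by (subst sum.reindex) (simp_all add: sum_nat[symmetric])
    qed
    also have "\<dots> \<le> ell2_norm w" by (rule ell2_leD[OF ell2_imp_le[OF w]]) simp
    also have "\<dots> \<le> C * ell2_norm v" using C[OF w] by (simp add: v_def[abs_def])
    also have "\<dots> \<le> \<bar>C\<bar> * B"
    proof -
      have vle: "cmod (v n) \<le> cmod (y 0) + cmod (y 1)" if n: "n \<in> {0, 1, T, T + 1}" for n
      proof (cases "M = 0")
        case True
        then show ?thesis by (simp add: v w_def T_def)
      next
        case False
        then have "T \<ge> 1 * (2 * int k)" unfolding T_def by (intro mult_right_mono) auto
        then have T: "T \<ge> 2" using k by linarith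
        have "cmod (y T) = cmod (y 0)" "cmod (y (T + 1)) = cmod (y 1)"
          using cper[of 0 M] cper[of 1 M] by (simp_all add: T_def add.commute)
        \<comment> \<open>The four sites at which the truncation spoils the eigenvalue equation.\<close>
        moreover have "v 0 = y 1" "v 1 = - y 0" "v T = - y (T + 1)" "v (T + 1) = y T"
          using T by (simp_all add: v w_def)
        ultimately show ?thesis using n by auto
      qed
      have "ell2_le v (\<Sum>n\<in>{0, 1, T, T + 1}. cmod (v n))"
        by (rule ell2_le_finite_support) (auto simp: v w_def)
      then have "ell2_norm v \<le> (\<Sum>n\<in>{0, 1, T, T + 1}. cmod (v n))" by (rule ell2_le_imp)
      also have "\<dots> \<le> real (card {0, 1, T, T + 1}) * (cmod (y 0) + cmod (y 1))"
        by (rule sum_bounded_above) (rule vle)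
      also have "\<dots> \<le> B" unfolding B_def
        by (intro mult_right_mono) (simp_all add: card_insert_if)
      finally have "ell2_norm v \<le> B" .
      moreover have "0 \<le> ell2_norm v" unfolding ell2_norm_def by (simp add: infsum_nonneg)
      ultimately show ?thesis by (intro mult_mono) auto
    qed
    finally show ?thesis by (rule sqrt_le_D)
  qed
  obtain M :: nat where "(\<bar>C\<bar> * B)\<^sup>2 / S < M" using reals_Archimedean2 by blast
  then show False using bound[of M] Spos by (simp add: pos_divide_less_eq)
qed

text \<open>
  The case \<open>\<Delta>(z) \<in> [-2, 2]\<close> with \<open>z\<close> not real is empty by the reality of Floquet energies.
\<close>

theorem jacobi_spectrum_eq:
  assumes k: "k \<ge> 1"
  shows "jacobi_spectrum k q = complex_of_real ` {l. \<bar>lyapunov k q l\<bar> \<le> 2}"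
proof -
  have floquet: "Im z = 0 \<and> z \<in> jacobi_spectrum k q"
    if r: "\<bar>r\<bar> \<le> 2" "poly (cdisc_poly k q) z = complex_of_real r" for r z
  proof (rule floquet_solution[OF r])
    fix y \<mu>
    assume y: "cmod \<mu> = 1" "\<And>n. y (n + 2 * int k) = \<mu> * y n"
      "\<And>n. jacobi_op k q y n = z * y n" "y 0 \<noteq> 0 \<or> y 1 \<noteq> 0"
    have "\<mu> \<noteq> 0" using y(1) by auto
    then have "y (int (2 * k)) \<noteq> 0 \<or> y (int 1) \<noteq> 0" using y(2)[of 0] y(4) by auto
    moreover have "2 * k \<in> {1..2*k}" "1 \<in> {1..2*k}" using k by auto
    ultimately obtain i where i: "i \<in> {1..2*k}" "y (int i) \<noteq> 0" by blast
    have "(cmod (y (int i)))\<^sup>2 \<le> (\<Sum>n=1..2*k. (cmod (y (int n)))\<^sup>2)"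
      using i by (intro member_le_sum) auto
    then have nz: "(\<Sum>n=1..2*k. (cmod (y (int n)))\<^sup>2) \<noteq> 0" using i by auto
    show ?thesis using floquet_energy_real[OF y(1-3) nz] in_jacobi_spectrum[OF k y(1-3) nz] by blast
  qed
  show ?thesis
  proof (intro equalityI subsetI)
    fix z assume z: "z \<in> jacobi_spectrum k q"
    then obtain r where r: "\<bar>r\<bar> \<le> 2" "poly (cdisc_poly k q) z = complex_of_real r"
      using not_in_jacobi_spectrum[OF k] by blast
    then have zr: "z = complex_of_real (Re z)" using floquet[OF r] by (simp add: complex_eq_iff)
    then have "lyapunov k q (Re z) = r"
      using r(2) poly_cdisc_real[of k q "Re z"] by simp
    then show "z \<in> complex_of_real ` {l. \<bar>lyapunov k q l\<bar> \<le> 2}" using zr r(1) by blast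
  next
    fix z assume "z \<in> complex_of_real ` {l. \<bar>lyapunov k q l\<bar> \<le> 2}"
    then show "z \<in> jacobi_spectrum k q" using floquet poly_cdisc_real[of k q] by blast
  qed
qed

section \<open>Band structure of an oscillating polynomial\<close>

text \<open>
  The conditions on the band edges, with the spectrum replaced by its description through the
  discriminant \<open>p\<close>.
\<close>

definition poly_edges :: "nat \<Rightarrow> real poly \<Rightarrow> (nat \<Rightarrow> real) \<Rightarrow> (nat \<Rightarrow> real) \<Rightarrow> bool" where
  "poly_edges m p lm lp \<longleftrightarrow>
     {x. \<bar>poly p x\<bar> \<le> 2} = (\<Union>n\<in>{0..m - 1}. {lp n..lm (n + 1)}) \<and>
     (\<forall>n\<in>{0..m - 1}. lp n < lm (n + 1)) \<and>
     (\<forall>n\<in>{1..m - 1}. lm n \<le> lp n) \<and>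
     (\<forall>n\<in>{0..m - 1}. (-1) ^ (m - n) * poly p (lp n) = 2) \<and>
     (\<forall>n\<in>{1..m}. (-1) ^ (m - n) * poly p (lm n) = 2)"

text \<open>
  Between critical points a polynomial is strictly monotone; in this form the direction of
  monotonicity is read off from the endpoints \<open>u\<close>, \<open>v\<close>.
\<close>

lemma poly_strict_sign:
  fixes p :: "real poly"
  assumes "\<And>x. u < x \<Longrightarrow> x < v \<Longrightarrow> poly (pderiv p) x \<noteq> 0"
    and "u \<le> x" "x < y" "y \<le> v"
  shows "(poly p y - poly p x) * (poly p v - poly p u) > 0"
proof -
  obtain s where s: "x < s" "s < y" "poly p y - poly p x = (y - x) * poly (pderiv p) s"
    using poly_MVT[OF \<open>x < y\<close>, of p] by blast
  have "u < v" using assms by simp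
  then obtain t where t: "u < t" "t < v" "poly p v - poly p u = (v - u) * poly (pderiv p) t"
    using poly_MVT[of u v p] by blast
  have "poly (pderiv p) s * poly (pderiv p) t > 0"
  proof (rule ccontr)
    assume "\<not> ?thesis"
    moreover have "poly (pderiv p) s \<noteq> 0" "poly (pderiv p) t \<noteq> 0" using assms s t by auto
    ultimately have neg: "poly (pderiv p) s * poly (pderiv p) t < 0" by (simp add: not_less order_less_le)
    then have "s \<noteq> t" by (metis not_less zero_le_square)
    then consider "s < t" | "t < s" by linarith
    then obtain w where "min s t < w" "w < max s t" "poly (pderiv p) w = 0"
    proof cases
      case 1
      then show ?thesis using poly_IVT[of s t "pderiv p"] neg that by (auto simp: min_def max_def)
    next
      case 2
      then show ?thesis using poly_IVT[of t s "pderiv p"] neg that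
        by (auto simp: min_def max_def mult.commute)
    qed
    then show False using assms(1)[of w] assms(2-4) s t by (auto simp: min_def max_def split: if_splits)
  qed
  moreover have "(y - x) * (v - u) > 0" using \<open>x < y\<close> \<open>u < v\<close> by simp
  ultimately have "((y - x) * (v - u)) * (poly (pderiv p) s * poly (pderiv p) t) > 0"
    by (rule mult_pos_pos[rotated])
  then show ?thesis unfolding s(3) t(3) by (simp add: mult_ac)
qed

lemma strict_mono_on_enum_unique:
  fixes f g :: "nat \<Rightarrow> real"
  assumes "\<And>i. Suc i < m \<Longrightarrow> f i < f (Suc i)" "\<And>i. Suc i < m \<Longrightarrow> g i < g (Suc i)"
    and "f ` {..<m} = g ` {..<m}" and "n < m"
  shows "f n = g n"
proof -
  have sd: "sorted (map h [0..<m]) \<and> distinct (map h [0..<m])"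
    if "\<And>i. Suc i < m \<Longrightarrow> h i < h (Suc i)" for h :: "nat \<Rightarrow> real"
  proof -
    have "sorted_wrt (<) (map h [0..<m])"
      using that by (subst sorted_wrt_iff_nth_Suc_transp) (auto intro: transpI)
    then show ?thesis by (simp add: strict_sorted_iff)
  qed
  have "map f [0..<m] = map g [0..<m]"
    using sd[of f] sd[of g] assms
    by (intro sorted_distinct_set_unique) (auto simp: lessThan_atLeast0)
  then show ?thesis using \<open>n < m\<close> by simp
qed

text \<open>
  A polynomial of degree \<open>m\<close> with \<open>m\<close> real zeros \<open>z\<^sub>0 < \<dots> < z\<^sub>m\<^sub>-\<^sub>1\<close>, separated by critical points
  \<open>\<kappa>\<^sub>1, \<dots>, \<kappa>\<^sub>m\<^sub>-\<^sub>1\<close> at which its modulus is at least \<open>2\<close>. By counting degrees there are no other zeros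
  or critical points.
\<close>

locale oscillating_poly =
  fixes p :: "real poly" and m :: nat and z \<kappa> :: "nat \<Rightarrow> real"
  assumes m2: "m \<ge> 2" and deg: "degree p = m"
    and z_zero: "\<And>n. n < m \<Longrightarrow> poly p (z n) = 0"
    and z_less: "\<And>n. Suc n < m \<Longrightarrow> z n < \<kappa> (Suc n)" "\<And>n. Suc n < m \<Longrightarrow> \<kappa> (Suc n) < z (Suc n)"
    and crit: "\<And>n. Suc n < m \<Longrightarrow> poly (pderiv p) (\<kappa> (Suc n)) = 0"
    and peak: "\<And>n. Suc n < m \<Longrightarrow> (-1) ^ (m - Suc n) * poly p (\<kappa> (Suc n)) \<ge> 2"
begin

definition s :: "nat \<Rightarrow> real" where "s n = (-1) ^ (m - n)"

text \<open>
  The closed interval \<open>[\<kappa>\<^sub>n, \<kappa>\<^sub>n\<^sub>+\<^sub>1]\<close>, unbounded to the left for \<open>n = 0\<close> and to the right for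
  \<open>n = m - 1\<close>; it contains the \<open>n\<close>-th band.
\<close>

definition branch :: "nat \<Rightarrow> real set" where
  "branch n = {x. (n > 0 \<longrightarrow> \<kappa> n \<le> x) \<and> (Suc n < m \<longrightarrow> x \<le> \<kappa> (Suc n))}"

lemma s_Suc: "n < m \<Longrightarrow> s (Suc n) = - s n"
  by (simp add: s_def Suc_diff_Suc[symmetric])

lemma abs_s_mult: "\<bar>s n * x\<bar> = \<bar>x\<bar>"
  by (simp add: s_def abs_mult power_abs)

lemma s_sq: "s n * s n = 1"
  by (simp add: s_def power_mult_distrib[symmetric])

lemma s_cancel: "s n * x = s n * y \<Longrightarrow> x = y"
  by (metis s_sq mult.assoc mult_1)

lemma p_nonzero: "p \<noteq> 0" "pderiv p \<noteq> 0"
  using m2 deg by (auto simp: pderiv_eq_0_iff)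

lemma z_mono: "Suc n < m \<Longrightarrow> z n < z (Suc n)"
  using z_less by (blast intro: order.strict_trans)

lemma z_strict: "i < j \<Longrightarrow> j < m \<Longrightarrow> z i < z j"
proof (induction j)
  case (Suc j)
  then show ?case using z_mono[of j] by (cases "i = j") auto
qed simp

lemma zeros: "{x. poly p x = 0} = z ` {..<m}"
proof (rule card_seteq[symmetric])
  show "finite {x. poly p x = 0}" using p_nonzero by (simp add: poly_roots_finite)
  show "z ` {..<m} \<subseteq> {x. poly p x = 0}" using z_zero by auto
  have "inj_on z {..<m}"
    by (rule linorder_inj_onI') (use z_strict in fastforce)
  then show "card {x. poly p x = 0} \<le> card (z ` {..<m})"
    using card_poly_roots_bound[of p] p_nonzero deg by (simp add: card_image)
qed

lemma crit_zeros: "{x. poly (pderiv p) x = 0} = (\<lambda>n. \<kappa> (Suc n)) ` {..<m - 1}"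
proof (rule card_seteq[symmetric])
  show "finite {x. poly (pderiv p) x = 0}" using p_nonzero by (simp add: poly_roots_finite)
  show "(\<lambda>n. \<kappa> (Suc n)) ` {..<m - 1} \<subseteq> {x. poly (pderiv p) x = 0}" using crit by auto
  have "inj_on (\<lambda>n. \<kappa> (Suc n)) {..<m - 1}"
  proof (rule linorder_inj_onI')
    fix i j assume ij: "i \<in> {..<m - 1}" "j \<in> {..<m - 1}" "i < j"
    have "\<kappa> (Suc i) < z (Suc i)" "z j < \<kappa> (Suc j)" using ij z_less by auto
    moreover have "z (Suc i) \<le> z j" using ij z_strict[of "Suc i" j]
      by (cases "Suc i = j") (auto simp: less_diff_conv)
    ultimately show "\<kappa> (Suc i) \<noteq> \<kappa> (Suc j)" by simp
  qed
  then show "card {x. poly (pderiv p) x = 0} \<le> card ((\<lambda>n. \<kappa> (Suc n)) ` {..<m - 1})"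
    using card_poly_roots_bound[of "pderiv p"] p_nonzero deg by (simp add: card_image degree_pderiv)
qed

lemma kappa_mono: "0 < i \<Longrightarrow> i < j \<Longrightarrow> j < m \<Longrightarrow> \<kappa> i < \<kappa> j"
proof (induction j)
  case (Suc j)
  then have "\<kappa> j < \<kappa> (Suc j)" using z_less(2)[of "j - 1"] z_less(1)[of j]
    by (cases j) auto
  then show ?case using Suc by (cases "i = j") auto
qed simp

lemma branch_no_crit:
  assumes "n < m" "x \<in> branch n" "y \<in> branch n" "x < t" "t < y"
  shows "poly (pderiv p) t \<noteq> 0"
proof
  assume "poly (pderiv p) t = 0"
  then have "t \<in> (\<lambda>n. \<kappa> (Suc n)) ` {..<m - 1}" unfolding crit_zeros[symmetric] by simp
  then obtain j where j: "Suc j < m" "t = \<kappa> (Suc j)" by (auto simp: less_diff_conv)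
  consider "Suc j \<le> n" | "Suc n \<le> Suc j" by linarith
  then show False
  proof cases
    case 1
    then have "\<kappa> (Suc j) \<le> \<kappa> n" using kappa_mono[of "Suc j" n] assms(1) by (cases "Suc j = n") auto
    then show False using assms j 1 by (auto simp: branch_def)
  next
    case 2
    then have "\<kappa> (Suc n) \<le> \<kappa> (Suc j)" using kappa_mono[of "Suc n" "Suc j"] j by (cases "n = j") auto
    then show False using assms j 2 by (auto simp: branch_def)
  qed
qed

lemma z_branch: "n < m \<Longrightarrow> z n \<in> branch n"
  using z_less(1)[of n] z_less(2)[of "n - 1"] by (cases n) (auto simp: branch_def)

lemma kappa_branch: "n < m \<Longrightarrow> n > 0 \<Longrightarrow> \<kappa> n \<in> branch n"
  "Suc n < m \<Longrightarrow> \<kappa> (Suc n) \<in> branch n"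
  using kappa_mono[of n "Suc n"] by (cases "n = 0"; auto simp: branch_def)+

text \<open>
  Monotonicity is clear as a branch has no interior critical point. Its direction follows from the
  zero of \<open>p\<close> in the branch and the value of \<open>p\<close> at a finite end of the branch; there is such an end because
  \<open>m \<ge> 2\<close>.
\<close>

lemma branch_decreasing:
  assumes n: "n < m" and x: "x \<in> branch n" and y: "y \<in> branch n" and "x < y"
  shows "s n * poly p y < s n * poly p x"
proof -
  define ref where "ref u v \<longleftrightarrow> u \<in> branch n \<and> v \<in> branch n \<and> u < v \<and> s n * poly p v < s n * poly p u" for u v
  have "\<exists>u v. ref u v"
  proof (cases "n > 0")
    case True
    then obtain l where l: "n = Suc l" by (cases n) auto
    have "ref (\<kappa> n) (z n)"
      using n True peak[of l] z_zero[of n] z_less(2)[of l] z_branch[of n] kappa_branch(1)[of n]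
      by (simp add: ref_def l s_def)
    then show ?thesis by blast
  next
    case False
    then have "ref (z n) (\<kappa> (Suc n))"
      using m2 peak[of n] z_zero[of n] z_less(1)[of n] z_branch[of n] kappa_branch(2)[of n] s_Suc[of n]
      by (simp add: ref_def s_def)
    then show ?thesis by blast
  qed
  then obtain u v where uv: "u \<in> branch n" "v \<in> branch n" "u < v" "s n * poly p v < s n * poly p u"
    by (auto simp: ref_def)
  let ?a = "min x u" and ?b = "max y v"
  have ab: "?a \<in> branch n" "?b \<in> branch n" using x y uv by (auto simp: min_def max_def)
  \<comment> \<open>Compare with the reference pair inside the larger interval \<open>[?a, ?b]\<close> of the branch.\<close>
  have 1: "(poly p y - poly p x) * (poly p ?b - poly p ?a) > 0"
    by (rule poly_strict_sign) (use branch_no_crit[OF n ab] \<open>x < y\<close> in auto)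
  have 2: "(poly p v - poly p u) * (poly p ?b - poly p ?a) > 0"
    by (rule poly_strict_sign) (use branch_no_crit[OF n ab] uv in auto)
  have "(poly p y - poly p x) * (poly p v - poly p u) > 0"
    using 1 2 by (auto simp: zero_less_mult_iff)
  then have "(s n * s n) * ((poly p y - poly p x) * (poly p v - poly p u)) > 0" by (simp add: s_sq)
  then have "(s n * poly p y - s n * poly p x) * (s n * poly p v - s n * poly p u) > 0"
    by (simp add: algebra_simps)
  then show ?thesis using uv(4) by (simp add: zero_less_mult_iff)
qed

lemma branch_le_iff:
  assumes "n < m" "x \<in> branch n" "y \<in> branch n"
  shows "s n * poly p x \<le> s n * poly p y \<longleftrightarrow> y \<le> x"
  using branch_decreasing[OF assms(1,2,3)] branch_decreasing[OF assms(1,3,2)]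
  by (metis less_eq_real_def linorder_not_less order_less_irrefl linorder_neqE_linordered_idom)

lemma branch_inj:
  assumes "n < m" "x \<in> branch n" "y \<in> branch n" "poly p x = poly p y"
  shows "x = y"
  using branch_le_iff[OF assms(1-3)] branch_le_iff[OF assms(1,3,2)] assms(4) by auto

lemma branch_cover: "\<exists>n<m. x \<in> branch n"
proof -
  define n where "n = Max {i. i < m \<and> (i > 0 \<longrightarrow> \<kappa> i \<le> x)}"
  have fin: "finite {i. i < m \<and> (i > 0 \<longrightarrow> \<kappa> i \<le> x)}" by simp
  have "0 \<in> {i. i < m \<and> (i > 0 \<longrightarrow> \<kappa> i \<le> x)}" using m2 by simp
  then have n: "n \<in> {i. i < m \<and> (i > 0 \<longrightarrow> \<kappa> i \<le> x)}"
    unfolding n_def using Max_in[OF fin] by blast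
  have "x \<le> \<kappa> (Suc n)" if "Suc n < m"
  proof (rule ccontr)
    assume "\<not> x \<le> \<kappa> (Suc n)"
    then have "Suc n \<in> {i. i < m \<and> (i > 0 \<longrightarrow> \<kappa> i \<le> x)}" using that by simp
    then have "Suc n \<le> n" unfolding n_def using Max_ge[OF fin] by blast
    then show False by simp
  qed
  then show ?thesis using n by (auto simp: branch_def)
qed

lemma branch_convex: "x \<in> branch n \<Longrightarrow> y \<in> branch n \<Longrightarrow> x \<le> t \<Longrightarrow> t \<le> y \<Longrightarrow> t \<in> branch n"
  by (auto simp: branch_def)

lemma poly_large: "\<exists>x<b. \<bar>poly p x\<bar> \<ge> 2" "\<exists>x>b. \<bar>poly p x\<bar> \<ge> 2"
proof -
  have "filterlim (poly p) at_infinity at_infinity"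
    using m2 deg by (intro filterlim_poly_at_infinity) auto
  then have "eventually (\<lambda>x. norm (poly p x) \<ge> 2) at_infinity"
    by (auto simp: filterlim_at_infinity[of 0] )
  then obtain B where B: "\<And>x. norm x \<ge> B \<Longrightarrow> norm (poly p x) \<ge> 2"
    by (auto simp: eventually_at_infinity)
  show "\<exists>x<b. \<bar>poly p x\<bar> \<ge> 2" using B[of "min (b - 1) (- \<bar>B\<bar>)"]
    by (intro exI[of _ "min (b - 1) (- \<bar>B\<bar>)"]) auto
  show "\<exists>x>b. \<bar>poly p x\<bar> \<ge> 2" using B[of "max (b + 1) \<bar>B\<bar>"]
    by (intro exI[of _ "max (b + 1) \<bar>B\<bar>"]) auto
qed

lemma poly_level_between:
  assumes "a < b" "s n * poly p a \<ge> c" "s n * poly p b \<le> c"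
  shows "\<exists>x. a \<le> x \<and> x \<le> b \<and> s n * poly p x = c"
proof -
  have "\<exists>x\<ge>a. x \<le> b \<and> s n * poly p x = c"
    by (rule IVT2'[where f = "\<lambda>x. s n * poly p x"]) (use assms in \<open>auto intro!: continuous_intros\<close>)
  then show ?thesis by blast
qed

lemma edges_exist:
  assumes n: "n < m"
  shows "\<exists>x\<in>branch n. s n * poly p x = 2" "\<exists>x\<in>branch n. s n * poly p x = - 2"
proof -
  have "\<exists>a\<in>branch n. a < z n \<and> s n * poly p a \<ge> 2"
  proof (cases n)
    case 0
    obtain x where x: "x < z 0" "\<bar>poly p x\<bar> \<ge> 2" using poly_large by blast
    have xb: "x \<in> branch n" using 0 x z_less(1)[of 0] by (auto simp: branch_def)
    then have "s n * poly p x > 0"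
      using branch_decreasing[OF n xb z_branch[OF n]] x z_zero[OF n] 0 by simp
    then show ?thesis using x xb abs_s_mult[of n "poly p x"] 0 by (intro bexI[of _ x]) auto
  next
    case (Suc l)
    then show ?thesis using n peak[of l] z_less(2)[of l] kappa_branch(1)[of n]
      by (intro bexI[of _ "\<kappa> n"]) (auto simp: s_def)
  qed
  then obtain a where a: "a \<in> branch n" "a < z n" "s n * poly p a \<ge> 2" by blast
  have "\<exists>b\<in>branch n. z n < b \<and> s n * poly p b \<le> - 2"
  proof (cases "Suc n < m")
    case False
    obtain x where x: "x > z n" "\<bar>poly p x\<bar> \<ge> 2" using poly_large by blast
    have xb: "x \<in> branch n" using False n x z_less(2)[of "n - 1"] by (auto simp: branch_def)
    then have "s n * poly p x < 0"
      using branch_decreasing[OF n z_branch[OF n] xb] x z_zero[OF n] by simp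
    then show ?thesis using x xb abs_s_mult[of n "poly p x"] by (intro bexI[of _ x]) auto
  next
    case True
    then show ?thesis using n peak[of n] z_less(1)[of n] kappa_branch(2)[of n] s_Suc[of n]
      by (intro bexI[of _ "\<kappa> (Suc n)"]) (auto simp: s_def)
  qed
  then obtain b where b: "b \<in> branch n" "z n < b" "s n * poly p b \<le> - 2" by blast
  have z: "s n * poly p (z n) = 0" using z_zero n by simp
  show "\<exists>x\<in>branch n. s n * poly p x = 2"
    using poly_level_between[of a "z n" 2 n] a z branch_convex[OF a(1) z_branch[OF n]] by auto
  show "\<exists>x\<in>branch n. s n * poly p x = - 2"
    using poly_level_between[of "z n" b "- 2" n] b z branch_convex[OF z_branch[OF n] b(1)] by auto
qed

definition lp :: "nat \<Rightarrow> real" where "lp n = (SOME x. x \<in> branch n \<and> s n * poly p x = 2)"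
definition lm :: "nat \<Rightarrow> real" where
  "lm n = (SOME x. x \<in> branch (n - 1) \<and> s (n - 1) * poly p x = - 2)"

lemma lp: "n < m \<Longrightarrow> lp n \<in> branch n" "n < m \<Longrightarrow> s n * poly p (lp n) = 2"
  using someI_ex[of "\<lambda>x. x \<in> branch n \<and> s n * poly p x = 2"] edges_exist(1)[of n]
  unfolding lp_def by blast+

lemma lm: "n < m \<Longrightarrow> lm (Suc n) \<in> branch n" "n < m \<Longrightarrow> s n * poly p (lm (Suc n)) = - 2"
  using someI_ex[of "\<lambda>x. x \<in> branch n \<and> s n * poly p x = - 2"] edges_exist(2)[of n]
  unfolding lm_def by auto

lemma band_iff:
  assumes "n < m" "x \<in> branch n"
  shows "\<bar>poly p x\<bar> \<le> 2 \<longleftrightarrow> lp n \<le> x \<and> x \<le> lm (Suc n)"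
  using branch_le_iff[OF assms lp(1)[OF assms(1)]] branch_le_iff[OF assms(1) lm(1)[OF assms(1)] assms(2)]
    lp(2)[OF assms(1)] lm(2)[OF assms(1)] abs_s_mult[of n "poly p x"] by auto

lemma lp_less_lm: "n < m \<Longrightarrow> lp n < z n" "n < m \<Longrightarrow> z n < lm (Suc n)"
  using branch_le_iff[OF _ lp(1) z_branch, of n] branch_le_iff[OF _ z_branch lm(1), of n]
    lp(2)[of n] lm(2)[of n] z_zero[of n] by force+

lemma gap_order: "Suc n < m \<Longrightarrow> lm (Suc n) \<le> \<kappa> (Suc n)" "Suc n < m \<Longrightarrow> \<kappa> (Suc n) \<le> lp (Suc n)"
  using lm(1)[of n] lp(1)[of "Suc n"] by (auto simp: branch_def)

lemma poly_edges_lm_lp: "poly_edges m p lm lp"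
  unfolding poly_edges_def
proof (intro conjI ballI)
  show "{x. \<bar>poly p x\<bar> \<le> 2} = (\<Union>n\<in>{0..m - 1}. {lp n..lm (n + 1)})"
  proof (intro equalityI subsetI)
    fix x assume x: "x \<in> {x. \<bar>poly p x\<bar> \<le> 2}"
    obtain n where "n < m" "x \<in> branch n" using branch_cover by blast
    then show "x \<in> (\<Union>n\<in>{0..m - 1}. {lp n..lm (n + 1)})" using band_iff x by force
  next
    fix x assume "x \<in> (\<Union>n\<in>{0..m - 1}. {lp n..lm (n + 1)})"
    then obtain n where "n \<in> {0..m - 1}" "lp n \<le> x" "x \<le> lm (Suc n)" by auto
    moreover from this have "n < m" using m2 by auto
    ultimately have n: "n < m" "lp n \<le> x" "x \<le> lm (Suc n)" by auto
    then have "x \<in> branch n" using lp lm branch_convex by blast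
    then show "x \<in> {x. \<bar>poly p x\<bar> \<le> 2}" using band_iff n by blast
  qed
  fix n
  show "lp n < lm (n + 1)" if "n \<in> {0..m - 1}"
  proof -
    have "n < m" using that m2 by auto
    then show ?thesis using lp_less_lm[of n] by auto
  qed
  show "lm n \<le> lp n" if "n \<in> {1..m - 1}"
  proof -
    have "n < m" using that m2 by auto
    then show ?thesis using gap_order[of "n - 1"] that by auto
  qed
  show "(-1) ^ (m - n) * poly p (lp n) = 2" if "n \<in> {0..m - 1}"
  proof -
    have "n < m" using that m2 by auto
    then show ?thesis using lp(2)[of n] by (auto simp: s_def)
  qed
  show "(-1) ^ (m - n) * poly p (lm n) = 2" if "n \<in> {1..m}"
    using lm(2)[of "n - 1"] that m2 s_Suc[of "n - 1"] by (auto simp: s_def)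
qed

text \<open>
  The competing bands contain one zero of \<open>p\<close> each, and there are only \<open>m\<close> zeros, so the \<open>n\<close>-th band
  contains \<open>z\<^sub>n\<close>. If its left edge were not in branch \<open>n\<close>, the band would contain \<open>\<kappa>\<^sub>n\<close>, where
  \<open>\<bar>p\<bar> \<ge> 2\<close>; then \<open>\<bar>p (\<kappa>\<^sub>n)\<bar> = 2\<close>, and \<open>p\<close> would take the same value twice on branch \<open>n - 1\<close>. So
  the edge lies in branch \<open>n\<close>, where \<open>p\<close> is injective.
\<close>

lemma poly_edges_unique:
  assumes "poly_edges m p lm' lp'"
  shows "n < m \<Longrightarrow> lp' n = lp n" "n < m \<Longrightarrow> lm' (Suc n) = lm (Suc n)"
proof -
  have U: "\<bar>poly p x\<bar> \<le> 2" if "n < m" "lp' n \<le> x" "x \<le> lm' (Suc n)" for n x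
  proof -
    have "x \<in> (\<Union>n\<in>{0..m - 1}. {lp' n..lm' (n + 1)})" using that by force
    then show ?thesis using assms unfolding poly_edges_def by blast
  qed
  have ord: "\<And>n. n < m \<Longrightarrow> lp' n < lm' (Suc n)" "\<And>n. Suc n < m \<Longrightarrow> lm' (Suc n) \<le> lp' (Suc n)"
    using assms by (auto simp: poly_edges_def)
  have val_p: "s n * poly p (lp' n) = 2" if "n < m" for n
    using assms that by (auto simp: poly_edges_def s_def)
  have val_m: "s n * poly p (lm' (Suc n)) = - 2" if "n < m" for n
  proof -
    have "s (Suc n) * poly p (lm' (Suc n)) = 2"
      using assms that by (auto simp: poly_edges_def s_def)
    then show ?thesis using s_Suc[OF that] by simp
  qed
  have "\<exists>x. lp' n < x \<and> x < lm' (Suc n) \<and> poly p x = 0" if nm: "n < m" for n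
  proof -
    obtain x where x: "lp' n \<le> x" "x \<le> lm' (Suc n)" "s n * poly p x = 0"
      using poly_level_between[of "lp' n" "lm' (Suc n)" 0 n] val_p[OF nm] val_m[OF nm] ord(1)[OF nm]
      by fastforce
    then have "x \<noteq> lp' n" "x \<noteq> lm' (Suc n)" using val_p[OF nm] val_m[OF nm] by auto
    moreover have "poly p x = 0" using s_cancel[of n "poly p x" 0] x by simp
    ultimately show ?thesis using x by (intro exI[of _ x]) auto
  qed
  then obtain z' where z': "\<And>n. n < m \<Longrightarrow> lp' n < z' n" "\<And>n. n < m \<Longrightarrow> z' n < lm' (Suc n)"
    "\<And>n. n < m \<Longrightarrow> poly p (z' n) = 0" by metis
  have z'_mono: "z' n < z' (Suc n)" if "Suc n < m" for n
    using z'(2)[of n] z'(1)[of "Suc n"] ord(2)[of n] that by simp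
  have z'_strict: "i < j \<Longrightarrow> j < m \<Longrightarrow> z' i < z' j" for i j
  proof (induction j)
    case (Suc j)
    then show ?case using z'_mono[of j] by (cases "i = j") auto
  qed simp
  have "inj_on z' {..<m}" by (rule linorder_inj_onI') (use z'_strict in fastforce)
  then have "z' ` {..<m} = {x. poly p x = 0}"
    using z'(3) card_poly_roots_bound[of p] p_nonzero deg
    by (intro card_seteq) (auto simp: poly_roots_finite card_image)
  then have zz: "z' n = z n" if "n < m" for n
    using strict_mono_on_enum_unique[of m z' z n] z'_mono z_mono zeros that by auto
  have lo: "lp' n < z n" and hi: "z n < lm' (Suc n)" if "n < m" for n
    using z'(1,2)[OF that] zz[OF that] by auto
  show "lp' n = lp n" if n: "n < m" for n
  proof (cases "lp' n \<in> branch n")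
    case True
    then show ?thesis using n lp branch_inj[OF n True lp(1)] val_p s_cancel[of n] by metis
  next
    case False
    then obtain l where l: "n = Suc l" "lp' n < \<kappa> n"
      using lo[OF n] z_branch[OF n] by (cases n) (auto simp: branch_def)
    have "\<bar>poly p (\<kappa> n)\<bar> \<le> 2"
      using U[OF n, of "\<kappa> n"] l lo[OF n] hi[OF n] z_branch[OF n] by (auto simp: branch_def)
    then have "s n * poly p (\<kappa> n) = 2" using peak[of l] n l abs_s_mult[of n "poly p (\<kappa> n)"] by (auto simp: s_def)
    then have "poly p (lp' n) = poly p (\<kappa> n)" using val_p[OF n] s_cancel[of n] by metis
    moreover have "lp' n \<in> branch l"
      using hi[of l] ord(2)[of l] z_branch[of l] l n by (auto simp: branch_def)
    ultimately have "lp' n = \<kappa> n" using branch_inj[of l] kappa_branch(2)[of l] l n by auto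
    then show ?thesis using l by simp
  qed
  show "lm' (Suc n) = lm (Suc n)" if n: "n < m" for n
  proof (cases "lm' (Suc n) \<in> branch n")
    case True
    then show ?thesis using n lm branch_inj[OF n True lm(1)] val_m s_cancel[of n] by metis
  next
    case False
    then have l: "Suc n < m" "\<kappa> (Suc n) < lm' (Suc n)"
      using hi[OF n] z_branch[OF n] by (auto simp: branch_def)
    have "\<bar>poly p (\<kappa> (Suc n))\<bar> \<le> 2"
      using U[OF n, of "\<kappa> (Suc n)"] l lo[OF n] z_less(1)[of n] by auto
    then have "s n * poly p (\<kappa> (Suc n)) = - 2"
      using peak[of n] l s_Suc[OF n] abs_s_mult[of n "poly p (\<kappa> (Suc n))"] by (auto simp: s_def)
    then have "poly p (lm' (Suc n)) = poly p (\<kappa> (Suc n))" using val_m[OF n] s_cancel[of n] by metis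
    moreover have "lm' (Suc n) \<in> branch (Suc n)"
      using lo[of "Suc n"] ord(2)[of n] z_branch[of "Suc n"] l n by (auto simp: branch_def)
    ultimately have "lm' (Suc n) = \<kappa> (Suc n)"
      using branch_inj[of "Suc n"] kappa_branch(1)[of "Suc n"] l by auto
    then show ?thesis using l by simp
  qed
qed

lemma gap_crit_unique:
  assumes "Suc n < m" "lm (Suc n) \<le> x" "x \<le> lp (Suc n)" "poly (pderiv p) x = 0"
  shows "x = \<kappa> (Suc n)"
proof -
  have "z n < x" "x < z (Suc n)" using lp_less_lm(2)[of n] lp_less_lm(1)[of "Suc n"] assms by auto
  then show ?thesis
    using branch_no_crit[of n "z n" "\<kappa> (Suc n)" x] branch_no_crit[of "Suc n" "\<kappa> (Suc n)" "z (Suc n)" x]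
      z_branch[of n] z_branch[of "Suc n"] kappa_branch(2)[of n] kappa_branch(1)[of "Suc n"] assms
    by (metis Suc_lessD linorder_neqE_linordered_idom zero_less_Suc)
qed

lemma gap_ge_two:
  assumes "Suc n < m" "lm (Suc n) \<le> x" "x \<le> lp (Suc n)"
  shows "s (Suc n) * poly p x \<ge> 2"
proof (cases "x \<le> \<kappa> (Suc n)")
  case True
  then have "x \<in> branch n"
    using branch_convex[OF lm(1)[of n] kappa_branch(2)[of n]] assms by auto
  then show ?thesis
    using branch_le_iff[of n x "lm (Suc n)"] lm[of n] assms s_Suc[of n] by auto
next
  case False
  then have "x \<in> branch (Suc n)"
    using branch_convex[OF kappa_branch(1)[of "Suc n"] lp(1)[of "Suc n"]] assms by auto
  then show ?thesis
    using branch_le_iff[of "Suc n" "lp (Suc n)" x] lp[of "Suc n"] assms by auto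
qed

lemma kappa_max:
  assumes "Suc n < m" "x \<in> branch n \<or> x \<in> branch (Suc n)"
  shows "s (Suc n) * poly p x \<le> s (Suc n) * poly p (\<kappa> (Suc n))"
  using assms(2)
proof
  assume "x \<in> branch n"
  then show ?thesis
    using branch_le_iff[of n "\<kappa> (Suc n)" x] kappa_branch(2)[of n] assms(1) s_Suc[of n]
    by (auto simp: branch_def)
next
  assume "x \<in> branch (Suc n)"
  then show ?thesis
    using branch_le_iff[of "Suc n" x "\<kappa> (Suc n)"] kappa_branch(1)[of "Suc n"] assms(1)
    by (auto simp: branch_def)
qed

lemma in_gap_if_ge_two:
  assumes "Suc n < m" "z n < x" "x < z (Suc n)" "s (Suc n) * poly p x \<ge> 2"
  shows "lm (Suc n) \<le> x" "x \<le> lp (Suc n)"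
proof -
  show "lm (Suc n) \<le> x"
  proof (cases "x \<le> \<kappa> (Suc n)")
    case True
    then have "x \<in> branch n"
      using branch_convex[OF z_branch[of n] kappa_branch(2)[of n]] assms by auto
    then show ?thesis
      using branch_le_iff[of n x "lm (Suc n)"] lm[of n] assms s_Suc[of n] by auto
  qed (use gap_order assms in fastforce)
  show "x \<le> lp (Suc n)"
  proof (cases "x \<ge> \<kappa> (Suc n)")
    case True
    then have "x \<in> branch (Suc n)"
      using branch_convex[OF kappa_branch(1)[of "Suc n"] z_branch[of "Suc n"]] assms by auto
    then show ?thesis
      using branch_le_iff[of "Suc n" "lp (Suc n)" x] lp[of "Suc n"] assms by auto
  qed (use gap_order assms in fastforce)
qed

end

text \<open>
  The points \<open>\<mu>\<^sub>n\<close> force a zero in each interval \<open>(\<mu>\<^sub>n, \<mu>\<^sub>n\<^sub>+\<^sub>1)\<close> and a maximum of \<open>\<plusminus> p\<close> between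
  consecutive zeros, so \<open>p\<close> is oscillating. The points \<open>a\<^sub>n\<close> lie inside the bands and confine
  the gaps.
\<close>

lemma band_structure:
  fixes p :: "real poly" and a \<mu> :: "nat \<Rightarrow> real"
  assumes m2: "m \<ge> 2" and deg: "degree p = m"
    and a: "\<And>n. n < m \<Longrightarrow> \<mu> n < a n" "\<And>n. n < m \<Longrightarrow> a n < \<mu> (Suc n)"
    and a2: "\<And>n. n < m \<Longrightarrow> \<bar>poly p (a n)\<bar> < 2"
    and ends: "(-1) ^ m * poly p (\<mu> 0) > 0" "poly p (\<mu> m) > 0"
    and alt: "\<And>n. n \<in> {1..<m} \<Longrightarrow> (-1) ^ (m - n) * poly p (\<mu> n) \<ge> 2"
  obtains lm lp \<kappa> where "poly_edges m p lm lp"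
    and "\<And>lm' lp' n. poly_edges m p lm' lp' \<Longrightarrow> n \<in> {1..<m} \<Longrightarrow> lm' n = lm n \<and> lp' n = lp n"
    and "\<And>n. n \<in> {1..<m} \<Longrightarrow> a (n - 1) < lm n \<and> lm n \<le> \<kappa> n \<and> \<kappa> n \<le> lp n \<and> lp n < a n"
    and "\<And>n. n \<in> {1..<m} \<Longrightarrow> poly (pderiv p) (\<kappa> n) = 0"
    and "\<And>n x. n \<in> {1..<m} \<Longrightarrow> x \<in> {lm n..lp n} \<Longrightarrow> poly (pderiv p) x = 0 \<Longrightarrow> x = \<kappa> n"
    and "\<And>n. n \<in> {1..<m} \<Longrightarrow> (-1) ^ (m - n) * poly p (\<kappa> n) \<ge> 2"
    and "\<And>n x. n \<in> {1..<m} \<Longrightarrow> x \<in> {a (n - 1)..a n} \<Longrightarrow>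
          (-1) ^ (m - n) * poly p x \<le> (-1) ^ (m - n) * poly p (\<kappa> n)"
proof -
  have pos: "(-1) ^ (m - n) * poly p (\<mu> n) > 0" if nm: "n \<le> m" for n
  proof -
    consider "n = 0" | "n = m" | "n \<in> {1..<m}" using nm by fastforce
    then show ?thesis using ends alt[of n] by cases auto
  qed
  have "\<exists>x. \<mu> n < x \<and> x < \<mu> (Suc n) \<and> poly p x = 0" if n: "n < m" for n
  proof -
    have "(-1) ^ (m - n) = - ((-1 :: real) ^ (m - Suc n))"
      using n by (simp add: Suc_diff_Suc[symmetric])
    moreover have "((-1 :: real) ^ (m - Suc n)) * ((-1) ^ (m - Suc n)) = 1"
      by (simp add: power_mult_distrib[symmetric])
    ultimately have "poly p (\<mu> n) * poly p (\<mu> (Suc n)) < 0"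
      using mult_pos_pos[OF pos[of n] pos[of "Suc n"]] n by (auto simp: mult_ac mult_less_0_iff zero_less_mult_iff)
    moreover have "\<mu> n < \<mu> (Suc n)" using a[OF n] by simp
    ultimately show ?thesis using poly_IVT[of "\<mu> n" "\<mu> (Suc n)" p] by blast
  qed
  then obtain z where z: "\<And>n. n < m \<Longrightarrow> \<mu> n < z n" "\<And>n. n < m \<Longrightarrow> z n < \<mu> (Suc n)"
    "\<And>n. n < m \<Longrightarrow> poly p (z n) = 0" by metis
  have "\<exists>k. z n < k \<and> k < z (Suc n) \<and> poly (pderiv p) k = 0 \<and> (-1) ^ (m - Suc n) * poly p k \<ge> 2"
    if n: "Suc n < m" for n
  proof -
    define f where "f x = (-1) ^ (m - Suc n) * poly p x" for x
    have mu: "z n < \<mu> (Suc n)" "\<mu> (Suc n) < z (Suc n)" using z n by auto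
    have "continuous_on {z n..z (Suc n)} f" unfolding f_def by (intro continuous_intros)
    moreover have "compact {z n..z (Suc n)}" "{z n..z (Suc n)} \<noteq> {}" using mu by auto
    ultimately obtain k where k: "k \<in> {z n..z (Suc n)}" "\<And>x. x \<in> {z n..z (Suc n)} \<Longrightarrow> f x \<le> f k"
      using continuous_attains_sup by metis
    have "f (\<mu> (Suc n)) \<ge> 2" using alt[of "Suc n"] n by (simp add: f_def)
    moreover have "\<mu> (Suc n) \<in> {z n..z (Suc n)}" using mu by simp
    ultimately have fk: "f k \<ge> 2" using k(2) by force
    moreover have "f (z n) = 0" "f (z (Suc n)) = 0" using z n by (auto simp: f_def)
    ultimately have "k \<noteq> z n" "k \<noteq> z (Suc n)" by auto
    then have kk: "z n < k" "k < z (Suc n)" using k(1) by auto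
    have "(f has_real_derivative (-1) ^ (m - Suc n) * poly (pderiv p) k) (at k)"
      unfolding f_def by (intro DERIV_cmult poly_DERIV)
    then have "(-1) ^ (m - Suc n) * poly (pderiv p) k = 0"
    proof (rule DERIV_local_max)
      show "0 < min (k - z n) (z (Suc n) - k)" using kk by simp
      show "\<forall>y. \<bar>k - y\<bar> < min (k - z n) (z (Suc n) - k) \<longrightarrow> f y \<le> f k"
        by (intro allI impI k(2)) (auto simp: abs_less_iff)
    qed
    then show ?thesis using kk fk by (intro exI[of _ k]) (auto simp: f_def)
  qed
  then obtain K where K: "\<And>n. Suc n < m \<Longrightarrow> z n < K n" "\<And>n. Suc n < m \<Longrightarrow> K n < z (Suc n)"
    "\<And>n. Suc n < m \<Longrightarrow> poly (pderiv p) (K n) = 0"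
    "\<And>n. Suc n < m \<Longrightarrow> (-1) ^ (m - Suc n) * poly p (K n) \<ge> 2" by metis
  define \<kappa> where "\<kappa> n = K (n - 1)" for n
  interpret oscillating_poly p m z \<kappa>
    by unfold_locales (use m2 deg z K in \<open>auto simp: \<kappa>_def\<close>)
  have loc: "lm (Suc n) \<le> \<mu> (Suc n)" "\<mu> (Suc n) \<le> lp (Suc n)" if "Suc n < m" for n
    using in_gap_if_ge_two[of n "\<mu> (Suc n)"] z that alt[of "Suc n"] by (auto simp: s_def)
  have out: "a j \<notin> {lm (Suc n)..lp (Suc n)}" if "Suc n < m" "j < m" for n j
    using gap_ge_two[OF that(1), of "a j"] a2[OF that(2)] abs_s_mult[of "Suc n" "poly p (a j)"] by auto
  have al: "a n < lm (Suc n)" "lp (Suc n) < a (Suc n)" if "Suc n < m" for n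
    using out[OF that, of n] out[OF that, of "Suc n"] loc[OF that] a(2)[of n] a(1)[of "Suc n"] that by auto
  show ?thesis
  proof (rule that[OF poly_edges_lm_lp])
    fix lm' lp' n assume "poly_edges m p lm' lp'" "n \<in> {1..<m}"
    then show "lm' n = lm n \<and> lp' n = lp n"
      using poly_edges_unique[of lm' lp' "n - 1"] poly_edges_unique[of lm' lp' n] by auto
  next
    fix n assume n: "n \<in> {1..<m}"
    then obtain l where l: "n = Suc l" "Suc l < m" by (cases n) auto
    show "a (n - 1) < lm n \<and> lm n \<le> \<kappa> n \<and> \<kappa> n \<le> lp n \<and> lp n < a n"
      using al[OF l(2)] gap_order[OF l(2)] l by simp
    show "poly (pderiv p) (\<kappa> n) = 0" "(-1) ^ (m - n) * poly p (\<kappa> n) \<ge> 2"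
      using crit[OF l(2)] peak[OF l(2)] l by auto
    fix x
    show "x = \<kappa> n" if "x \<in> {lm n..lp n}" "poly (pderiv p) x = 0"
      using gap_crit_unique[OF l(2)] that l by auto
    assume x: "x \<in> {a (n - 1)..a n}"
    have "x \<in> branch l \<or> x \<in> branch (Suc l)"
    proof (cases "x \<le> \<kappa> (Suc l)")
      case True
      have "l > 0 \<Longrightarrow> \<kappa> l \<le> x"
        using al(2)[of "l - 1"] gap_order(2)[of "l - 1"] x l by simp
      then show ?thesis using True by (simp add: branch_def)
    next
      case False
      have "Suc (Suc l) < m \<Longrightarrow> x \<le> \<kappa> (Suc (Suc l))"
        using al(1)[of "Suc l"] gap_order(1)[of "Suc l"] x l by simp
      then show ?thesis using False by (simp add: branch_def)
    qed
    then show "(-1) ^ (m - n) * poly p x \<le> (-1) ^ (m - n) * poly p (\<kappa> n)"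
      using kappa_max[OF l(2), of x] l by (simp add: s_def)
  qed
qed

section \<open>The odd sine basis\<close>

lemma sin_mult_sum_cos_odd:
  "2 * sin x * (\<Sum>j=1..n. cos ((2 * real j - 1) * x)) = sin (2 * real n * x)"
proof (induction n)
  case (Suc n)
  have "2 * sin x * cos ((2 * real (Suc n) - 1) * x) = sin (2 * real (Suc n) * x) - sin (2 * real n * x)"
  proof -
    let ?b = "(2 * real (Suc n) - 1) * x"
    have "2 * real (Suc n) * x = ?b + x" "2 * real n * x = ?b - x"
      by (simp_all add: algebra_simps)
    then show ?thesis by (simp only: sin_add sin_diff) simp
  qed
  then show ?case using Suc by (simp add: distrib_left)
qed simp

lemma sin_mult_sum_cos:
  "2 * sin (y / 2) * (\<Sum>m=1..n. cos (real m * y)) = sin (real n * y + y / 2) - sin (y / 2)"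
proof (induction n)
  case (Suc n)
  have "2 * sin (y / 2) * cos (real (Suc n) * y)
      = sin (real (Suc n) * y + y / 2) - sin (real n * y + y / 2)"
  proof -
    have "real n * y + y / 2 = real (Suc n) * y - y / 2" by (simp add: algebra_simps)
    then show ?thesis by (simp only: sin_add sin_diff) simp
  qed
  then show ?case using Suc by (simp add: distrib_left)
qed simp

lemma sum_cos_odd_multiples:
  assumes "0 < d" "d < 2 * k"
  shows "(\<Sum>j=1..2 * k. cos ((2 * real j - 1) * (real d * pi / (2 * real k)))) = 0"
proof -
  let ?x = "real d * pi / (2 * real k)"
  have "?x < pi" using assms by (simp add: pos_divide_less_eq)
  then have "sin ?x > 0" using assms by (intro sin_gt_zero) auto
  moreover have "2 * real (2 * k) * ?x = real (2 * d) * pi" using assms by simp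
  then have "sin (2 * real (2 * k) * ?x) = 0" by (simp only: sin_npi)
  ultimately show ?thesis using sin_mult_sum_cos_odd[of ?x "2 * k"] by simp
qed

text \<open>
  Discrete orthogonality at half-integer nodes. At \<open>m = l = k\<close> the summand is constantly \<open>1\<close> instead
  of \<open>1 / 2\<close> on average, hence the extra factor \<open>2\<close>.
\<close>

lemma sum_sin_sin_odd:
  assumes "k \<ge> 1" "m \<in> {1..k}" "l \<in> {1..k}"
  shows "(\<Sum>j=1..2 * k. sin ((2 * real j - 1) * real m * pi / (2 * real k))
                         * sin ((2 * real j - 1) * real l * pi / (2 * real k)))
       = (if m = l then real k * 2 ^ of_bool (k = m) else 0)"
proof -
  define C where "C d = (\<Sum>j=1..2 * k. cos ((2 * real j - 1) * (d * pi / (2 * real k))))" for d :: real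
  have C0: "C 0 = 2 * real k" by (simp add: C_def)
  have C2: "C (real (2 * k)) = - 2 * real k"
  proof -
    have "cos ((2 * real j - 1) * (real (2 * k) * pi / (2 * real k))) = - 1" if "j \<in> {1..2*k}" for j
    proof -
      have "(2 * real j - 1) * (real (2 * k) * pi / (2 * real k)) = real j * (2 * pi) - pi"
        using assms by (simp add: algebra_simps)
      then show ?thesis using cos_npi[of "2 * j"] by (simp add: cos_diff mult.commute mult.left_commute)
    qed
    then show ?thesis unfolding C_def by simp
  qed
  have Cd: "C (real d) = 0" if "0 < d" "d < 2 * k" for d
    unfolding C_def using that by (rule sum_cos_odd_multiples)
  have Cm: "C (- d) = C d" for d unfolding C_def by (simp add: minus_divide_left[symmetric])
  have "(\<Sum>j=1..2 * k. sin ((2 * real j - 1) * real m * pi / (2 * real k))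
                         * sin ((2 * real j - 1) * real l * pi / (2 * real k)))
       = (C (real m - real l) - C (real (m + l))) / 2"
    unfolding C_def sum_subtractf[symmetric] sum_divide_distrib sin_times_sin
    by (intro sum.cong refl) (simp add: algebra_simps add_divide_distrib diff_divide_distrib)
  moreover consider "m = l" "m = k" | "m = l" "m < k" | "m < l" | "l < m" using assms by force
  then have "(C (real m - real l) - C (real (m + l))) / 2
      = (if m = l then real k * 2 ^ of_bool (k = m) else 0)"
  proof cases
    case 1
    then have "C (real (m + l)) = - 2 * real k" using C2 by (simp add: mult_2[symmetric])
    then show ?thesis using 1 C0 by simp
  next
    case 2
    then show ?thesis using C0 Cd[of "m + l"] assms by simp
  next
    case 3
    then show ?thesis using Cd[of "l - m"] Cd[of "m + l"] Cm[of "real l - real m"] assms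
      by (simp add: of_nat_diff)
  next
    case 4
    then show ?thesis using Cd[of "m - l"] Cd[of "m + l"] assms
      by (simp add: of_nat_diff)
  qed
  ultimately show ?thesis by simp
qed

definition ehat_scale :: "nat \<Rightarrow> nat \<Rightarrow> real" where
  "ehat_scale k m = 2 powr (- of_bool (k = m) / 2) / sqrt (real k)"

lemma ehat_scale_sq: "(ehat_scale k m)\<^sup>2 = 1 / (real k * 2 ^ of_bool (k = m))"
  by (simp add: ehat_scale_def power_divide powr_minus powr_half_sqrt power_inverse divide_simps)

lemma ehat_eq:
  "j \<in> {1..2 * k} \<Longrightarrow> ehat k m j = ehat_scale k m * sin ((2 * real j - 1) * real m * pi / (2 * real k))"
  by (simp add: ehat_def ehat_scale_def)

lemma ehat_orthonormal:
  assumes "k \<ge> 1" "m \<in> {1..k}" "l \<in> {1..k}"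
  shows "(\<Sum>j=1..2 * k. ehat k m j * ehat k l j) = (if m = l then 1 else 0)"
proof -
  have "(\<Sum>j=1..2 * k. ehat k m j * ehat k l j)
      = ehat_scale k m * ehat_scale k l * (if m = l then real k * 2 ^ of_bool (k = m) else 0)"
    unfolding sum_sin_sin_odd[OF assms, symmetric] sum_distrib_left
    by (intro sum.cong refl) (simp add: ehat_eq mult_ac)
  moreover have "ehat_scale k m * ehat_scale k m * (real k * 2 ^ of_bool (k = m)) = 1"
    using assms by (simp add: ehat_scale_sq flip: power2_eq_square)
  ultimately show ?thesis by auto
qed

text \<open>
  Half of the sum over a full period of length \<open>2 k\<close>: the terms \<open>m\<close> and \<open>2 k - m\<close> agree, so \<open>m = k\<close> is
  counted with weight \<open>1 / 2\<close>, and the missing half of the term \<open>m = 0\<close> is the \<open>- 1 / 2\<close>.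
\<close>

lemma half_weighted_sum_cos:
  fixes d :: int
  assumes "k \<ge> 1"
  shows "(\<Sum>m=1..k. (if m = k then 1 / 2 else 1) * cos (real m * (real_of_int d * pi / real k)))
       = (if 2 * int k dvd d then real k else 0) - 1 / 2"
proof -
  let ?y = "real_of_int d * pi / real k"
  define S where "S = (\<Sum>m=1..k. cos (real m * ?y))"
  have "(\<Sum>m=1..k. (if m = k then 1 / 2 else 1) * cos (real m * ?y))
      = (\<Sum>m=1..k. cos (real m * ?y) - (if m = k then cos (real m * ?y) / 2 else 0))"
    by (intro sum.cong refl) simp
  also have "\<dots> = S - cos (real k * ?y) / 2"
    using assms by (simp add: S_def sum_subtractf)
  finally have *: "(\<Sum>m=1..k. (if m = k then 1 / 2 else 1) * cos (real m * ?y)) = S - cos (real k * ?y) / 2" .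
  have ky: "real k * ?y = real_of_int d * pi" using assms by simp
  show ?thesis
  proof (cases "2 * int k dvd d")
    case True
    then obtain c where d: "d = 2 * int k * c" by (auto elim: dvdE)
    \<comment> \<open>Here \<open>?y\<close> is a multiple of \<open>2 \<pi>\<close>.\<close>
    have c1: "cos (real m * ?y) = 1" for m
    proof -
      have "real m * ?y = 2 * pi * real_of_int (int m * c)" using assms by (simp add: d)
      then show ?thesis by (simp only: cos_int_2pin)
    qed
    then show ?thesis using * True unfolding S_def c1 by simp
  next
    case False
    have "sin (?y / 2) \<noteq> 0"
    proof
      assume "sin (?y / 2) = 0"
      then obtain i :: int where "?y / 2 = of_int i * pi" by (auto simp: sin_zero_iff_int2)
      then have "real_of_int d = real_of_int (2 * int k * i)"
        using assms by (simp add: field_simps)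
      then have "d = 2 * int k * i" by (simp only: of_int_eq_iff)
      then show False using False by simp
    qed
    moreover have "sin (real k * ?y + ?y / 2) = cos (real k * ?y) * sin (?y / 2)"
      unfolding sin_add ky by (simp add: sin_zero_iff_int2)
    then have "sin (?y / 2) * (2 * S) = sin (?y / 2) * (cos (real k * ?y) - 1)"
      using sin_mult_sum_cos[of ?y k] unfolding S_def[symmetric]
      by (simp only: right_diff_distrib mult_ac mult_1_right)
    ultimately have "2 * S = cos (real k * ?y) - 1" by (metis mult_cancel_left)
    then show ?thesis using * False by simp
  qed
qed

text \<open>
  The right side is the kernel of the orthogonal projection onto the odd vectors.
\<close>

lemma ehat_complete:
  assumes k: "k \<ge> 1" and j: "j \<in> {1..2 * k}" and l: "l \<in> {1..2 * k}"
  shows "(\<Sum>m=1..k. ehat k m j * ehat k m l)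
       = (of_bool (j = l) - of_bool (j = 2 * k + 1 - l)) / 2"
proof -
  define S where "S d = (\<Sum>m=1..k. (if m = k then 1 / 2 else 1) * cos (real m * (real_of_int d * pi / real k)))"
    for d :: int
  have S: "S d = (if 2 * int k dvd d then real k else 0) - 1 / 2" for d
    unfolding S_def by (rule half_weighted_sum_cos[OF k])
  have "ehat k m j * ehat k m l = (if m = k then 1 / 2 else 1) / (2 * real k) *
     (cos (real m * (real_of_int (int j - int l) * pi / real k))
      - cos (real m * (real_of_int (int j + int l - 1) * pi / real k)))" for m
  proof -
    have "ehat k m j * ehat k m l = (ehat_scale k m)\<^sup>2 *
      (sin ((2 * real j - 1) * real m * pi / (2 * real k)) * sin ((2 * real l - 1) * real m * pi / (2 * real k)))"
      using j l by (simp add: ehat_eq power2_eq_square)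
    also have "\<dots> = (ehat_scale k m)\<^sup>2 *
     ((cos (real m * (real_of_int (int j - int l) * pi / real k))
      - cos (real m * (real_of_int (int j + int l - 1) * pi / real k))) / 2)"
    proof -
      have "(2 * real j - 1) * real m * pi / (2 * real k) - (2 * real l - 1) * real m * pi / (2 * real k)
          = real m * (real_of_int (int j - int l) * pi / real k)"
        "(2 * real j - 1) * real m * pi / (2 * real k) + (2 * real l - 1) * real m * pi / (2 * real k)
          = real m * (real_of_int (int j + int l - 1) * pi / real k)"
        using k by (auto simp: field_simps)
      then show ?thesis unfolding sin_times_sin by simp
    qed
    finally show ?thesis by (auto simp: ehat_scale_sq)
  qed
  then have "(\<Sum>m=1..k. ehat k m j * ehat k m l) = (S (int j - int l) - S (int j + int l - 1)) / (2 * real k)"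
    by (simp add: S_def sum_subtractf[symmetric] sum_divide_distrib right_diff_distrib diff_divide_distrib cong: if_cong)
  moreover have "2 * int k dvd int j - int l \<longleftrightarrow> j = l"
  proof
    assume "2 * int k dvd int j - int l"
    moreover have "\<bar>int j - int l\<bar> < 2 * int k" using j l by auto
    ultimately show "j = l" using dvd_imp_le_int[of "int j - int l" "2 * int k"] by force
  qed simp
  moreover have "2 * int k dvd int j + int l - 1 \<longleftrightarrow> j = 2 * k + 1 - l"
  proof
    assume "2 * int k dvd int j + int l - 1"
    then obtain c where c: "int j + int l - 1 = 2 * int k * c" by (auto elim: dvdE)
    have "0 < 2 * int k * c" "2 * int k * c < 2 * int k * 2"
      unfolding c[symmetric] using j l by auto
    then have "0 < c" "c < 2" using k by (auto simp: zero_less_mult_iff)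
    then have "c = 1" by simp
    then show "j = 2 * k + 1 - l" using c l by auto
  next
    assume "j = 2 * k + 1 - l"
    then have "int j + int l - 1 = 2 * int k" using l by auto
    then show "2 * int k dvd int j + int l - 1" by simp
  qed
  ultimately show ?thesis using k by (auto simp: S)
qed

lemma Qodd_antisym:
  assumes "q \<in> Qodd k" "n \<in> {1..2 * k}"
  shows "q (2 * k + 1 - n) = - q n"
proof (cases "n = 2 * k")
  case True
  then have "1 \<in> {1..2 * k - 1}" using assms by auto
  then have "q (2 * k + 1 - 1) = - q 1" using assms unfolding Qodd_def by blast
  then show ?thesis using True by simp
qed (use assms in \<open>auto simp: Qodd_def\<close>)

lemma qhat_eq_inner:
  assumes k: "k \<ge> 1" and q: "q \<in> Qodd k" and m: "m \<in> {1..k}"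
  shows "qhat k q m = (\<Sum>j=1..2 * k. q j * ehat k m j)"
  unfolding qhat_def
proof (rule the_equality)
  define c where "c m = (\<Sum>j=1..2 * k. q j * ehat k m j)" for m
  have "q n = (\<Sum>i=1..k. c i * ehat k i n)" for n
  proof (cases "n \<in> {1..2 * k}")
    case True
    have "(\<Sum>i=1..k. c i * ehat k i n) = (\<Sum>j=1..2 * k. q j * (\<Sum>i=1..k. ehat k i j * ehat k i n))"
      unfolding c_def sum_distrib_left sum_distrib_right
      by (subst sum.swap) (simp add: mult.assoc)
    also have "\<dots> = (\<Sum>j=1..2 * k. q j * of_bool (j = n) / 2 - q j * of_bool (j = 2 * k + 1 - n) / 2)"
      by (intro sum.cong refl, subst ehat_complete[OF k _ True])
        (simp_all add: right_diff_distrib diff_divide_distrib)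
    also have "\<dots> = (\<Sum>j=1..2 * k. (if j = n then q j / 2 else 0)) - (\<Sum>j=1..2 * k. if j = 2 * k + 1 - n then q j / 2 else 0)"
      unfolding sum_subtractf by (intro arg_cong2[of _ _ _ _ "(-)"] sum.cong) auto
    also have "\<dots> = q n / 2 - q (2 * k + 1 - n) / 2"
      using True by (subst (1 2) sum.delta) auto
    finally show ?thesis using Qodd_antisym[OF q True] by simp
  next
    case False
    then show ?thesis using q by (auto simp: Qodd_def ehat_def)
  qed
  then have "q = (\<lambda>n. \<Sum>i=1..k. c i * ehat k i n)" by (rule ext)
  moreover have "(\<Sum>j=1..2 * k. q j * ehat k m j) = c m" by (simp only: c_def)
  ultimately show "\<exists>c. q = (\<lambda>n. \<Sum>j=1..k. c j * ehat k j n) \<and> (\<Sum>j=1..2 * k. q j * ehat k m j) = c m"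
    by blast
next
  fix x assume "\<exists>c. q = (\<lambda>n. \<Sum>j=1..k. c j * ehat k j n) \<and> x = c m"
  then obtain c where c: "q = (\<lambda>n. \<Sum>j=1..k. c j * ehat k j n)" "x = c m" by blast
  have "(\<Sum>j=1..2 * k. q j * ehat k m j) = (\<Sum>i=1..k. c i * (\<Sum>j=1..2 * k. ehat k i j * ehat k m j))"
    unfolding c(1) sum_distrib_left sum_distrib_right
    by (subst sum.swap) (simp add: mult.assoc)
  also have "\<dots> = (\<Sum>i=1..k. if i = m then c i else 0)"
    by (intro sum.cong refl, subst ehat_orthonormal[OF k _ m]) simp_all
  also have "\<dots> = x" using m c(2) by simp
  finally show "x = (\<Sum>j=1..2 * k. q j * ehat k m j)" by simp
qed

text \<open>
  For \<open>n > k\<close> the frequencies \<open>n\<close> and \<open>2 k - n\<close> have the same sines at the half-integer nodes; this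
  is why the coordinate with index \<open>2 k - n\<close> governs the \<open>n\<close>-th gap.
\<close>

lemma sine_sum_sq_eq_qhat:
  assumes k: "k \<ge> 1" and q: "q \<in> Qodd k" and n: "n \<in> {1..<2 * k}"
  shows "(\<Sum>j=1..2 * k. q j * sin ((2 * real j - 1) * (pi * real n / (2 * real k))))\<^sup>2
       = real k * 2 ^ of_bool (k = n) * (qhat k q (if n \<le> k then n else 2 * k - n))\<^sup>2"
proof -
  define m where "m = (if n \<le> k then n else 2 * k - n)"
  have m: "m \<in> {1..k}" and mk: "k = m \<longleftrightarrow> k = n" using n by (auto simp: m_def)
  have "sin ((2 * real j - 1) * (pi * real n / (2 * real k)))
      = sin ((2 * real j - 1) * real m * pi / (2 * real k))" if "j \<in> {1..2 * k}" for j
  proof (cases "n \<le> k")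
    case False
    then have "(2 * real j - 1) * (pi * real n / (2 * real k))
        = (real j * (2 * pi) - pi) - (2 * real j - 1) * real m * pi / (2 * real k)"
      using n k by (simp add: m_def of_nat_diff field_simps)
    moreover have "sin (real j * (2 * pi) - pi) = 0" "cos (real j * (2 * pi) - pi) = - 1"
      using sin_npi[of "2 * j"] cos_npi[of "2 * j"]
      by (simp_all add: cos_diff sin_diff mult.commute mult.left_commute)
    ultimately show ?thesis by (simp add: sin_diff)
  qed (simp add: m_def mult_ac)
  then have e: "ehat_scale k m * (\<Sum>j=1..2 * k. q j * sin ((2 * real j - 1) * (pi * real n / (2 * real k))))
      = qhat k q m"
    unfolding qhat_eq_inner[OF k q m] sum_distrib_left
    by (intro sum.cong refl) (simp add: ehat_eq mult_ac)
  have "(qhat k q m)\<^sup>2 = (ehat_scale k m)\<^sup>2 *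
     (\<Sum>j=1..2 * k. q j * sin ((2 * real j - 1) * (pi * real n / (2 * real k))))\<^sup>2"
    unfolding e[symmetric] by (rule power_mult_distrib)
  then show ?thesis using k by (simp add: ehat_scale_sq mk flip: m_def)
qed

lemma Qodd_sum_zero:
  assumes q: "q \<in> Qodd k" and f: "\<And>j. j \<in> {1..2 * k} \<Longrightarrow> f (2 * k + 1 - j) = f j"
  shows "(\<Sum>j=1..2 * k. q j * f j :: real) = 0"
proof -
  have "(\<Sum>j=1..2 * k. q j * f j) = (\<Sum>j=1..2 * k. q (2 * k + 1 - j) * f (2 * k + 1 - j))"
    by (rule sum.reindex_bij_witness[of _ "\<lambda>j. 2 * k + 1 - j" "\<lambda>j. 2 * k + 1 - j"]) auto
  also have "\<dots> = - (\<Sum>j=1..2 * k. q j * f j)"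
    unfolding sum_negf[symmetric] by (intro sum.cong refl) (use Qodd_antisym[OF q] f in auto)
  finally show ?thesis by simp
qed

text \<open>
  Since \<open>2 sin\<^sup>2 ((i - j) \<theta>) = 1 - cos (2 (i - j) \<theta>)\<close>, the double sum is
  \<open>((\<Sum>q)\<^sup>2 - \<bar>\<Sum>\<^sub>j q\<^sub>j exp (\<i> (2 j - 1) \<theta>)\<bar>\<^sup>2) / 2\<close>; for odd \<open>q\<close> both the sum of \<open>q\<close> and the cosine
  part of the exponential sum vanish.
\<close>

lemma double_sine_sum_eq_qhat:
  assumes k: "k \<ge> 1" and q: "q \<in> Qodd k" and n: "n \<in> {1..<2 * k}"
  defines "\<theta> \<equiv> pi * real n / (2 * real k)"
  shows "(\<Sum>i=1..2 * k. \<Sum>j=1..2 * k. q i * q j * (sin ((real j - real i) * \<theta>))\<^sup>2)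
       = - (real k * 2 ^ of_bool (k = n) * (qhat k q (if n \<le> k then n else 2 * k - n))\<^sup>2) / 2"
proof -
  define S where "S = (\<Sum>j=1..2 * k. q j * sin ((2 * real j - 1) * \<theta>))"
  define C where "C = (\<Sum>j=1..2 * k. q j * cos ((2 * real j - 1) * \<theta>))"
  have "C = 0" unfolding C_def
  proof (rule Qodd_sum_zero[OF q])
    fix j assume j: "j \<in> {1..2 * k}"
    have "(2 * real (2 * k + 1 - j) - 1) * \<theta> = real n * (2 * pi) - (2 * real j - 1) * \<theta>"
      using j k by (simp add: \<theta>_def of_nat_diff field_simps)
    then show "cos ((2 * real (2 * k + 1 - j) - 1) * \<theta>) = cos ((2 * real j - 1) * \<theta>)"
      using sin_npi[of "2 * n"] cos_npi[of "2 * n"] by (simp add: cos_diff mult.commute mult.left_commute)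
  qed
  have T: "(\<Sum>j=1..2 * k. q j) = 0" using Qodd_sum_zero[OF q, of "\<lambda>_. 1"] by simp
  have "(\<Sum>i=1..2 * k. \<Sum>j=1..2 * k. q i * q j * (sin ((real j - real i) * \<theta>))\<^sup>2)
     = (\<Sum>i=1..2 * k. \<Sum>j=1..2 * k. (q i * q j
        - (q i * cos ((2 * real i - 1) * \<theta>)) * (q j * cos ((2 * real j - 1) * \<theta>))
        - (q i * sin ((2 * real i - 1) * \<theta>)) * (q j * sin ((2 * real j - 1) * \<theta>))) / 2)"
  proof (intro sum.cong refl)
    fix i j
    have "2 * ((real j - real i) * \<theta>) = (2 * real j - 1) * \<theta> - (2 * real i - 1) * \<theta>"
      by (simp add: algebra_simps)
    then have e: "(sin ((real j - real i) * \<theta>))\<^sup>2 = (1 - cos ((2 * real i - 1) * \<theta>) * cos ((2 * real j - 1) * \<theta>)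
        - sin ((2 * real i - 1) * \<theta>) * sin ((2 * real j - 1) * \<theta>)) / 2"
      using cos_double_sin[of "(real j - real i) * \<theta>"] by (simp add: cos_diff mult.commute)
    show "q i * q j * (sin ((real j - real i) * \<theta>))\<^sup>2 = (q i * q j
        - (q i * cos ((2 * real i - 1) * \<theta>)) * (q j * cos ((2 * real j - 1) * \<theta>))
        - (q i * sin ((2 * real i - 1) * \<theta>)) * (q j * sin ((2 * real j - 1) * \<theta>))) / 2"
      unfolding e by (simp add: right_diff_distrib mult_ac)
  qed
  also have "\<dots> = ((\<Sum>j=1..2 * k. q j) * (\<Sum>j=1..2 * k. q j) - C * C - S * S) / 2"
    unfolding C_def S_def sum_product by (simp add: sum_subtractf sum_divide_distrib[symmetric])
  also have "\<dots> = - S\<^sup>2 / 2" unfolding \<open>C = 0\<close> T by (simp add: power2_eq_square)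
  finally show ?thesis
    using sine_sum_sq_eq_qhat[OF k q n] by (simp add: S_def \<theta>_def)
qed

section \<open>Constant coefficients and expansion in the coupling constant\<close>

lemma recsol_const_sin: "recsol (\<lambda>_. 2 * cos x) 0 1 n * sin x = sin (real n * x)"
proof (induction n rule: less_induct)
  case (less n)
  consider "n = 0" | "n = 1" | m where "n = Suc (Suc m)"
    by (metis One_nat_def not0_implies_Suc)
  then show ?case
  proof cases
    case 3
    have "sin (real n * x) = 2 * cos x * sin (real (Suc m) * x) - sin (real m * x)"
    proof -
      have "real n * x = real (Suc m) * x + x" "real m * x = real (Suc m) * x - x"
        by (simp_all add: 3 algebra_simps)
      then show ?thesis by (simp only: sin_add sin_diff) simp
    qed
    then show ?thesis using less.IH[of "Suc m"] less.IH[of m] 3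
      by (simp add: left_diff_distrib mult.assoc)
  qed simp_all
qed

lemma disc_const_cos:
  assumes "m \<ge> 1"
  shows "disc m (\<lambda>_. 2 * cos x) = 2 * cos (real m * x)"
  using assms
proof (induction m rule: less_induct)
  case (less m)
  consider "m = 1" | "m = 2" | l where "m = Suc (Suc (Suc l))"
    using less.prems by (metis One_nat_def Suc_1 not0_implies_Suc not_one_le_zero)
  then show ?case
  proof cases
    case 2
    have "disc 2 (\<lambda>_. 2 * cos x) = 4 * (cos x)\<^sup>2 - 2"
      by (simp add: disc_def numeral_2_eq_2 power2_eq_square)
    then show ?thesis using 2 by (simp add: cos_double_cos)
  next
    case 3
    have "cos (real m * x) = 2 * cos x * cos (real (Suc (Suc l)) * x) - cos (real (Suc l) * x)"
    proof -
      have "real m * x = real (Suc (Suc l)) * x + x" "real (Suc l) * x = real (Suc (Suc l)) * x - x"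
        by (simp_all add: 3 algebra_simps)
      then show ?thesis by (simp only: cos_add cos_diff) simp
    qed
    moreover have "disc m (\<lambda>_. 2 * cos x) = 2 * cos x * disc (Suc (Suc l)) (\<lambda>_. 2 * cos x) - disc (Suc l) (\<lambda>_. 2 * cos x)"
      by (simp add: disc_def 3 algebra_simps)
    ultimately show ?thesis using less.IH[of "Suc (Suc l)"] less.IH[of "Suc l"] 3
      by (simp add: algebra_simps)
  qed (simp add: disc_def)
qed

text \<open>
  A term of degree \<open>i\<close> in the coupling constant contains \<open>i\<close> factors \<open>q j\<close>. The constant \<open>4\<close> only has
  to absorb the three terms of the recurrence when \<open>\<bar>l\<bar> \<le> 2\<close>.
\<close>

lemma abs_coeff_coupling_le:
  fixes l r :: real
  assumes l: "\<bar>l\<bar> \<le> 2" and q: "\<And>j. \<bar>q j\<bar> \<le> r" and a: "\<And>i. \<bar>coeff a i\<bar> \<le> r ^ i"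
    and b: "\<And>i. \<bar>coeff b i\<bar> \<le> r ^ i"
  shows "\<bar>coeff (recsol (\<lambda>j. [:l, - q j:]) a b n) i\<bar> \<le> 4 ^ n * r ^ i"
proof (induction n arbitrary: i rule: less_induct)
  case (less n)
  have r: "0 \<le> r" using q[of 0] by linarith
  let ?y = "recsol (\<lambda>j. [:l, - q j:]) a b"
  consider "n = 0" | "n = 1" | m where "n = Suc (Suc m)"
    by (metis One_nat_def not0_implies_Suc)
  then show ?case
  proof cases
    case 1
    then show ?thesis using a by simp
  next
    case 2
    have "\<bar>coeff b i\<bar> \<le> 4 * r ^ i" using b[of i] zero_le_power[OF r, of i] by linarith
    then show ?thesis using 2 by simp
  next
    case 3
    have 1: "\<bar>coeff (?y (Suc m)) i\<bar> \<le> 4 ^ Suc m * r ^ i" for i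
      by (rule less) (simp add: 3)
    have 2: "\<bar>coeff (?y m) i\<bar> \<le> 4 ^ m * r ^ i" for i using less 3 by simp
    have L: "\<bar>l * coeff (?y (Suc m)) i\<bar> \<le> 2 * (4 ^ Suc m * r ^ i)"
      unfolding abs_mult using l 1 by (intro mult_mono) auto
    have Q: "\<bar>(if i = 0 then 0 else - q (Suc m) * coeff (?y (Suc m)) (i - 1))\<bar> \<le> 4 ^ Suc m * r ^ i"
    proof (cases i)
      case (Suc j)
      have "\<bar>q (Suc m)\<bar> * \<bar>coeff (?y (Suc m)) j\<bar> \<le> r * (4 ^ Suc m * r ^ j)"
        using q 1 r by (intro mult_mono) auto
      then show ?thesis using Suc by (simp add: abs_mult mult_ac)
    qed (use r in simp)
    have "coeff (?y n) i = l * coeff (?y (Suc m)) i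
       + (if i = 0 then 0 else - q (Suc m) * coeff (?y (Suc m)) (i - 1)) - coeff (?y m) i"
      by (cases i) (simp_all add: 3)
    then have "\<bar>coeff (?y n) i\<bar> \<le> 2 * (4 ^ Suc m * r ^ i) + 4 ^ Suc m * r ^ i + 4 ^ m * r ^ i"
      using L Q 2[of i] by linarith
    also have "\<dots> = 13 * (4 ^ m * r ^ i)" by simp
    also have "\<dots> \<le> 16 * (4 ^ m * r ^ i)" using r by (intro mult_right_mono) auto
    also have "\<dots> = 4 ^ n * r ^ i" by (simp add: 3)
    finally show ?thesis .
  qed
qed

lemma abs_coeff_coupling_lipschitz:
  fixes l r :: real
  assumes l: "\<bar>l\<bar> \<le> 2" and l': "\<bar>l'\<bar> \<le> 2" and q: "\<And>j. \<bar>q j\<bar> \<le> r" and a: "\<And>i. \<bar>coeff a i\<bar> \<le> r ^ i"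
    and b: "\<And>i. \<bar>coeff b i\<bar> \<le> r ^ i"
  shows "\<bar>coeff (recsol (\<lambda>j. [:l, - q j:]) a b n) i - coeff (recsol (\<lambda>j. [:l', - q j:]) a b n) i\<bar>
    \<le> 8 ^ n * r ^ i * \<bar>l - l'\<bar>"
proof (induction n arbitrary: i rule: less_induct)
  case (less n)
  have r: "0 \<le> r" using q[of 0] by linarith
  let ?d = "\<bar>l - l'\<bar>"
  let ?y = "recsol (\<lambda>j. [:l, - q j:]) a b"
  let ?z = "recsol (\<lambda>j. [:l', - q j:]) a b"
  consider "n = 0" | "n = 1" | m where "n = Suc (Suc m)"
    by (metis One_nat_def not0_implies_Suc)
  then show ?case
  proof cases
    case 3
    have 1: "\<bar>coeff (?y (Suc m)) i - coeff (?z (Suc m)) i\<bar> \<le> 8 ^ Suc m * r ^ i * ?d" for i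
      by (rule less) (simp add: 3)
    have 2: "\<bar>coeff (?y m) i - coeff (?z m) i\<bar> \<le> 8 ^ m * r ^ i * ?d" for i using less 3 by simp
    have L: "\<bar>l * (coeff (?y (Suc m)) i - coeff (?z (Suc m)) i)\<bar> \<le> 2 * (8 ^ Suc m * r ^ i * ?d)"
      unfolding abs_mult using l 1 by (intro mult_mono) auto
    have "\<bar>coeff (?z (Suc m)) i\<bar> \<le> 4 ^ Suc m * r ^ i"
      by (rule abs_coeff_coupling_le[OF l' q a b])
    also have "\<dots> \<le> 8 ^ Suc m * r ^ i" using r by (intro mult_right_mono power_mono) auto
    finally have Z: "\<bar>(l - l') * coeff (?z (Suc m)) i\<bar> \<le> 8 ^ Suc m * r ^ i * ?d"
      unfolding abs_mult by (subst mult.commute) (rule mult_right_mono, auto)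
    have Q: "\<bar>(if i = 0 then 0 else - q (Suc m) * (coeff (?y (Suc m)) (i - 1) - coeff (?z (Suc m)) (i - 1)))\<bar>
      \<le> 8 ^ Suc m * r ^ i * ?d"
    proof (cases i)
      case (Suc j)
      have "\<bar>q (Suc m)\<bar> * \<bar>coeff (?y (Suc m)) j - coeff (?z (Suc m)) j\<bar> \<le> r * (8 ^ Suc m * r ^ j * ?d)"
        using q 1 r by (intro mult_mono) auto
      then show ?thesis using Suc by (simp add: abs_mult mult_ac del: recsol.simps)
    qed (use r in simp)
    have "coeff (?y n) i - coeff (?z n) i = l * (coeff (?y (Suc m)) i - coeff (?z (Suc m)) i)
       + (l - l') * coeff (?z (Suc m)) i
       + (if i = 0 then 0 else - q (Suc m) * (coeff (?y (Suc m)) (i - 1) - coeff (?z (Suc m)) (i - 1)))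
       - (coeff (?y m) i - coeff (?z m) i)"
      by (cases i) (simp_all add: 3 algebra_simps)
    then have "\<bar>coeff (?y n) i - coeff (?z n) i\<bar> \<le> 2 * (8 ^ Suc m * r ^ i * ?d)
      + 8 ^ Suc m * r ^ i * ?d + 8 ^ Suc m * r ^ i * ?d + 8 ^ m * r ^ i * ?d"
      using L Z Q 2[of i] by linarith
    also have "\<dots> = 33 * (8 ^ m * r ^ i * ?d)" by simp
    also have "\<dots> \<le> 64 * (8 ^ m * r ^ i * ?d)" using r by (intro mult_right_mono) auto
    also have "\<dots> = 8 ^ n * r ^ i * ?d" by (simp add: 3)
    finally show ?thesis .
  qed (use r in simp_all)
qed

lemma degree_coupling_le:
  fixes l :: real
  assumes "degree a \<le> n" "degree b \<le> n"
  shows "degree (recsol (\<lambda>j. [:l, - q j:]) a b m) \<le> n + m"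
  using assms
proof (induction m rule: less_induct)
  case (less m)
  consider "m = 0" | "m = 1" | i where "m = Suc (Suc i)"
    by (metis One_nat_def not0_implies_Suc)
  then show ?case
  proof cases
    case 3
    have "degree ([:l, - q (Suc i):] * recsol (\<lambda>j. [:l, - q j:]) a b (Suc i))
       \<le> degree [:l, - q (Suc i):] + degree (recsol (\<lambda>j. [:l, - q j:]) a b (Suc i))"
      by (rule degree_mult_le)
    also have "\<dots> \<le> 1 + (n + Suc i)"
      using less.IH[of "Suc i"] less.prems 3 by (intro add_mono) auto
    finally have "degree ([:l, - q (Suc i):] * recsol (\<lambda>j. [:l, - q j:]) a b (Suc i)) \<le> n + m" using 3 by simp
    moreover have "degree (recsol (\<lambda>j. [:l, - q j:]) a b i) \<le> n + m"
      using less.IH[of i] less.prems 3 by simp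
    ultimately show ?thesis unfolding 3 recsol.simps by (intro degree_diff_le) auto
  qed (use less in auto)
qed

lemma abs_poly_at_1_le:
  fixes P :: "real poly"
  assumes "degree P \<le> n" "\<And>i. \<bar>coeff P i\<bar> \<le> C" "0 \<le> C"
  shows "\<bar>poly P 1\<bar> \<le> real (Suc n) * C"
proof -
  have "\<bar>poly P 1\<bar> \<le> (\<Sum>i\<le>degree P. \<bar>coeff P i\<bar>)"
    unfolding poly_altdef by (simp add: sum_abs)
  also have "\<dots> \<le> (\<Sum>i\<le>degree P. C)" by (intro sum_mono assms)
  also have "\<dots> \<le> real (Suc n) * C" using assms by (simp add: mult_right_mono)
  finally show ?thesis .
qed

lemma poly_at_1_first_order:
  fixes P :: "real poly"
  assumes "degree P \<le> n" "\<And>i. \<bar>coeff P i\<bar> \<le> C * r ^ i" "0 \<le> C" "0 \<le> r" "r \<le> 1"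
  shows "\<bar>poly P 1 - coeff P 0\<bar> \<le> real (Suc n) * (C * r)"
proof -
  obtain c0 R where P: "P = pCons c0 R" by (rule pCons_cases)
  have "\<bar>poly R 1\<bar> \<le> real (Suc n) * (C * r)"
  proof (rule abs_poly_at_1_le)
    show "degree R \<le> n" using assms(1) unfolding P by (cases "R = 0") auto
    show "\<bar>coeff R i\<bar> \<le> C * r" for i
    proof -
      have "\<bar>coeff R i\<bar> \<le> C * r ^ Suc i" using assms(2)[of "Suc i"] by (simp add: P)
      also have "\<dots> \<le> C * r" using assms by (intro mult_left_mono) (auto simp: mult_left_le power_le_one)
      finally show ?thesis .
    qed
  qed (use assms in auto)
  then show ?thesis by (simp add: P)
qed

text \<open>
  For coefficients of size \<open>r ^ i\<close>, dropping the terms of degree at least \<open>4\<close> costs \<open>O(r ^ 4)\<close>.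
\<close>

lemma even_poly_at_1_second_order:
  fixes P :: "real poly"
  assumes "degree P \<le> n" "\<And>i. \<bar>coeff P i\<bar> \<le> C * r ^ i" "0 \<le> C" "0 \<le> r" "r \<le> 1"
    and "coeff P 1 = 0" "coeff P 3 = 0"
  shows "\<bar>poly P 1 - coeff P 0 - coeff P 2\<bar> \<le> real (Suc n) * (C * r ^ 4)"
proof -
  obtain c0 P1 where P0: "P = pCons c0 P1" by (rule pCons_cases)
  obtain c1 P2 where P1: "P1 = pCons c1 P2" by (rule pCons_cases)
  obtain c2 P3 where P2: "P2 = pCons c2 P3" by (rule pCons_cases)
  obtain c3 R where P3: "P3 = pCons c3 R" by (rule pCons_cases)
  note P = P0 P1 P2 P3
  have R: "coeff R i = coeff P (i + 4)" for i by (simp add: P numeral_eq_Suc)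
  have "\<bar>poly R 1\<bar> \<le> real (Suc n) * (C * r ^ 4)"
  proof (rule abs_poly_at_1_le)
    show "degree R \<le> n" using assms(1) by (intro degree_le) (auto simp: R intro!: coeff_eq_0)
    show "\<bar>coeff R i\<bar> \<le> C * r ^ 4" for i
    proof -
      have "\<bar>coeff R i\<bar> \<le> C * (r ^ i * r ^ 4)" using assms(2)[of "i + 4"] by (simp only: R power_add)
      also have "\<dots> \<le> C * (1 * r ^ 4)" using assms
        by (intro mult_left_mono mult_right_mono power_le_one) auto
      finally show ?thesis by simp
    qed
  qed (use assms in auto)
  moreover have "poly P 1 - coeff P 0 - coeff P 2 = poly R 1"
    using assms(6,7) by (simp add: P numeral_eq_Suc)
  ultimately show ?thesis by simp
qed

text \<open>
  The discriminant of the potential \<open>t * q\<close> at the energy \<open>l\<close>, as a polynomial in \<open>t\<close>.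
\<close>

definition coupling_poly :: "nat \<Rightarrow> (nat \<Rightarrow> real) \<Rightarrow> real \<Rightarrow> real poly" where
  "coupling_poly k q l = disc (2 * k) (\<lambda>j. [:l, - q j:])"

lemma poly_coupling_poly: "poly (coupling_poly k q l) t = disc (2 * k) (\<lambda>j. l - t * q j)"
proof -
  have "poly (coupling_poly k q l) t = disc (2 * k) (\<lambda>j. poly [:l, - q j:] t)"
    unfolding coupling_poly_def by (rule disc_hom) simp_all
  then show ?thesis by simp
qed

text \<open>
  Replacing \<open>t\<close> by \<open>- t\<close> reverses the order of the potential, which leaves the discriminant unchanged.
\<close>

lemma coeff_coupling_poly_odd:
  assumes k: "k \<ge> 1" and q: "q \<in> Qodd k" and i: "odd i"
  shows "coeff (coupling_poly k q l) i = 0"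
proof -
  obtain m where "k = 1 + m" using k le_Suc_ex by blast
  then have k2: "2 * k = Suc (Suc (2 * m))" by simp
  let ?P = "coupling_poly k q l"
  have "pcompose ?P [:0, - 1:] = disc (2 * k) (\<lambda>j. pcompose [:l, - q j:] [:0, - 1:])"
    unfolding coupling_poly_def
    by (rule disc_hom) (simp_all add: pcompose_diff pcompose_mult pcompose_1)
  also have "\<dots> = disc (2 * k) (\<lambda>j. [:l, - q (2 * k + 1 - j):])"
    using Qodd_antisym[OF q] by (intro disc_cong) (simp add: pcompose_pCons)
  also have "\<dots> = ?P"
    unfolding coupling_poly_def k2 using disc_reverse[of "2 * m" "\<lambda>j. [:l, - q j:]"] by simp
  finally have "coeff ?P i = (- 1) ^ i * coeff ?P i"
    using coeff_pcompose_linear[of ?P "- 1" i] by simp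
  then show ?thesis using i by simp
qed

lemma abs_le_qnorm:
  assumes "q \<in> Qodd k"
  shows "\<bar>q j\<bar> \<le> qnorm k q"
proof (cases "j \<in> {1..2 * k}")
  case True
  have "(q j)\<^sup>2 \<le> (\<Sum>n=1..2 * k. (q n)\<^sup>2)" using True by (intro member_le_sum) auto
  then show ?thesis unfolding qnorm_def using real_le_rsqrt[of "\<bar>q j\<bar>"] by simp
next
  case False
  then show ?thesis using assms by (auto simp: Qodd_def qnorm_def intro!: real_sqrt_ge_zero sum_nonneg)
qed

lemma qnorm_nonneg: "0 \<le> qnorm k q"
  by (simp add: qnorm_def sum_nonneg)

lemma abs_coeff_one_le: "\<bar>coeff (1 :: real poly) i\<bar> \<le> r ^ i" "\<bar>coeff (0 :: real poly) i\<bar> \<le> r ^ i" if "0 \<le> r" for r :: real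
  using that by (cases i; simp add: one_pCons)+

lemma coupling_coeff_bounds:
  assumes k: "k \<ge> 1" and q: "q \<in> Qodd k" and l: "\<bar>l\<bar> \<le> 2"
  defines "r \<equiv> qnorm k q"
  shows "\<bar>coeff (coupling_poly k q l) i\<bar> \<le> 2 * 4 ^ Suc (2 * k) * r ^ i"
    "\<bar>l'\<bar> \<le> 2 \<Longrightarrow> \<bar>coeff (coupling_poly k q l) i - coeff (coupling_poly k q l') i\<bar>
        \<le> 2 * 8 ^ Suc (2 * k) * r ^ i * \<bar>l - l'\<bar>"
    "degree (coupling_poly k q l) \<le> Suc (2 * k)"
proof -
  have r: "0 \<le> r" unfolding r_def by (rule qnorm_nonneg)
  have qr: "\<bar>q j\<bar> \<le> r" for j unfolding r_def by (rule abs_le_qnorm[OF q])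
  note ab = abs_coeff_one_le[OF r]
  let ?P = "\<lambda>l. recsol (\<lambda>j. [:l, - q j:]) 0 1 (Suc (2 * k))"
  let ?R = "\<lambda>l. recsol (\<lambda>j. [:l, - q j:]) 1 0 (2 * k)"
  have e: "coupling_poly k q l = ?P l + ?R l" for l by (simp add: coupling_poly_def disc_def del: recsol.simps)
  have "\<bar>coeff (?P l) i\<bar> \<le> 4 ^ Suc (2 * k) * r ^ i"
    by (rule abs_coeff_coupling_le) (use l qr ab in auto)
  moreover have "\<bar>coeff (?R l) i\<bar> \<le> 4 ^ (2 * k) * r ^ i"
    by (rule abs_coeff_coupling_le) (use l qr ab in auto)
  moreover have "4 ^ (2 * k) * r ^ i \<le> 4 ^ Suc (2 * k) * r ^ i"
    using r by (intro mult_right_mono power_increasing) auto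
  ultimately show "\<bar>coeff (coupling_poly k q l) i\<bar> \<le> 2 * 4 ^ Suc (2 * k) * r ^ i"
    unfolding e coeff_add by linarith
  show "\<bar>coeff (coupling_poly k q l) i - coeff (coupling_poly k q l') i\<bar>
        \<le> 2 * 8 ^ Suc (2 * k) * r ^ i * \<bar>l - l'\<bar>" if l': "\<bar>l'\<bar> \<le> 2"
  proof -
    have "\<bar>coeff (?P l) i - coeff (?P l') i\<bar> \<le> 8 ^ Suc (2 * k) * r ^ i * \<bar>l - l'\<bar>"
      by (rule abs_coeff_coupling_lipschitz) (use l l' qr ab in auto)
    moreover have "\<bar>coeff (?R l) i - coeff (?R l') i\<bar> \<le> 8 ^ (2 * k) * r ^ i * \<bar>l - l'\<bar>"
      by (rule abs_coeff_coupling_lipschitz) (use l l' qr ab in auto)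
    moreover have "8 ^ (2 * k) * r ^ i * \<bar>l - l'\<bar> \<le> 8 ^ Suc (2 * k) * r ^ i * \<bar>l - l'\<bar>"
      using r by (intro mult_right_mono power_increasing) auto
    ultimately show ?thesis unfolding e coeff_add by linarith
  qed
  show "degree (coupling_poly k q l) \<le> Suc (2 * k)"
    unfolding e using degree_coupling_le[of 0 0 1 l q "Suc (2 * k)"] degree_coupling_le[of 1 0 0 l q "2 * k"]
    by (intro degree_add_le) auto
qed

lemma coeff_coupling_poly_0: "coeff (coupling_poly k q l) 0 = disc (2 * k) (\<lambda>_. l)"
  using poly_coupling_poly[of k q l 0] by (simp add: poly_0_coeff_0)

lemma lyapunov_second_order:
  assumes k: "k \<ge> 1" and q: "q \<in> Qodd k" and l: "\<bar>l\<bar> \<le> 2" and r: "qnorm k q \<le> 1"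
  shows "\<bar>lyapunov k q l - disc (2 * k) (\<lambda>_. l) - coeff (coupling_poly k q l) 2\<bar>
    \<le> real (2 * k + 2) * (2 * 4 ^ Suc (2 * k)) * qnorm k q ^ 4"
proof -
  have "lyapunov k q l = poly (coupling_poly k q l) 1"
    by (simp add: lyapunov_eq_disc poly_coupling_poly)
  moreover have "\<bar>poly (coupling_poly k q l) 1 - coeff (coupling_poly k q l) 0 - coeff (coupling_poly k q l) 2\<bar>
     \<le> real (Suc (Suc (2 * k))) * (2 * 4 ^ Suc (2 * k) * qnorm k q ^ 4)"
    by (rule even_poly_at_1_second_order)
      (use coupling_coeff_bounds[OF k q l] r qnorm_nonneg coeff_coupling_poly_odd[OF k q] in auto)
  ultimately show ?thesis unfolding coeff_coupling_poly_0 by (simp add: mult.assoc)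
qed

lemma recsol_first_order:
  assumes q: "q \<in> Qodd k" and l: "\<bar>l\<bar> \<le> 2" and r: "qnorm k q \<le> 1"
  shows "\<bar>recsol (\<lambda>j. l - q j) 0 1 n - recsol (\<lambda>_. l) 0 1 n\<bar> \<le> real (Suc n) * (4 ^ n * qnorm k q)"
proof -
  let ?P = "recsol (\<lambda>j. [:l, - q j:]) 0 1 n"
  have "poly ?P t = recsol (\<lambda>j. l - t * q j) 0 1 n" for t
    using recsol_hom[of "\<lambda>p. poly p t" "\<lambda>j. [:l, - q j:]" 0 1 n] by simp
  from this[of 1] this[of 0]
  have e: "recsol (\<lambda>j. l - q j) 0 1 n = poly ?P 1" "recsol (\<lambda>_. l) 0 1 n = coeff ?P 0"
    by (simp_all add: poly_0_coeff_0)
  show ?thesis unfolding e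
  proof (rule poly_at_1_first_order)
    show "degree ?P \<le> n" using degree_coupling_le[of 0 0 1 l q n] by simp
    show "\<bar>coeff ?P i\<bar> \<le> 4 ^ n * qnorm k q ^ i" for i
      by (rule abs_coeff_coupling_le) (use l abs_le_qnorm[OF q] abs_coeff_one_le[OF qnorm_nonneg] in auto)
  qed (use r qnorm_nonneg in auto)
qed

text \<open>
  Duhamel's formula for the recurrence with constant coefficient \<open>l\<close> and source \<open>f\<close>.
\<close>

lemma variation_of_constants:
  fixes l :: "'a::comm_ring_1"
  assumes "x 0 = 0" "x 1 = 0" "\<And>n. x (Suc (Suc n)) = l * x (Suc n) - x n - f (Suc n)"
  shows "x n = - (\<Sum>j\<in>{1..<n}. recsol (\<lambda>_. l) 0 1 (n - j) * f j)"
proof (induction n rule: less_induct)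
  case (less n)
  let ?U = "recsol (\<lambda>_. l) 0 1"
  consider "n = 0" | "n = 1" | m where "n = Suc (Suc m)"
    by (metis One_nat_def not0_implies_Suc)
  then show ?case
  proof cases
    case 3
    have 1: "(\<Sum>j\<in>{1..<Suc m}. ?U (m - j) * f j) = (\<Sum>j\<in>{1..<m}. ?U (m - j) * f j)"
      by (cases m) simp_all
    have "(\<Sum>j\<in>{1..<n}. ?U (n - j) * f j) = (\<Sum>j\<in>{1..<Suc m}. ?U (n - j) * f j) + f (Suc m)"
      by (simp add: 3)
    also have "(\<Sum>j\<in>{1..<Suc m}. ?U (n - j) * f j)
        = (\<Sum>j\<in>{1..<Suc m}. l * (?U (Suc m - j) * f j) - ?U (m - j) * f j)"
    proof (intro sum.cong refl)
      fix j assume "j \<in> {1..<Suc m}"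
      then have "n - j = Suc (Suc (m - j))" "Suc m - j = Suc (m - j)" using 3 by auto
      then show "?U (n - j) * f j = l * (?U (Suc m - j) * f j) - ?U (m - j) * f j"
        by (simp add: algebra_simps)
    qed
    also have "\<dots> = l * (\<Sum>j\<in>{1..<Suc m}. ?U (Suc m - j) * f j) - (\<Sum>j\<in>{1..<m}. ?U (m - j) * f j)"
      unfolding sum_subtractf 1 by (simp only: sum_distrib_left)
    finally show ?thesis
      using less.IH[of "Suc m"] less.IH[of m] assms(3)[of m] 3 by simp
  qed (use assms in simp_all)
qed

text \<open>
  The coefficient of degree \<open>i + 1\<close> solves the free recurrence with a source that contains the
  coefficient of degree \<open>i\<close>.
\<close>

lemma coeff_coupling_recsol:
  fixes q :: "nat \<Rightarrow> real" and l :: real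
  defines "Y \<equiv> \<lambda>a b n. recsol (\<lambda>j. [:l, - q j:]) [:a:] [:b:] n"
  shows "coeff (Y a b n) 0 = recsol (\<lambda>_. l) a b n"
    and "coeff (Y a b n) (Suc i) = - (\<Sum>j\<in>{1..<n}. recsol (\<lambda>_. l) 0 1 (n - j) * (q j * coeff (Y a b j) i))"
proof -
  show "coeff (Y a b n) 0 = recsol (\<lambda>_. l) a b n"
    using recsol_hom[of "\<lambda>p. poly p 0" "\<lambda>j. [:l, - q j:]" "[:a:]" "[:b:]" n]
    by (simp add: Y_def flip: poly_0_coeff_0)
  show "coeff (Y a b n) (Suc i) = - (\<Sum>j\<in>{1..<n}. recsol (\<lambda>_. l) 0 1 (n - j) * (q j * coeff (Y a b j) i))"
    by (rule variation_of_constants) (simp_all add: Y_def)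
qed

text \<open>
  Two applications of variation of constants give a sum over pairs \<open>i < j\<close> of
  \<open>q\<^sub>i q\<^sub>j\<close> times two free propagators, over the \<open>j - i\<close> sites between the pair and over the
  remaining \<open>2 k - (j - i)\<close> sites of the period. At a closed gap \<open>sin (2 k p) = 0\<close>, and the two propagators agree up to
  the sign \<open>- cos (2 k p)\<close>.
\<close>

lemma coeff_coupling_poly_2:
  fixes q :: "nat \<Rightarrow> real"
  assumes s: "sin p \<noteq> 0" and sk: "sin (real (2 * k) * p) = 0"
  shows "coeff (coupling_poly k q (2 * cos p)) 2
    = - cos (real (2 * k) * p) / (sin p)\<^sup>2 * (\<Sum>j=1..2 * k. \<Sum>i\<in>{1..<j}. q i * q j * (sin ((real j - real i) * p))\<^sup>2)"
proof -
  let ?l = "2 * cos p"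
  define U where "U n = recsol (\<lambda>_. ?l) 0 1 n" for n
  define V where "V n = recsol (\<lambda>_. ?l) 1 0 n" for n
  have U: "U n = sin (real n * p) / sin p" for n
    using recsol_const_sin[of p n] s by (simp add: U_def field_simps)
  have VU: "V (Suc n) = - U n" for n
    unfolding V_def U_def recsol_Suc_shift by (subst recsol_linear) simp
  have V: "V i = - sin ((real i - 1) * p) / sin p" if "i \<ge> 1" for i
    using VU[of "i - 1"] U[of "i - 1"] that by (simp add: of_nat_diff)
  have c2: "coeff (recsol (\<lambda>j. [:?l, - q j:]) [:a:] [:b:] n) 2
     = (\<Sum>j\<in>{1..<n}. \<Sum>i\<in>{1..<j}. q i * q j * (U (j - i) * (U (n - j) * recsol (\<lambda>_. ?l) a b i)))" for a b n
    unfolding numeral_2_eq_2 coeff_coupling_recsol U_def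
    by (simp add: sum_distrib_left sum_negf[symmetric] mult_ac)
  have "coeff (coupling_poly k q ?l) 2
     = (\<Sum>j\<in>{1..<Suc (2 * k)}. \<Sum>i\<in>{1..<j}. q i * q j * (U (j - i) * (U (Suc (2 * k) - j) * U i)))
     + (\<Sum>j\<in>{1..<2 * k}. \<Sum>i\<in>{1..<j}. q i * q j * (U (j - i) * (U (2 * k - j) * V i)))"
    unfolding coupling_poly_def disc_def coeff_add
    using c2[of 0 1 "Suc (2 * k)"] c2[of 1 0 "2 * k"] unfolding U_def[symmetric] V_def[symmetric]
    by (simp add: one_pCons del: recsol.simps)
  also have "(\<Sum>j\<in>{1..<2 * k}. \<Sum>i\<in>{1..<j}. q i * q j * (U (j - i) * (U (2 * k - j) * V i)))
     = (\<Sum>j\<in>{1..<Suc (2 * k)}. \<Sum>i\<in>{1..<j}. q i * q j * (U (j - i) * (U (2 * k - j) * V i)))"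
    by (rule sum.mono_neutral_left) (auto simp: U less_Suc_eq)
  also have "(\<Sum>j\<in>{1..<Suc (2 * k)}. \<Sum>i\<in>{1..<j}. q i * q j * (U (j - i) * (U (Suc (2 * k) - j) * U i))) + \<dots>
     = (\<Sum>j=1..2 * k. \<Sum>i\<in>{1..<j}. - cos (real (2 * k) * p) / (sin p)\<^sup>2 * (q i * q j * (sin ((real j - real i) * p))\<^sup>2))"
    unfolding sum.distrib[symmetric] atLeastLessThanSuc_atLeastAtMost
  proof (intro sum.cong refl)
    fix j i assume j: "j \<in> {1..2 * k}" and i: "i \<in> {1..<j}"
    define A where "A = real (2 * k - j) * p"
    define B where "B = real i * p"
    have "U (Suc (2 * k) - j) * U i + U (2 * k - j) * V i
       = (sin (A + p) * sin B - sin A * sin (B - p)) / (sin p)\<^sup>2"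
      using i j by (simp add: U V A_def B_def power2_eq_square Suc_diff_le algebra_simps diff_divide_distrib)
    also have "sin (A + p) * sin B - sin A * sin (B - p) = sin p * sin (A + B)"
      by (simp add: sin_add sin_diff algebra_simps)
    also have "A + B = real (2 * k) * p - (real j - real i) * p"
      using j by (simp add: A_def B_def of_nat_diff algebra_simps)
    also have "sin \<dots> = - cos (real (2 * k) * p) * sin ((real j - real i) * p)"
      unfolding sin_diff sk by simp
    finally have e: "U (j - i) * (U (Suc (2 * k) - j) * U i + U (2 * k - j) * V i)
       = - cos (real (2 * k) * p) / (sin p)\<^sup>2 * (sin ((real j - real i) * p))\<^sup>2"
      using i s by (simp add: U of_nat_diff power2_eq_square)
    have "q i * q j * (U (j - i) * (U (Suc (2 * k) - j) * U i)) + q i * q j * (U (j - i) * (U (2 * k - j) * V i))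
       = q i * q j * (U (j - i) * (U (Suc (2 * k) - j) * U i + U (2 * k - j) * V i))"
      by (simp only: distrib_left)
    also have "\<dots> = - cos (real (2 * k) * p) / (sin p)\<^sup>2 * (q i * q j * (sin ((real j - real i) * p))\<^sup>2)"
      unfolding e by (rule mult.left_commute)
    finally show "q i * q j * (U (j - i) * (U (Suc (2 * k) - j) * U i)) + q i * q j * (U (j - i) * (U (2 * k - j) * V i))
       = - cos (real (2 * k) * p) / (sin p)\<^sup>2 * (q i * q j * (sin ((real j - real i) * p))\<^sup>2)" .
  qed
  finally show ?thesis by (simp only: sum_distrib_left)
qed

lemma sum_symmetric_square:
  fixes g :: "nat \<Rightarrow> nat \<Rightarrow> real"
  assumes "\<And>i j. g i j = g j i" "\<And>i. g i i = 0"
  shows "(\<Sum>i=1..n. \<Sum>j=1..n. g i j) = 2 * (\<Sum>j=1..n. \<Sum>i\<in>{1..<j}. g i j)"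
proof (induction n)
  case (Suc n)
  have "(\<Sum>i=1..Suc n. \<Sum>j=1..Suc n. g i j)
     = (\<Sum>i=1..n. \<Sum>j=1..n. g i j) + 2 * (\<Sum>i=1..n. g i (Suc n))"
    using assms by (simp add: sum.distrib assms(1)[of "Suc n"])
  moreover have "{1..<Suc n} = {1..n}" by auto
  ultimately show ?case using Suc by (simp add: distrib_left)
qed simp

section \<open>The free operator and its closed gaps\<close>

lemma band_edges_iff:
  assumes "k \<ge> 1"
  shows "band_edges k q lm lp \<longleftrightarrow> poly_edges (2 * k) (lyap_poly k q) lm lp"
proof -
  have "jacobi_spectrum k q = complex_of_real ` A \<longleftrightarrow> {l. \<bar>lyapunov k q l\<bar> \<le> 2} = A" for A
    unfolding jacobi_spectrum_eq[OF assms] by (rule inj_image_eq_iff) (simp add: inj_on_def)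
  then show ?thesis
    unfolding band_edges_def poly_edges_def lyapunov_eq_poly[symmetric] by simp
qed

lemma degree_lyap_poly: "k \<ge> 1 \<Longrightarrow> degree (lyap_poly k q) = 2 * k"
  unfolding lyap_poly_def by (rule degree_disc_linear_factors) simp

text \<open>
  The parameter \<open>x \<in> [0, 2 k]\<close> counts bands from below: energies increase with \<open>x\<close>, the closed gaps
  are at the interior integers and the zeros of the free discriminant at the half-integers.
\<close>

definition quasi_momentum :: "nat \<Rightarrow> real \<Rightarrow> real" where
  "quasi_momentum k x = pi * (2 * real k - x) / (2 * real k)"

definition free_energy :: "nat \<Rightarrow> real \<Rightarrow> real" where
  "free_energy k x = 2 * cos (quasi_momentum k x)"

lemma quasi_momentum_bounds: "k \<ge> 1 \<Longrightarrow> 0 \<le> x \<Longrightarrow> x \<le> 2 * real k \<Longrightarrow> 0 \<le> quasi_momentum k x \<and> quasi_momentum k x \<le> pi"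
  by (simp add: quasi_momentum_def field_simps)

lemma sin_quasi_momentum_pos: "k \<ge> 1 \<Longrightarrow> 0 < x \<Longrightarrow> x < 2 * real k \<Longrightarrow> 0 < sin (quasi_momentum k x)"
  by (rule sin_gt_zero) (simp_all add: quasi_momentum_def field_simps)

lemma free_energy_less:
  assumes "k \<ge> 1" "0 \<le> x" "x < y" "y \<le> 2 * real k"
  shows "free_energy k x < free_energy k y"
proof -
  have "quasi_momentum k y < quasi_momentum k x" using assms by (simp add: quasi_momentum_def divide_strict_right_mono)
  then show ?thesis unfolding free_energy_def
    using quasi_momentum_bounds[of k x] quasi_momentum_bounds[of k y] assms by (simp add: cos_monotone_0_pi)
qed

lemma abs_free_energy_le: "\<bar>free_energy k x\<bar> \<le> 2"
  using abs_cos_le_one[of "quasi_momentum k x"] by (simp add: free_energy_def abs_mult)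

lemma free_energy_surj:
  assumes "k \<ge> 1" "u \<le> v" "free_energy k u \<le> l" "l \<le> free_energy k v"
  shows "\<exists>x. u \<le> x \<and> x \<le> v \<and> free_energy k x = l"
proof -
  have "\<exists>x\<ge>u. x \<le> v \<and> free_energy k x = l"
    by (rule IVT') (use assms in \<open>auto simp: free_energy_def quasi_momentum_def intro!: continuous_intros\<close>)
  then show ?thesis by blast
qed

lemma two_k_quasi_momentum: "k \<ge> 1 \<Longrightarrow> real (2 * k) * quasi_momentum k x = real k * (2 * pi) - pi * x"
  by (simp add: quasi_momentum_def field_simps)

lemma cos_two_k_quasi_momentum: "k \<ge> 1 \<Longrightarrow> cos (real (2 * k) * quasi_momentum k x) = cos (pi * x)"
  using sin_npi[of "2 * k"] cos_npi[of "2 * k"]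
  by (simp only: two_k_quasi_momentum cos_diff) (simp add: mult.commute mult.left_commute)

lemma sin_two_k_quasi_momentum: "k \<ge> 1 \<Longrightarrow> sin (real (2 * k) * quasi_momentum k x) = - sin (pi * x)"
  using sin_npi[of "2 * k"] cos_npi[of "2 * k"]
  by (simp only: two_k_quasi_momentum sin_diff) (simp add: mult.commute mult.left_commute)

lemma free_disc: "k \<ge> 1 \<Longrightarrow> disc (2 * k) (\<lambda>_. free_energy k x) = 2 * cos (pi * x)"
  using disc_const_cos[of "2 * k" "quasi_momentum k x"] cos_two_k_quasi_momentum[of k x] by (simp add: free_energy_def)

lemma parity_cos: "(-1) ^ n * cos (pi * x) = cos (pi * (x - real n))"
  using sin_npi2[of n] cos_npi2[of n] by (simp add: right_diff_distrib cos_diff mult.commute)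

lemma parity_2k: "n \<le> 2 * k \<Longrightarrow> (-1 :: real) ^ (2 * k - n) = (-1) ^ n"
  by (simp add: minus_one_power_iff)

lemma half_le_sin:
  assumes "0 \<le> y" "y \<le> pi / 4"
  shows "y / 2 \<le> sin y"
proof (cases "y = 0")
  case False
  then have "0 < y" using assms by simp
  then obtain t where t: "0 < t" "t < y" "sin y - sin 0 = (y - 0) * cos t"
    using MVT2[of 0 y sin cos] DERIV_sin by blast
  have "cos (pi / 3) \<le> cos t" using t assms by (intro cos_monotone_0_pi_le) auto
  then have "y * (1 / 2) \<le> y * cos t" using assms by (intro mult_left_mono) (simp_all add: cos_60)
  then show ?thesis using t by simp
qed simp

text \<open>
  With \<open>2 y = \<bar>\<pi> (x - n)\<bar> \<le> \<pi> / 2\<close>, the left side is \<open>2 cos (2 y) = 2 - 4 sin\<^sup>2 y \<le> 2 - y\<^sup>2\<close>, while the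
  energies differ by at most \<open>2 y\<close>, the cosine being Lipschitz.
\<close>

lemma free_disc_quadratic_upper:
  assumes k: "k \<ge> 1" and x: "\<bar>x - real n\<bar> \<le> 1 / 2"
  shows "(-1) ^ n * disc (2 * k) (\<lambda>_. free_energy k x)
    \<le> 2 - (free_energy k x - free_energy k (real n))\<^sup>2 / 4"
proof -
  define y where "y = pi * \<bar>x - real n\<bar> / 2"
  have y: "0 \<le> y" "y \<le> pi / 4" using x by (simp_all add: y_def)
  have "\<bar>free_energy k x - free_energy k (real n)\<bar> \<le> 2 * \<bar>quasi_momentum k x - quasi_momentum k (real n)\<bar>"
  proof -
    have "\<bar>cos (quasi_momentum k x) - cos (quasi_momentum k (real n))\<bar> \<le> \<bar>quasi_momentum k x - quasi_momentum k (real n)\<bar>"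
    proof -
      let ?a = "quasi_momentum k x" and ?b = "quasi_momentum k (real n)"
      have "\<bar>cos ?a - cos ?b\<bar> = 2 * (\<bar>sin ((?a + ?b) / 2)\<bar> * \<bar>sin ((?b - ?a) / 2)\<bar>)"
        by (simp add: cos_diff_cos abs_mult)
      also have "\<dots> \<le> 2 * (1 * \<bar>(?b - ?a) / 2\<bar>)"
        by (intro mult_left_mono mult_mono abs_sin_x_le_abs_x) auto
      finally show ?thesis by simp
    qed
    then have "2 * \<bar>cos (quasi_momentum k x) - cos (quasi_momentum k (real n))\<bar> \<le> 2 * \<bar>quasi_momentum k x - quasi_momentum k (real n)\<bar>" by simp
    moreover have "free_energy k x - free_energy k (real n) = 2 * (cos (quasi_momentum k x) - cos (quasi_momentum k (real n)))"
      by (simp add: free_energy_def)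
    ultimately show ?thesis by (simp only: abs_mult abs_numeral)
  qed
  also have "\<bar>quasi_momentum k x - quasi_momentum k (real n)\<bar> = y / real k"
  proof -
    have "quasi_momentum k x - quasi_momentum k (real n) = - (pi * (x - real n)) / (2 * real k)"
      unfolding quasi_momentum_def diff_divide_distrib[symmetric]
      by (rule arg_cong2[of _ _ _ _ "(/)"]) (simp_all add: algebra_simps)
    then show ?thesis by (simp add: y_def abs_mult abs_divide)
  qed
  also have "y / real k \<le> y" using k y by (simp add: field_simps mult_le_cancel_left1)
  finally have s: "\<bar>free_energy k x - free_energy k (real n)\<bar> \<le> 2 * y" by simp
  have "(free_energy k x - free_energy k (real n))\<^sup>2 \<le> (2 * y)\<^sup>2"
    using power_mono[OF s, of 2] by simp
  also have "\<dots> = 16 * (y / 2)\<^sup>2" by (simp add: power2_eq_square)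
  also have "\<dots> \<le> 16 * (sin y)\<^sup>2" using half_le_sin[OF y] y by (intro mult_left_mono power_mono) auto
  also have "2 * y = \<bar>pi * (x - real n)\<bar>" by (simp add: y_def abs_mult)
  then have "cos (pi * (x - real n)) = cos (2 * y)" by simp
  then have "16 * (sin y)\<^sup>2 = 8 - 8 * cos (pi * (x - real n))" by (simp add: cos_double_sin)
  finally show ?thesis using parity_cos[of n x] by (simp add: free_disc[OF k] mult.left_commute)
qed

text \<open>
  Differentiate \<open>P (2 cos p) = 2 cos (2 k p)\<close> twice in \<open>p\<close>, at a point where \<open>sin (2 k p) = 0\<close> and
  \<open>sin p \<noteq> 0\<close>.
\<close>

lemma free_lyap_derivs:
  assumes k: "k \<ge> 1" and n: "n \<in> {1..<2 * k}"
  defines "P \<equiv> lyap_poly k (\<lambda>_. 0)" and "c \<equiv> free_energy k (real n)"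
  shows "poly (pderiv P) c = 0"
    and "poly (pderiv (pderiv P)) c = - 2 * (-1) ^ n * ((real k)\<^sup>2 / (sin (quasi_momentum k (real n)))\<^sup>2)"
proof -
  let ?m = "real (2 * k)"
  let ?p = "quasi_momentum k (real n)"
  have sp: "sin ?p \<noteq> 0" using sin_quasi_momentum_pos[OF k, of "real n"] n by simp
  have P: "poly P (2 * cos p) = 2 * cos (?m * p)" for p
    using k unfolding P_def lyapunov_eq_poly[symmetric] lyapunov_eq_disc by (simp add: disc_const_cos)
  have d1: "poly (pderiv P) (2 * cos p) * (2 * sin p) = 2 * (?m * sin (?m * p))" for p
  proof -
    have "((\<lambda>p. poly P (2 * cos p)) has_real_derivative poly (pderiv P) (2 * cos p) * (2 * - sin p)) (at p)"
      by (auto intro!: derivative_eq_intros DERIV_chain2[OF poly_DERIV])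
    moreover have "((\<lambda>p. 2 * cos (?m * p)) has_real_derivative 2 * (- sin (?m * p) * ?m)) (at p)"
      by (auto intro!: derivative_eq_intros)
    ultimately have "poly (pderiv P) (2 * cos p) * (2 * - sin p) = 2 * (- sin (?m * p) * ?m)"
      unfolding P by (rule DERIV_unique)
    then show ?thesis by (simp add: mult.commute)
  qed
  have d2: "poly (pderiv (pderiv P)) (2 * cos p) * (- 4 * (sin p)\<^sup>2) + poly (pderiv P) (2 * cos p) * (2 * cos p)
      = 2 * ?m\<^sup>2 * cos (?m * p)" for p
  proof -
    have "((\<lambda>p. poly (pderiv P) (2 * cos p) * (2 * sin p)) has_real_derivative
        poly (pderiv (pderiv P)) (2 * cos p) * (2 * - sin p) * (2 * sin p) + (2 * cos p) * poly (pderiv P) (2 * cos p)) (at p)"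
      by (auto intro!: derivative_eq_intros DERIV_chain2[OF poly_DERIV])
    moreover have "((\<lambda>p. 2 * (?m * sin (?m * p))) has_real_derivative 2 * (?m * (cos (?m * p) * ?m))) (at p)"
      by (auto intro!: derivative_eq_intros)
    ultimately have "poly (pderiv (pderiv P)) (2 * cos p) * (2 * - sin p) * (2 * sin p) + (2 * cos p) * poly (pderiv P) (2 * cos p)
       = 2 * (?m * (cos (?m * p) * ?m))"
      unfolding d1 by (rule DERIV_unique)
    then show ?thesis by (simp add: power2_eq_square mult_ac)
  qed
  have c: "c = 2 * cos ?p" by (simp add: c_def free_energy_def)
  have s0: "sin (?m * ?p) = 0" unfolding sin_two_k_quasi_momentum[OF k] using sin_npi2[of n] by simp
  have c0: "cos (?m * ?p) = (-1) ^ n" unfolding cos_two_k_quasi_momentum[OF k] using cos_npi2[of n] by simp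
  have "poly (pderiv P) (2 * cos ?p) * (2 * sin ?p) = 0" unfolding d1 s0 by simp
  moreover have "2 * sin ?p \<noteq> 0" using sp by simp
  ultimately have z: "poly (pderiv P) c = 0" unfolding c by (metis mult_eq_0_iff)
  then show "poly (pderiv P) c = 0" .
  have "poly (pderiv (pderiv P)) c * (- 4 * (sin ?p)\<^sup>2) = 2 * ?m\<^sup>2 * (-1) ^ n"
    using d2[of ?p] unfolding c0 c[symmetric] z by (simp only: mult_zero_left add_0_right)
  moreover have "- 4 * (sin ?p)\<^sup>2 \<noteq> 0" using sp by simp
  ultimately have "poly (pderiv (pderiv P)) c = 2 * ?m\<^sup>2 * (-1) ^ n / (- 4 * (sin ?p)\<^sup>2)"
    by (metis nonzero_eq_divide_eq)
  also have "\<dots> = - 2 * (-1) ^ n * ((real k)\<^sup>2 / (sin ?p)\<^sup>2)"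
    by (simp only: of_nat_mult power_mult_distrib) simp
  finally show "poly (pderiv (pderiv P)) c = - 2 * (-1) ^ n * ((real k)\<^sup>2 / (sin ?p)\<^sup>2)" .
qed

lemma poly_taylor_second_order:
  fixes P :: "real poly"
  shows "\<exists>C. \<forall>x. \<bar>x - c\<bar> \<le> R \<longrightarrow>
    \<bar>poly P x - poly P c - poly (pderiv P) c * (x - c) - poly (pderiv (pderiv P)) c / 2 * (x - c)\<^sup>2\<bar> \<le> C * \<bar>x - c\<bar> ^ 3"
proof -
  define T where "T = pcompose P [:c, 1:]"
  obtain t0 T1 where T0: "T = pCons t0 T1" by (rule pCons_cases)
  obtain t1 T2 where T1: "T1 = pCons t1 T2" by (rule pCons_cases)
  obtain t2 T3 where T2: "T2 = pCons t2 T3" by (rule pCons_cases)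
  have d: "pderiv (pcompose p [:c, 1:]) = pcompose (pderiv p) [:c, 1:]" for p
    by (simp add: pderiv_pcompose pderiv_pCons)
  have c0: "poly P c = t0" using T0 T_def by (metis poly_pCons poly_pcompose add.right_neutral mult_zero_left)
  have "poly (pderiv P) c = poly (pderiv T) 0" unfolding T_def d by (simp add: poly_pcompose)
  then have c1: "poly (pderiv P) c = t1" by (simp add: T0 T1 pderiv_pCons)
  have "poly (pderiv (pderiv P)) c = poly (pderiv (pderiv T)) 0" unfolding T_def d by (simp add: poly_pcompose)
  then have c2: "poly (pderiv (pderiv P)) c = 2 * t2" by (simp add: T0 T1 T2 pderiv_pCons pderiv_add)
  have "compact {-R..R}" by simp
  moreover have "continuous_on {-R..R} (\<lambda>s. poly T3 s)" by (intro continuous_intros)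
  ultimately have "bounded (poly T3 ` {-R..R})" by (intro compact_imp_bounded compact_continuous_image)
  then obtain C where "\<forall>y\<in>poly T3 ` {-R..R}. norm y \<le> C" unfolding bounded_iff by blast
  then have C: "\<And>s. s \<in> {-R..R} \<Longrightarrow> \<bar>poly T3 s\<bar> \<le> C" by simp
  have "\<bar>poly P x - poly P c - poly (pderiv P) c * (x - c) - poly (pderiv (pderiv P)) c / 2 * (x - c)\<^sup>2\<bar> \<le> C * \<bar>x - c\<bar> ^ 3"
    if x: "\<bar>x - c\<bar> \<le> R" for x
  proof -
    have "poly P x = poly T (x - c)" by (simp add: T_def poly_pcompose)
    then have "poly P x - poly P c - poly (pderiv P) c * (x - c) - poly (pderiv (pderiv P)) c / 2 * (x - c)\<^sup>2
       = poly T3 (x - c) * (x - c) ^ 3"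
      unfolding c0 c1 c2 by (simp add: T0 T1 T2 power2_eq_square power3_eq_cube algebra_simps)
    moreover have "\<bar>poly T3 (x - c)\<bar> \<le> C" using x by (intro C) auto
    ultimately show ?thesis by (simp add: abs_mult power_abs mult_right_mono)
  qed
  then show ?thesis by blast
qed

lemma free_disc_taylor:
  assumes k: "k \<ge> 1" and n: "n \<in> {1..<2 * k}"
  defines "c \<equiv> free_energy k (real n)"
  shows "\<exists>C. \<forall>l. \<bar>l\<bar> \<le> 2 \<longrightarrow> \<bar>(-1) ^ n * disc (2 * k) (\<lambda>_. l) - 2
    + (real k)\<^sup>2 / (sin (quasi_momentum k (real n)))\<^sup>2 * (l - c)\<^sup>2\<bar> \<le> C * \<bar>l - c\<bar> ^ 3"
proof -
  let ?P = "lyap_poly k (\<lambda>_. 0)"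
  let ?B = "(real k)\<^sup>2 / (sin (quasi_momentum k (real n)))\<^sup>2"
  obtain C where C: "\<And>x. \<bar>x - c\<bar> \<le> 4 \<Longrightarrow> \<bar>poly ?P x - poly ?P c - poly (pderiv ?P) c * (x - c)
      - poly (pderiv (pderiv ?P)) c / 2 * (x - c)\<^sup>2\<bar> \<le> C * \<bar>x - c\<bar> ^ 3"
    using poly_taylor_second_order[of c 4 ?P] by blast
  have P: "poly ?P l = disc (2 * k) (\<lambda>_. l)" for l
    using lyapunov_eq_disc[of k "\<lambda>_. 0" l] by (simp add: lyapunov_eq_poly)
  have Pc: "poly ?P c = 2 * (-1) ^ n"
    unfolding P c_def free_disc[OF k] using cos_npi2[of n] by simp
  have "\<bar>(-1) ^ n * disc (2 * k) (\<lambda>_. l) - 2 + ?B * (l - c)\<^sup>2\<bar> \<le> C * \<bar>l - c\<bar> ^ 3" if l: "\<bar>l\<bar> \<le> 2" for l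
  proof -
    have "\<bar>l - c\<bar> \<le> 4" using l abs_free_energy_le[of k "real n"] by (simp add: c_def)
    from C[OF this, unfolded Pc free_lyap_derivs[OF k n, folded c_def], unfolded P]
    have "\<bar>disc (2 * k) (\<lambda>_. l) - 2 * (-1) ^ n + (-1) ^ n * ?B * (l - c)\<^sup>2\<bar> \<le> C * \<bar>l - c\<bar> ^ 3"
      by simp
    also have "disc (2 * k) (\<lambda>_. l) - 2 * (-1) ^ n + (-1) ^ n * ?B * (l - c)\<^sup>2
      = (-1) ^ n * ((-1) ^ n * disc (2 * k) (\<lambda>_. l) - 2 + ?B * (l - c)\<^sup>2)"
      by (simp add: distrib_left right_diff_distrib mult.assoc[symmetric] power_mult_distrib[symmetric])
    finally show ?thesis by (simp add: abs_mult power_abs)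
  qed
  then show ?thesis by blast
qed

text \<open>
  The quasi-momentum at the \<open>n\<close>-th closed gap is \<open>\<pi> (2 k - n) / (2 k)\<close>, so the double sum is the one of
  index \<open>2 k - n\<close>, which involves the same coordinate of \<open>q\<close>.
\<close>

lemma coupling_coeff_2_at_band_edge:
  assumes k: "k \<ge> 1" and q: "q \<in> Qodd k" and n: "n \<in> {1..<2 * k}"
  shows "(-1) ^ n * coeff (coupling_poly k q (free_energy k (real n))) 2
    = real k * 2 ^ of_bool (k = n) * (qhat k q (if n \<le> k then n else 2 * k - n))\<^sup>2
      / (4 * (sin (quasi_momentum k (real n)))\<^sup>2)"
proof -
  let ?p = "quasi_momentum k (real n)"
  \<comment> \<open>The index whose angle is the quasi-momentum at the \<open>n\<close>-th closed gap.\<close>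
  define n' where "n' = 2 * k - n"
  have n': "n' \<in> {1..<2 * k}" using n by (auto simp: n'_def)
  have p: "?p = pi * real n' / (2 * real k)" using n by (simp add: quasi_momentum_def n'_def of_nat_diff)
  have sp: "sin ?p \<noteq> 0" using sin_quasi_momentum_pos[OF k, of "real n"] n by simp
  have s0: "sin (real (2 * k) * ?p) = 0" unfolding sin_two_k_quasi_momentum[OF k] using sin_npi2[of n] by simp
  have c0: "cos (real (2 * k) * ?p) = (-1) ^ n" unfolding cos_two_k_quasi_momentum[OF k] using cos_npi2[of n] by simp
  let ?g = "\<lambda>i j. q i * q j * (sin ((real j - real i) * ?p))\<^sup>2"
  have sym: "?g i j = ?g j i" for i j
  proof -
    have "sin ((real j - real i) * ?p) = - sin ((real i - real j) * ?p)"
      by (simp add: sin_minus[symmetric] left_diff_distrib)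
    then show ?thesis by simp
  qed
  define Q where "Q = real k * 2 ^ of_bool (k = n) * (qhat k q (if n \<le> k then n else 2 * k - n))\<^sup>2"
  have "real k * 2 ^ of_bool (k = n') * (qhat k q (if n' \<le> k then n' else 2 * k - n'))\<^sup>2 = Q"
  proof -
    have "(if n' \<le> k then n' else 2 * k - n') = (if n \<le> k then n else 2 * k - n)" "(k = n') = (k = n)"
      using n by (auto simp: n'_def)
    then show ?thesis by (simp add: Q_def)
  qed
  then have "2 * (\<Sum>j=1..2 * k. \<Sum>i\<in>{1..<j}. ?g i j) = - Q / 2"
    using double_sine_sum_eq_qhat[OF k q n'] sum_symmetric_square[of ?g "2 * k", OF sym]
    unfolding p by simp
  then have S: "(\<Sum>j=1..2 * k. \<Sum>i\<in>{1..<j}. ?g i j) = - Q / 4" by simp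
  have "coeff (coupling_poly k q (free_energy k (real n))) 2 = - ((-1) ^ n) / (sin ?p)\<^sup>2 * (- Q / 4)"
    unfolding free_energy_def coeff_coupling_poly_2[OF sp s0] c0 S ..
  then have "(-1) ^ n * coeff (coupling_poly k q (free_energy k (real n))) 2
     = ((-1) ^ n * (-1) ^ n) * (Q / (4 * (sin ?p)\<^sup>2))"
    by simp
  then show ?thesis by (simp add: Q_def power_mult_distrib[symmetric])
qed

section \<open>Gaps of small odd potentials\<close>

lemma uniform_perturbation:
  assumes k: "k \<ge> 1"
  obtains C where "C \<ge> 1"
    and "\<And>q l. q \<in> Qodd k \<Longrightarrow> qnorm k q \<le> 1 \<Longrightarrow> \<bar>l\<bar> \<le> 2 \<Longrightarrow>
      \<bar>lyapunov k q l - disc (2 * k) (\<lambda>_. l) - coeff (coupling_poly k q l) 2\<bar> \<le> C * qnorm k q ^ 4"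
    and "\<And>q l. q \<in> Qodd k \<Longrightarrow> \<bar>l\<bar> \<le> 2 \<Longrightarrow> \<bar>coeff (coupling_poly k q l) 2\<bar> \<le> C * (qnorm k q)\<^sup>2"
    and "\<And>q l l'. q \<in> Qodd k \<Longrightarrow> \<bar>l\<bar> \<le> 2 \<Longrightarrow> \<bar>l'\<bar> \<le> 2 \<Longrightarrow>
      \<bar>coeff (coupling_poly k q l) 2 - coeff (coupling_poly k q l') 2\<bar> \<le> C * (qnorm k q)\<^sup>2 * \<bar>l - l'\<bar>"
    and "\<And>q l. q \<in> Qodd k \<Longrightarrow> qnorm k q \<le> 1 \<Longrightarrow> \<bar>l\<bar> \<le> 2 \<Longrightarrow>
      \<bar>recsol (\<lambda>j. l - q j) 0 1 (2 * k) - recsol (\<lambda>_. l) 0 1 (2 * k)\<bar> \<le> C * qnorm k q"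
proof -
  define C1 :: real where "C1 = real (2 * k + 2) * (2 * 4 ^ Suc (2 * k))"
  define C2 :: real where "C2 = 2 * 4 ^ Suc (2 * k)"
  define C3 :: real where "C3 = 2 * 8 ^ Suc (2 * k)"
  define C4 :: real where "C4 = real (Suc (2 * k)) * 4 ^ (2 * k)"
  define C where "C = 1 + C1 + C2 + C3 + C4"
  have "0 \<le> C1" "0 \<le> C2" "0 \<le> C3" "0 \<le> C4" by (simp_all add: C1_def C2_def C3_def C4_def)
  then have C: "1 \<le> C" "C1 \<le> C" "C2 \<le> C" "C3 \<le> C" "C4 \<le> C" by (simp_all add: C_def)
  show ?thesis
  proof (rule that[of C])
    fix q and l :: real
    assume q: "q \<in> Qodd k" and l: "\<bar>l\<bar> \<le> 2"
    note r0 = qnorm_nonneg[of k q]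
    show "\<bar>coeff (coupling_poly k q l) 2\<bar> \<le> C * (qnorm k q)\<^sup>2"
      using coupling_coeff_bounds(1)[OF k q l, of 2] C(3)
        mult_right_mono[of C2 C "(qnorm k q)\<^sup>2"] by (simp add: C2_def)
    show "\<bar>coeff (coupling_poly k q l) 2 - coeff (coupling_poly k q l') 2\<bar> \<le> C * (qnorm k q)\<^sup>2 * \<bar>l - l'\<bar>"
      if "\<bar>l'\<bar> \<le> 2" for l'
    proof -
      have "\<bar>coeff (coupling_poly k q l) 2 - coeff (coupling_poly k q l') 2\<bar> \<le> C3 * (qnorm k q)\<^sup>2 * \<bar>l - l'\<bar>"
        using coupling_coeff_bounds(2)[OF k q l that, of 2] by (simp add: C3_def)
      also have "\<dots> \<le> C * (qnorm k q)\<^sup>2 * \<bar>l - l'\<bar>" using C by (intro mult_right_mono) auto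
      finally show ?thesis .
    qed
    assume r: "qnorm k q \<le> 1"
    have "\<bar>lyapunov k q l - disc (2 * k) (\<lambda>_. l) - coeff (coupling_poly k q l) 2\<bar> \<le> C1 * qnorm k q ^ 4"
      unfolding C1_def by (rule lyapunov_second_order[OF k q l r])
    also have "\<dots> \<le> C * qnorm k q ^ 4" using C r0 by (intro mult_right_mono) auto
    finally show "\<bar>lyapunov k q l - disc (2 * k) (\<lambda>_. l) - coeff (coupling_poly k q l) 2\<bar> \<le> C * qnorm k q ^ 4" .
    have "\<bar>recsol (\<lambda>j. l - q j) 0 1 (2 * k) - recsol (\<lambda>_. l) 0 1 (2 * k)\<bar> \<le> C4 * qnorm k q"
      using recsol_first_order[OF q l r, of "2 * k"] by (simp add: C4_def mult.assoc)
    also have "\<dots> \<le> C * qnorm k q" using C r0 by (intro mult_right_mono) auto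
    finally show "\<bar>recsol (\<lambda>j. l - q j) 0 1 (2 * k) - recsol (\<lambda>_. l) 0 1 (2 * k)\<bar> \<le> C * qnorm k q" .
  qed (rule C(1))
qed

text \<open>
  The discriminant is \<open>u + v\<close>, and by the Wronskian \<open>u v = 1\<close>, so \<open>(u + v)\<^sup>2 \<ge> 4\<close>.
\<close>

lemma dirichlet_eigenvalue_disc:
  assumes "recsol c 0 1 m = (0 :: real)"
  shows "2 \<le> \<bar>disc m c\<bar>"
proof -
  define u where "u = recsol c 0 1 (Suc m)"
  define v where "v = recsol c 1 0 m"
  have uv: "u * v = 1" using wronskian_recsol[of c m] assms by (simp only: u_def v_def)
  have "(u + v)\<^sup>2 = (u - v)\<^sup>2 + 4 * (u * v)" by (simp add: power2_eq_square algebra_simps)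
  then have "2\<^sup>2 \<le> \<bar>u + v\<bar>\<^sup>2" unfolding uv by simp
  then have "2 \<le> \<bar>u + v\<bar>" by (rule power2_le_imp_le) simp
  then show ?thesis by (simp only: disc_def u_def v_def)
qed

text \<open>
  The free Dirichlet solution is \<open>sin (2 k p) / sin p\<close>, which alternates in sign at the zeros of the free
  discriminant. This locates its zeros, the Dirichlet eigenvalues, and the location survives a
  small perturbation.
\<close>

lemma free_dirichlet_value:
  assumes k: "k \<ge> 1" and n: "n < 2 * k"
  shows "(-1) ^ n * recsol (\<lambda>_. free_energy k (real n + 1 / 2)) 0 1 (2 * k) \<le> - 1"
proof -
  let ?x = "real n + 1 / 2"
  have xn: "?x < 2 * real k" using n by linarith
  have sp: "0 < sin (quasi_momentum k ?x)" using sin_quasi_momentum_pos[OF k, of ?x] xn by simp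
  have "recsol (\<lambda>_. free_energy k ?x) 0 1 (2 * k) * sin (quasi_momentum k ?x) = - sin (pi * ?x)"
    unfolding free_energy_def recsol_const_sin sin_two_k_quasi_momentum[OF k] ..
  also have "sin (pi * ?x) = (-1) ^ n"
    using sin_npi2[of n] cos_npi2[of n] by (simp add: distrib_left sin_add)
  finally have "((-1) ^ n * recsol (\<lambda>_. free_energy k ?x) 0 1 (2 * k)) * sin (quasi_momentum k ?x) = - ((-1) ^ n * (-1) ^ n)"
    by (simp only: mult.assoc minus_mult_right)
  then have "((-1) ^ n * recsol (\<lambda>_. free_energy k ?x) 0 1 (2 * k)) * sin (quasi_momentum k ?x) = - 1"
    by (simp add: power_mult_distrib[symmetric])
  then have e: "(-1) ^ n * recsol (\<lambda>_. free_energy k ?x) 0 1 (2 * k) = - 1 / sin (quasi_momentum k ?x)"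
    using sp by (metis nonzero_eq_divide_eq less_irrefl)
  show ?thesis unfolding e using sp sin_le_one[of "quasi_momentum k ?x"] by (simp add: field_simps)
qed

text \<open>
  All that the asymptotic analysis needs to know about the \<open>n\<close>-th gap. The first condition confines
  its edges and its critical point to the energies between the neighbouring zeros of the free discriminant.
\<close>

definition gap_localized :: "nat \<Rightarrow> (nat \<Rightarrow> real) \<Rightarrow> nat \<Rightarrow> bool" where
  "gap_localized k q n \<longleftrightarrow>
    (\<forall>x\<in>{lam_minus k q n, lam_plus k q n, lam_crit k q n}. \<exists>t. \<bar>t - real n\<bar> \<le> 1 / 2 \<and> x = free_energy k t) \<and>
    (-1) ^ n * lyapunov k q (lam_minus k q n) = 2 \<and>
    (-1) ^ n * lyapunov k q (lam_plus k q n) = 2 \<and>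
    (-1) ^ n * lyapunov k q (lam_crit k q n) \<ge> 2 \<and>
    (-1) ^ n * lyapunov k q (free_energy k (real n)) \<le> (-1) ^ n * lyapunov k q (lam_crit k q n)"

text \<open>
  The Dirichlet eigenvalues \<open>x\<^sub>1, \<dots>, x\<^sub>2\<^sub>k\<^sub>-\<^sub>1\<close> of the perturbed operator remain between the free zeros
  \<open>a\<^sub>0 < \<dots> < a\<^sub>2\<^sub>k\<^sub>-\<^sub>1\<close>. There the modulus of the discriminant is at least \<open>2\<close>, and closeness to the free
  one fixes the sign. Together with the points \<open>- 2\<close> and \<open>2\<close> at the ends of the free spectrum,
  they feed \<open>band_structure\<close>.
\<close>

lemma small_perturbation_gaps:
  assumes k: "k \<ge> 1" and n: "n \<in> {1..<2 * k}"
    and disc_close: "\<And>l. \<bar>l\<bar> \<le> 2 \<Longrightarrow> \<bar>lyapunov k q l - disc (2 * k) (\<lambda>_. l)\<bar> \<le> 1 / 2"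
    and sol_close: "\<And>l. \<bar>l\<bar> \<le> 2 \<Longrightarrow>
      \<bar>recsol (\<lambda>j. l - q j) 0 1 (2 * k) - recsol (\<lambda>_. l) 0 1 (2 * k)\<bar> \<le> 1 / 2"
  shows "gap_localized k q n"
proof -
  let ?E = "free_energy k"
  define a where "a i = ?E (real i + 1 / 2)" for i
  define f where "f = recsol (\<lambda>j. [:- q j, 1:]) 0 1 (2 * k)"
  have f: "poly f l = recsol (\<lambda>j. l - q j) 0 1 (2 * k)" for l
    using recsol_hom[of "\<lambda>p. poly p l" "\<lambda>j. [:- q j, 1:]" 0 1 "2 * k"] by (simp add: f_def)
  have sign: "\<bar>(-1) ^ i * x - (-1) ^ i * y\<bar> = \<bar>x - y\<bar>" for i and x y :: real
    by (simp add: right_diff_distrib[symmetric] abs_mult power_abs)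
  have fa: "(-1) ^ i * poly f (a i) < 0" if "i < 2 * k" for i
  proof -
    have "\<bar>(-1) ^ i * poly f (a i) - (-1) ^ i * recsol (\<lambda>_. a i) 0 1 (2 * k)\<bar> \<le> 1 / 2"
      unfolding sign f a_def by (intro sol_close abs_free_energy_le)
    moreover have "(-1) ^ i * recsol (\<lambda>_. a i) 0 1 (2 * k) \<le> - 1"
      unfolding a_def by (rule free_dirichlet_value[OF k that])
    ultimately show ?thesis unfolding abs_le_iff by linarith
  qed
  have a_less: "a i < a (Suc i)" if "Suc i < 2 * k" for i
    unfolding a_def using that by (intro free_energy_less[OF k]) auto
  have "\<exists>x. a (i - 1) < x \<and> x < a i \<and> poly f x = 0" if i: "i \<in> {1..<2 * k}" for i
  proof -
    obtain j where j: "i = Suc j" using i by (cases i) auto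
    have "poly f (a j) * poly f (a i) < 0"
      using fa[of j] fa[of i] i j
      by (cases "even j") (auto simp: mult_less_0_iff)
    then show ?thesis using poly_IVT[of "a j" "a i" f] a_less[of j] i j by auto
  qed
  then obtain x where x: "\<And>i. i \<in> {1..<2 * k} \<Longrightarrow> a (i - 1) < x i" "\<And>i. i \<in> {1..<2 * k} \<Longrightarrow> x i < a i"
    "\<And>i. i \<in> {1..<2 * k} \<Longrightarrow> poly f (x i) = 0" by metis
  \<comment> \<open>Dirichlet eigenvalues, with the ends of the free spectrum added on both sides.\<close>
  define \<mu> where "\<mu> i = (if i = 0 then ?E 0 else if i = 2 * k then ?E (2 * real k) else x i)" for i
  have half_window: "\<exists>t. \<bar>t - real i\<bar> \<le> 1 / 2 \<and> y = ?E t"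
    if "i \<ge> 1" "a (i - 1) \<le> y" "y \<le> a i" for i y
  proof -
    have "\<exists>t. real (i - 1) + 1 / 2 \<le> t \<and> t \<le> real i + 1 / 2 \<and> ?E t = y"
      using that(2,3) unfolding a_def by (intro free_energy_surj[OF k]) auto
    then obtain t where "real (i - 1) + 1 / 2 \<le> t" "t \<le> real i + 1 / 2" "?E t = y" by blast
    moreover have "real (i - 1) = real i - 1" using that(1) by (simp add: of_nat_diff)
    ultimately have "\<bar>t - real i\<bar> \<le> 1 / 2" unfolding abs_le_iff by linarith
    then show ?thesis using \<open>?E t = y\<close> by blast
  qed
  have lyap_ge: "(-1) ^ i * lyapunov k q y \<ge> - 1 / 2" if "\<bar>t - real i\<bar> \<le> 1 / 2" "y = ?E t" for i t y
  proof -
    have w: "- (1 / 2) \<le> t - real i" "t - real i \<le> 1 / 2"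
      using that(1) unfolding abs_le_iff by linarith+
    have "0 \<le> cos (pi * (t - real i))"
    proof (rule cos_ge_zero)
      show "- (pi / 2) \<le> pi * (t - real i)" "pi * (t - real i) \<le> pi / 2"
        using mult_left_mono[OF w(1), of pi] mult_left_mono[OF w(2), of pi] by simp_all
    qed
    then have "0 \<le> (-1) ^ i * disc (2 * k) (\<lambda>_. y)"
      unfolding that(2) free_disc[OF k] using parity_cos[of i t] by (simp add: mult.left_commute)
    moreover have "\<bar>(-1) ^ i * lyapunov k q y - (-1) ^ i * disc (2 * k) (\<lambda>_. y)\<bar> \<le> 1 / 2"
      unfolding sign that(2) by (intro disc_close abs_free_energy_le)
    ultimately show ?thesis unfolding abs_le_iff by linarith
  qed
  let ?p = "lyap_poly k q"
  have inside: "\<bar>poly ?p (a i)\<bar> < 2" if "i < 2 * k" for i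
  proof -
    have "disc (2 * k) (\<lambda>_. a i) = 0"
      unfolding a_def free_disc[OF k] using sin_npi2[of i] by (simp add: distrib_left cos_add)
    then show ?thesis using disc_close[of "a i"] abs_free_energy_le unfolding a_def lyapunov_eq_poly by fastforce
  qed
  have interlace: "\<mu> i < a i" "a i < \<mu> (Suc i)" if "i < 2 * k" for i
  proof -
    show "\<mu> i < a i" using that x(2)[of i] free_energy_less[OF k, of 0 "1 / 2"] k
      by (auto simp: \<mu>_def a_def)
    show "a i < \<mu> (Suc i)" using that x(1)[of "Suc i"] free_energy_less[OF k, of "real i + 1 / 2" "2 * real k"]
      by (auto simp: \<mu>_def a_def)
  qed
  have ends: "(-1) ^ (2 * k) * poly ?p (\<mu> 0) > 0" "poly ?p (\<mu> (2 * k)) > 0"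
  proof -
    have "disc (2 * k) (\<lambda>_. ?E 0) = 2" "disc (2 * k) (\<lambda>_. ?E (2 * real k)) = 2"
      unfolding free_disc[OF k] using cos_npi2[of "2 * k"] by simp_all
    then have "\<bar>lyapunov k q (?E 0) - 2\<bar> \<le> 1 / 2" "\<bar>lyapunov k q (?E (2 * real k)) - 2\<bar> \<le> 1 / 2"
      using disc_close[OF abs_free_energy_le[of k 0]] disc_close[OF abs_free_energy_le[of k "2 * real k"]]
      by simp_all
    then have "lyapunov k q (?E 0) > 0" "lyapunov k q (?E (2 * real k)) > 0"
      unfolding abs_le_iff by linarith+
    then show "(-1) ^ (2 * k) * poly ?p (\<mu> 0) > 0" "poly ?p (\<mu> (2 * k)) > 0"
      using k unfolding lyapunov_eq_poly[symmetric] by (simp_all add: \<mu>_def)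
  qed
  have alternate: "(-1) ^ (2 * k - i) * poly ?p (\<mu> i) \<ge> 2" if i: "i \<in> {1..<2 * k}" for i
  proof -
    have mu: "\<mu> i = x i" using i by (auto simp: \<mu>_def)
    obtain t where t: "\<bar>t - real i\<bar> \<le> 1 / 2" "x i = ?E t"
      using half_window[of i "x i"] x(1,2)[OF i] i by auto
    have "2 \<le> \<bar>lyapunov k q (x i)\<bar>"
      unfolding lyapunov_eq_disc by (rule dirichlet_eigenvalue_disc) (use x(3)[OF i] in \<open>simp add: f\<close>)
    then have "2 \<le> \<bar>(-1) ^ i * lyapunov k q (x i)\<bar>" by (simp add: abs_mult power_abs)
    then have "2 \<le> (-1) ^ i * lyapunov k q (x i)" using lyap_ge[OF t] by linarith
    then show ?thesis using i unfolding mu lyapunov_eq_poly by (simp add: parity_2k)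
  qed
  have size: "2 * k \<ge> 2" "degree ?p = 2 * k" using k degree_lyap_poly[OF k] by auto
  show ?thesis
  proof (rule band_structure[of "2 * k" ?p \<mu> a])
    fix lm lp \<kappa>
    assume edges: "poly_edges (2 * k) ?p lm lp"
      and uniq: "\<And>lm' lp' n. poly_edges (2 * k) ?p lm' lp' \<Longrightarrow> n \<in> {1..<2 * k} \<Longrightarrow> lm' n = lm n \<and> lp' n = lp n"
      and loc: "\<And>n. n \<in> {1..<2 * k} \<Longrightarrow> a (n - 1) < lm n \<and> lm n \<le> \<kappa> n \<and> \<kappa> n \<le> lp n \<and> lp n < a n"
      and crit: "\<And>n. n \<in> {1..<2 * k} \<Longrightarrow> poly (pderiv ?p) (\<kappa> n) = 0"
      and crit_uniq: "\<And>n x. n \<in> {1..<2 * k} \<Longrightarrow> x \<in> {lm n..lp n} \<Longrightarrow> poly (pderiv ?p) x = 0 \<Longrightarrow> x = \<kappa> n"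
      and peak: "\<And>n. n \<in> {1..<2 * k} \<Longrightarrow> (-1) ^ (2 * k - n) * poly ?p (\<kappa> n) \<ge> 2"
      and max: "\<And>n x. n \<in> {1..<2 * k} \<Longrightarrow> x \<in> {a (n - 1)..a n} \<Longrightarrow>
          (-1) ^ (2 * k - n) * poly ?p x \<le> (-1) ^ (2 * k - n) * poly ?p (\<kappa> n)"
    have lm: "lam_minus k q n = lm n" and lp: "lam_plus k q n = lp n"
      unfolding lam_minus_def lam_plus_def band_edges_iff[OF k] using edges uniq n
      by (blast intro!: the_equality)+
    have deriv: "deriv (lyapunov k q) = poly (pderiv ?p)"
      unfolding lyapunov_eq_poly by (intro ext DERIV_imp_deriv poly_DERIV)
    have crit_eq: "lam_crit k q n = \<kappa> n"
      unfolding lam_crit_def lm lp deriv using crit[OF n] crit_uniq[OF n] loc[OF n]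
      by (intro the_equality) auto
    have n1: "n \<ge> 1" using n by simp
    have En: "?E (real n) \<in> {a (n - 1)..a n}"
      using free_energy_less[OF k, of "real (n - 1) + 1 / 2" "real n"] free_energy_less[OF k, of "real n" "real n + 1 / 2"] n
      by (simp add: a_def of_nat_diff)
    have "\<forall>x\<in>{lm n, lp n, \<kappa> n}. \<exists>t. \<bar>t - real n\<bar> \<le> 1 / 2 \<and> x = ?E t"
      using half_window[OF n1] loc[OF n] by auto
    moreover have "(-1) ^ n * lyapunov k q (lm n) = 2" "(-1) ^ n * lyapunov k q (lp n) = 2"
    proof -
      have "n \<in> {1..2 * k}" "n \<in> {0..2 * k - 1}" using n by auto
      then have "(-1) ^ (2 * k - n) * poly ?p (lm n) = 2" "(-1) ^ (2 * k - n) * poly ?p (lp n) = 2"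
        using edges unfolding poly_edges_def by blast+
      then show "(-1) ^ n * lyapunov k q (lm n) = 2" "(-1) ^ n * lyapunov k q (lp n) = 2"
        using parity_2k[of n k] n by (simp_all add: lyapunov_eq_poly)
    qed
    moreover have "(-1) ^ n * lyapunov k q (\<kappa> n) \<ge> 2"
      using peak[OF n] n parity_2k[of n k] by (simp add: lyapunov_eq_poly)
    moreover have "(-1) ^ n * lyapunov k q (?E (real n)) \<le> (-1) ^ n * lyapunov k q (\<kappa> n)"
      using max[OF n En] n parity_2k[of n k] by (simp add: lyapunov_eq_poly)
    ultimately show "gap_localized k q n" unfolding gap_localized_def lm lp crit_eq by blast
  qed (fact size interlace inside ends alternate)+
qed

text \<open>
  With \<open>y = h / 2\<close> and \<open>H = 2 cosh h - 2 = 4 sinh\<^sup>2 y\<close>, the bounds \<open>y \<le> sinh y \<le> y cosh y\<close> give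
  \<open>h\<^sup>2 \<le> H \<le> h\<^sup>2 (1 + H / 4)\<close>.
\<close>

lemma sq_minus_cosh_gap:
  fixes h :: real
  assumes "h \<ge> 0"
  shows "\<bar>h\<^sup>2 - (2 * cosh h - 2)\<bar> \<le> (2 * cosh h - 2)\<^sup>2 / 4"
proof (cases "h = 0")
  case False
  define y where "y = h / 2"
  define H where "H = 2 * cosh h - 2"
  have y: "0 < y" using assms False by (simp add: y_def)
  obtain t where t: "0 < t" "t < y" "sinh y - sinh 0 = (y - 0) * cosh t"
  proof -
    have "(sinh has_real_derivative cosh x) (at x)" for x :: real
      by (auto intro!: derivative_eq_intros)
    then show ?thesis using MVT2[OF y, of sinh cosh] that by blast
  qed
  have ct: "1 \<le> cosh t" "cosh t \<le> cosh y" using t cosh_real_ge_1[of t] by (auto simp: cosh_real_nonneg_le_iff)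
  have H: "H = 4 * (sinh y)\<^sup>2"
    unfolding H_def using cosh_double[of y] cosh_square_eq[of y] by (simp add: y_def)
  have "sinh y = y * cosh t" using t(3) by simp
  then have Ht: "H = 4 * (y\<^sup>2 * (cosh t)\<^sup>2)" unfolding H by (simp add: power_mult_distrib)
  have h2: "h\<^sup>2 = 4 * y\<^sup>2" by (simp add: y_def power_divide)
  have "y\<^sup>2 * 1\<^sup>2 \<le> y\<^sup>2 * (cosh t)\<^sup>2" using ct by (intro mult_left_mono power_mono) auto
  then have lo: "h\<^sup>2 \<le> H" unfolding Ht h2 by simp
  have "y\<^sup>2 * (cosh t)\<^sup>2 \<le> y\<^sup>2 * (cosh y)\<^sup>2" using ct by (intro mult_left_mono power_mono) auto
  then have "H \<le> h\<^sup>2 * (cosh y)\<^sup>2" unfolding Ht h2 by simp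
  also have "(cosh y)\<^sup>2 = 1 + H / 4" by (simp add: H cosh_square_eq)
  finally have "H - h\<^sup>2 \<le> h\<^sup>2 * (H / 4)" by (simp add: distrib_left)
  also have "\<dots> \<le> H * (H / 4)" using lo H by (intro mult_right_mono) auto
  finally show ?thesis using lo by (simp add: H_def[symmetric] power2_eq_square)
qed simp

lemma gap_h_cosh:
  assumes "n \<le> 2 * k" "(-1) ^ n * lyapunov k q (lam_crit k q n) \<ge> 2"
  shows "gap_h k q n \<ge> 0" "2 * cosh (gap_h k q n) = (-1) ^ n * lyapunov k q (lam_crit k q n)"
proof -
  define X where "X = (-1) ^ n * lyapunov k q (lam_crit k q n)"
  define h where "h = arcosh (X / 2)"
  have X: "X / 2 \<ge> 1" using assms by (simp add: X_def)
  have h: "h \<ge> 0" "cosh h = X / 2" using X by (simp_all add: h_def)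
  have L: "lyapunov k q (lam_crit k q n) = 2 * (-1) ^ (2 * k - n) * cosh g \<longleftrightarrow> cosh g = X / 2" for g
    unfolding parity_2k[OF assms(1)] X_def by (cases "even n") auto
  have "gap_h k q n = h"
    unfolding gap_h_def L
  proof (rule the_equality)
    fix g assume "0 \<le> g \<and> cosh g = X / 2"
    then show "g = h" using h by (metis arcosh_cosh_real)
  qed (use h in auto)
  then show "gap_h k q n \<ge> 0" "2 * cosh (gap_h k q n) = (-1) ^ n * lyapunov k q (lam_crit k q n)"
    using h by (simp_all add: X_def)
qed

text \<open>
  Besides the expansion of the discriminant, only two facts enter: the free discriminant is at most
  \<open>2 - s\<^sup>2 / 4\<close> throughout the window around \<open>c\<close>, which gives the a priori bound \<open>\<bar>s\<bar> \<le> K r\<close> for the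
  edges, and its Taylor expansion at \<open>c\<close>, which then identifies \<open>s\<^sup>2\<close>. The maximum at the critical
  point is bounded from below by the value at \<open>c\<close> and from above by completing the square.
\<close>

lemma gap_asymptotics:
  assumes k: "k \<ge> 1" and n: "n \<in> {1..<2 * k}"
  defines "c \<equiv> free_energy k (real n)" and "S \<equiv> sin (quasi_momentum k (real n))"
  obtains \<epsilon> K where "\<epsilon> > 0"
    and "\<And>q x. q \<in> Qodd k \<Longrightarrow> qnorm k q < \<epsilon> \<Longrightarrow> x \<in> {lam_minus k q n, lam_plus k q n} \<Longrightarrow>
      \<bar>x - c\<bar> \<le> K * qnorm k q \<and>
      \<bar>(x - c)\<^sup>2 - 2 ^ of_bool (k = n) / (4 * real k) * (qhat k q (if n \<le> k then n else 2 * k - n))\<^sup>2\<bar>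
        \<le> K * qnorm k q ^ 3"
    and "\<And>q. q \<in> Qodd k \<Longrightarrow> qnorm k q < \<epsilon> \<Longrightarrow>
      \<bar>(gap_h k q n)\<^sup>2 - 2 ^ of_bool (k = n) * real k / (4 * S\<^sup>2) * (qhat k q (if n \<le> k then n else 2 * k - n))\<^sup>2\<bar>
        \<le> K * qnorm k q ^ 4"
proof -
  obtain C where C1: "C \<ge> 1"
    and expand: "\<And>q l. q \<in> Qodd k \<Longrightarrow> qnorm k q \<le> 1 \<Longrightarrow> \<bar>l\<bar> \<le> 2 \<Longrightarrow>
      \<bar>lyapunov k q l - disc (2 * k) (\<lambda>_. l) - coeff (coupling_poly k q l) 2\<bar> \<le> C * qnorm k q ^ 4"
    and second: "\<And>q l. q \<in> Qodd k \<Longrightarrow> \<bar>l\<bar> \<le> 2 \<Longrightarrow> \<bar>coeff (coupling_poly k q l) 2\<bar> \<le> C * (qnorm k q)\<^sup>2"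
    and lip: "\<And>q l l'. q \<in> Qodd k \<Longrightarrow> \<bar>l\<bar> \<le> 2 \<Longrightarrow> \<bar>l'\<bar> \<le> 2 \<Longrightarrow>
      \<bar>coeff (coupling_poly k q l) 2 - coeff (coupling_poly k q l') 2\<bar> \<le> C * (qnorm k q)\<^sup>2 * \<bar>l - l'\<bar>"
    and sol: "\<And>q l. q \<in> Qodd k \<Longrightarrow> qnorm k q \<le> 1 \<Longrightarrow> \<bar>l\<bar> \<le> 2 \<Longrightarrow>
      \<bar>recsol (\<lambda>j. l - q j) 0 1 (2 * k) - recsol (\<lambda>_. l) 0 1 (2 * k)\<bar> \<le> C * qnorm k q"
    using uniform_perturbation[OF k] by blast
  define B where "B = (real k)\<^sup>2 / S\<^sup>2"
  obtain T where T: "\<And>l. \<bar>l\<bar> \<le> 2 \<Longrightarrow>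
      \<bar>(-1) ^ n * disc (2 * k) (\<lambda>_. l) - 2 + B * (l - c)\<^sup>2\<bar> \<le> T * \<bar>l - c\<bar> ^ 3"
    using free_disc_taylor[OF k n] unfolding B_def S_def c_def by blast
  \<comment> \<open>\<open>s\<^sup>2 \<le> 8 C r\<^sup>2 \<le> (8 C r)\<^sup>2\<close> because \<open>C \<ge> 1\<close>; \<open>M\<close> collects the errors in \<open>B s\<^sup>2\<close>.\<close>
  define E where "E = 8 * C"
  define M where "M = \<bar>T\<bar> * E ^ 3 + C * E + C"
  define K where "K = E + M / B + (2 * C\<^sup>2 + C)"
  have S: "S > 0" using sin_quasi_momentum_pos[OF k, of "real n"] n by (simp add: S_def)
  have B: "B > 0" using S k by (simp add: B_def)
  have c2: "\<bar>c\<bar> \<le> 2" unfolding c_def by (rule abs_free_energy_le)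
  have M0: "0 \<le> M" "0 \<le> E" using C1 by (simp_all add: M_def E_def)
  have K: "E \<le> K" "M / B \<le> K" "2 * C\<^sup>2 + C \<le> K"
    using C1 M0 B by (simp_all add: K_def)
  show ?thesis
  \<comment> \<open>For \<open>4 C r < 1\<close> both perturbations are at most \<open>1 / 2\<close> (and \<open>r \<le> 1\<close>).\<close>
  proof (rule that[of "1 / (4 * C)" K])
    show "0 < 1 / (4 * C)" using C1 by simp
    fix q assume q: "q \<in> Qodd k" and small: "qnorm k q < 1 / (4 * C)"
    define r where "r = qnorm k q"
    define A where "A = (-1) ^ n * coeff (coupling_poly k q c) 2"
    define qh where "qh = qhat k q (if n \<le> k then n else 2 * k - n)"
    have A: "A = 2 ^ of_bool (k = n) * real k / (4 * S\<^sup>2) * qh\<^sup>2"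
      unfolding A_def c_def coupling_coeff_2_at_band_edge[OF k q n] qh_def S_def by simp
    have r0: "0 \<le> r" unfolding r_def by (rule qnorm_nonneg)
    have "r * (4 * C) < 1" using small C1 by (simp add: r_def pos_less_divide_eq)
    then have "4 * (C * r) < 1" by (simp only: mult_ac)
    then have rC: "C * r \<le> 1 / 4" by linarith
    have r1: "r \<le> 1" using rC C1 r0 mult_right_mono[of 1 C r] by simp
    have pw: "r ^ 4 \<le> r ^ 3" "r ^ 4 \<le> r\<^sup>2" "r\<^sup>2 \<le> r"
      using r0 r1 power_decreasing[of 3 4 r] power_decreasing[of 2 4 r] power_decreasing[of 1 2 r] by simp_all
    have C0: "0 \<le> C" using C1 by simp
    have Cp: "C * r ^ 4 \<le> C * r ^ 3" "C * r ^ 4 \<le> C * r\<^sup>2" "C * r\<^sup>2 \<le> C * r"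
      by (rule mult_left_mono[OF pw(1) C0], rule mult_left_mono[OF pw(2) C0], rule mult_left_mono[OF pw(3) C0])
    have sgn: "\<bar>(-1) ^ n * y\<bar> = \<bar>y\<bar>" for y :: real by (simp add: abs_mult power_abs)
    define s where "s l = l - c" for l
    \<comment> \<open>Perturbed discriminant, free discriminant and quadratic part, all multiplied by the sign of the gap.\<close>
    define L where "L l = (-1) ^ n * lyapunov k q l" for l
    define D0 where "D0 l = (-1) ^ n * disc (2 * k) (\<lambda>_. l)" for l :: real
    define G where "G l = (-1) ^ n * coeff (coupling_poly k q l) 2" for l
    have L: "\<bar>L l - D0 l - G l\<bar> \<le> C * r ^ 4" if "\<bar>l\<bar> \<le> 2" for l
      using expand[OF q _ that] r1 unfolding L_def D0_def G_def r_def right_diff_distrib[symmetric] sgn by simp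
    have G: "\<bar>G l\<bar> \<le> C * r\<^sup>2" if "\<bar>l\<bar> \<le> 2" for l
      using second[OF q that] unfolding G_def sgn r_def .
    have GA: "\<bar>G l - A\<bar> \<le> C * r\<^sup>2 * \<bar>s l\<bar>" if "\<bar>l\<bar> \<le> 2" for l
      using lip[OF q that c2] unfolding G_def A_def right_diff_distrib[symmetric] sgn r_def s_def .
    have gap: "gap_localized k q n"
    proof (rule small_perturbation_gaps[OF k n])
      fix l :: real assume l: "\<bar>l\<bar> \<le> 2"
      show "\<bar>recsol (\<lambda>j. l - q j) 0 1 (2 * k) - recsol (\<lambda>_. l) 0 1 (2 * k)\<bar> \<le> 1 / 2"
        using sol[OF q _ l] r1 rC unfolding r_def by linarith
      have "\<bar>lyapunov k q l - disc (2 * k) (\<lambda>_. l)\<bar> = \<bar>L l - D0 l\<bar>"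
        unfolding L_def D0_def right_diff_distrib[symmetric] sgn ..
      also have "\<dots> \<le> C * r ^ 4 + C * r\<^sup>2" using L[OF l] G[OF l] by linarith
      also have "\<dots> \<le> C * r + C * r" using Cp by linarith
      also have "\<dots> \<le> 1 / 2" using rC by linarith
      finally show "\<bar>lyapunov k q l - disc (2 * k) (\<lambda>_. l)\<bar> \<le> 1 / 2" .
    qed
    have window: "\<bar>x\<bar> \<le> 2 \<and> D0 x \<le> 2 - (s x)\<^sup>2 / 4"
      if xn: "x \<in> {lam_minus k q n, lam_plus k q n, lam_crit k q n}" for x
    proof -
      obtain t where t: "\<bar>t - real n\<bar> \<le> 1 / 2" "x = free_energy k t"
        using bspec[OF conjunct1[OF gap[unfolded gap_localized_def]] xn] by (elim exE conjE)
      have "D0 x \<le> 2 - (s x)\<^sup>2 / 4"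
        unfolding t(2) D0_def s_def c_def by (rule free_disc_quadratic_upper[OF k t(1)])
      moreover have "\<bar>x\<bar> \<le> 2" unfolding t(2) by (rule abs_free_energy_le)
      ultimately show ?thesis by (intro conjI)
    qed
    show "\<bar>x - c\<bar> \<le> K * qnorm k q \<and>
      \<bar>(x - c)\<^sup>2 - 2 ^ of_bool (k = n) / (4 * real k) * (qhat k q (if n \<le> k then n else 2 * k - n))\<^sup>2\<bar>
        \<le> K * qnorm k q ^ 3"
      if x: "x \<in> {lam_minus k q n, lam_plus k q n}" for x
    proof -
      have x2: "\<bar>x\<bar> \<le> 2" and D0x: "D0 x \<le> 2 - (s x)\<^sup>2 / 4" using window[of x] x by auto
      have Lx: "L x = 2" using gap x unfolding gap_localized_def L_def by auto
      have "(s x)\<^sup>2 / 4 \<le> C * r\<^sup>2 + C * r ^ 4" using D0x Lx L[OF x2] G[OF x2] by linarith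
      also have "\<dots> \<le> C * r\<^sup>2 + C * r\<^sup>2" using Cp by linarith
      finally have "(s x)\<^sup>2 \<le> 8 * C * r\<^sup>2" by simp
      also have "\<dots> \<le> (8 * C) * (8 * C) * r\<^sup>2" using C1 by (intro mult_right_mono) auto
      also have "\<dots> = (E * r)\<^sup>2" by (simp add: E_def power2_eq_square)
      finally have "\<bar>s x\<bar>\<^sup>2 \<le> (E * r)\<^sup>2" by (simp only: power2_abs)
      then have sE: "\<bar>s x\<bar> \<le> E * r"
        by (rule power2_le_imp_le) (rule mult_nonneg_nonneg[OF M0(2) r0])
      have "\<bar>D0 x - 2 + B * (s x)\<^sup>2\<bar> \<le> T * \<bar>s x\<bar> ^ 3" using T[OF x2] unfolding D0_def s_def .
      also have "\<dots> \<le> \<bar>T\<bar> * (E * r) ^ 3" using sE by (intro mult_mono power_mono) auto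
      finally have t1: "\<bar>D0 x - 2 + B * (s x)\<^sup>2\<bar> \<le> \<bar>T\<bar> * E ^ 3 * r ^ 3" by (simp add: power_mult_distrib)
      have "C * r\<^sup>2 * \<bar>s x\<bar> \<le> C * r\<^sup>2 * (E * r)" using sE C1 by (intro mult_left_mono) auto
      then have t2: "\<bar>G x - A\<bar> \<le> C * E * r ^ 3" using GA[OF x2] by (simp add: power2_eq_square power3_eq_cube mult_ac)
      have t3: "\<bar>L x - D0 x - G x\<bar> \<le> C * r ^ 3" using L[OF x2] Cp(1) by linarith
      have "\<bar>B * (s x)\<^sup>2 - A\<bar> \<le> \<bar>T\<bar> * E ^ 3 * r ^ 3 + C * E * r ^ 3 + C * r ^ 3"
        using t1 t2 t3 Lx by linarith
      then have "\<bar>B * (s x)\<^sup>2 - A\<bar> \<le> M * r ^ 3" by (simp add: M_def distrib_right)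
      moreover have "B * (2 ^ of_bool (k = n) / (4 * real k) * qh\<^sup>2) = A"
        using k S by (simp add: A B_def power2_eq_square)
      ultimately have "B * \<bar>(s x)\<^sup>2 - 2 ^ of_bool (k = n) / (4 * real k) * qh\<^sup>2\<bar> \<le> M * r ^ 3"
        using B by (metis abs_mult abs_of_pos right_diff_distrib)
      then have "\<bar>(s x)\<^sup>2 - 2 ^ of_bool (k = n) / (4 * real k) * qh\<^sup>2\<bar> \<le> M / B * r ^ 3"
        using B by (simp add: pos_le_divide_eq mult.commute)
      also have "\<dots> \<le> K * r ^ 3" using K r0 by (intro mult_right_mono) auto
      finally have "\<bar>(s x)\<^sup>2 - 2 ^ of_bool (k = n) / (4 * real k) * qh\<^sup>2\<bar> \<le> K * r ^ 3" .
      moreover have "\<bar>s x\<bar> \<le> K * r" using sE mult_right_mono[OF K(1) r0] by linarith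
      ultimately show ?thesis unfolding s_def qh_def r_def by blast
    qed
    let ?x = "lam_crit k q n"
    define H where "H = L ?x - 2"
    have x2: "\<bar>?x\<bar> \<le> 2" and D0x: "D0 ?x \<le> 2 - (s ?x)\<^sup>2 / 4" using window[of ?x] by auto
    have L2: "L ?x \<ge> 2" and Lc: "L c \<le> L ?x"
      using gap unfolding gap_localized_def L_def c_def by auto
    have "D0 c = 2" unfolding D0_def c_def free_disc[OF k] using cos_npi2[of n] by (simp add: power_mult_distrib[symmetric])
    moreover have "G c = A" by (simp add: G_def A_def)
    ultimately have lo: "A - C * r ^ 4 \<le> H" using Lc L[OF c2] unfolding H_def by linarith
    \<comment> \<open>Completing the square in \<open>- s\<^sup>2 / 4 + C r\<^sup>2 \<bar>s\<bar>\<close>.\<close>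
    have "0 \<le> (\<bar>s ?x\<bar> / 2 - C * r\<^sup>2)\<^sup>2" by simp
    also have "\<dots> = (s ?x)\<^sup>2 / 4 - C * r\<^sup>2 * \<bar>s ?x\<bar> + C\<^sup>2 * r ^ 4"
      by (simp add: power2_diff power_divide power_mult_distrib mult_ac)
    finally have up: "H \<le> A + C\<^sup>2 * r ^ 4 + C * r ^ 4"
      using D0x L[OF x2] GA[OF x2] unfolding H_def by linarith
    have "0 \<le> C\<^sup>2 * r ^ 4" by simp
    then have HA: "\<bar>H - A\<bar> \<le> C\<^sup>2 * r ^ 4 + C * r ^ 4"
      using lo up unfolding abs_le_iff by linarith
    have "0 \<le> (s ?x)\<^sup>2" by simp
    then have "H \<le> 2 * (C * r\<^sup>2)"
      using D0x L[OF x2] G[OF x2] Cp(2) unfolding H_def by linarith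
    moreover have "0 \<le> H" using L2 by (simp add: H_def)
    ultimately have "H\<^sup>2 \<le> (2 * (C * r\<^sup>2))\<^sup>2" by (rule power_mono)
    then have H2: "H\<^sup>2 / 4 \<le> C\<^sup>2 * r ^ 4" by (simp add: power_mult_distrib)
    have n2: "n \<le> 2 * k" using n by simp
    have "2 * cosh (gap_h k q n) - 2 = H" "gap_h k q n \<ge> 0"
      using gap_h_cosh[OF n2] L2 unfolding H_def L_def by auto
    then have "\<bar>(gap_h k q n)\<^sup>2 - H\<bar> \<le> H\<^sup>2 / 4" using sq_minus_cosh_gap[of "gap_h k q n"] by simp
    then have "\<bar>(gap_h k q n)\<^sup>2 - A\<bar> \<le> C\<^sup>2 * r ^ 4 + (C\<^sup>2 * r ^ 4 + C * r ^ 4)" using HA H2 by linarith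
    also have "\<dots> = (2 * C\<^sup>2 + C) * r ^ 4" by (simp add: distrib_right)
    also have "\<dots> \<le> K * r ^ 4" using K r0 by (intro mult_right_mono) auto
    finally show "\<bar>(gap_h k q n)\<^sup>2 - 2 ^ of_bool (k = n) * real k / (4 * S\<^sup>2) * (qhat k q (if n \<le> k then n else 2 * k - n))\<^sup>2\<bar>
        \<le> K * qnorm k q ^ 4"
      unfolding A qh_def r_def .
  qed
qed

lemma eventually_Qodd_to_0:
  assumes "\<epsilon> > 0" "\<And>q. q \<in> Qodd k \<Longrightarrow> qnorm k q < \<epsilon> \<Longrightarrow> P q"
  shows "eventually P (Qodd_to_0 k)"
proof -
  have "eventually (\<lambda>q. q \<in> Qodd k \<longrightarrow> P q) (filtercomap (qnorm k) (nhds 0))"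
    unfolding eventually_filtercomap eventually_nhds_metric
    by (rule exI[of _ "\<lambda>x. dist x 0 < \<epsilon>"]) (use assms qnorm_nonneg[of k] in auto)
  then show ?thesis unfolding Qodd_to_0_def eventually_inf_principal .
qed

lemma bigo_Qodd_to_0:
  assumes "\<epsilon> > 0" "\<And>q. q \<in> Qodd k \<Longrightarrow> qnorm k q < \<epsilon> \<Longrightarrow> \<bar>f q\<bar> \<le> K * qnorm k q ^ i"
  shows "f \<in> O[Qodd_to_0 k](\<lambda>q. qnorm k q ^ i)"
proof (rule bigoI[where c = K], rule eventually_Qodd_to_0[OF assms(1)])
  fix q assume "q \<in> Qodd k" "qnorm k q < \<epsilon>"
  then show "norm (f q) \<le> K * norm (qnorm k q ^ i)"
    using assms(2)[of q] qnorm_nonneg[of k q] by simp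
qed

theorem theorem1p1:
  fixes k N n :: nat
  assumes "k \<ge> 1" and "N + 1 = 2 * k" and "1 \<le> n" and "n \<le> N"
  defines "qh \<equiv> (\<lambda>q. qhat k q (if n \<le> k then n else 2 * k - n))"
  shows "lam_minus k (\<lambda>_. 0) n = - 2 * cos (pi * real n / real (N + 1)) \<and>
    lam_plus k (\<lambda>_. 0) n = - 2 * cos (pi * real n / real (N + 1)) \<and>
    (\<lambda>q. (lam_minus k q n - lam_minus k (\<lambda>_. 0) n)\<^sup>2
           - 2 ^ of_bool (k = n) / (4 * real k) * (qh q)\<^sup>2)
       \<in> O[Qodd_to_0 k](\<lambda>q. qnorm k q ^ 3) \<and>
    (\<lambda>q. (lam_plus k q n - lam_plus k (\<lambda>_. 0) n)\<^sup>2
           - 2 ^ of_bool (k = n) / (4 * real k) * (qh q)\<^sup>2)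
       \<in> O[Qodd_to_0 k](\<lambda>q. qnorm k q ^ 3) \<and>
    (\<lambda>q. (gap_h k q n)\<^sup>2
           - 2 ^ of_bool (k = n) * real k / (4 * (sin (pi * real n / (2 * real k)))\<^sup>2) * (qh q)\<^sup>2)
       \<in> O[Qodd_to_0 k](\<lambda>q. qnorm k q ^ 4)"
proof -
  have k: "k \<ge> 1" and n: "n \<in> {1..<2 * k}" using assms by auto
  define c where "c = free_energy k (real n)"
  have p: "quasi_momentum k (real n) = pi - pi * real n / (2 * real k)"
    using k by (simp add: quasi_momentum_def field_simps)
  have S: "sin (quasi_momentum k (real n)) = sin (pi * real n / (2 * real k))" unfolding p by simp
  have N: "real (N + 1) = 2 * real k" unfolding assms(2) by simp
  have c: "c = - 2 * cos (pi * real n / real (N + 1))"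
    unfolding c_def free_energy_def p N by simp
  obtain \<epsilon> K where e: "\<epsilon> > 0"
    and edge: "\<And>q x. q \<in> Qodd k \<Longrightarrow> qnorm k q < \<epsilon> \<Longrightarrow> x \<in> {lam_minus k q n, lam_plus k q n} \<Longrightarrow>
      \<bar>x - c\<bar> \<le> K * qnorm k q \<and> \<bar>(x - c)\<^sup>2 - 2 ^ of_bool (k = n) / (4 * real k) * (qh q)\<^sup>2\<bar> \<le> K * qnorm k q ^ 3"
    and gap: "\<And>q. q \<in> Qodd k \<Longrightarrow> qnorm k q < \<epsilon> \<Longrightarrow>
      \<bar>(gap_h k q n)\<^sup>2 - 2 ^ of_bool (k = n) * real k / (4 * (sin (pi * real n / (2 * real k)))\<^sup>2) * (qh q)\<^sup>2\<bar>
        \<le> K * qnorm k q ^ 4"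
    unfolding qh_def c_def using gap_asymptotics[OF k n] unfolding S by blast
  have "(\<lambda>_. 0) \<in> Qodd k" "qnorm k (\<lambda>_. 0) = 0" by (simp_all add: Qodd_def qnorm_def)
  \<comment> \<open>At \<open>q = 0\<close> the bound \<open>\<bar>x - c\<bar> \<le> K r\<close> is an equality of \<open>x\<close> and \<open>c\<close>.\<close>
  then have zero: "lam_minus k (\<lambda>_. 0) n = c" "lam_plus k (\<lambda>_. 0) n = c"
    using edge[of "\<lambda>_. 0"] e by auto
  show ?thesis
    unfolding zero
  proof (intro conjI)
    show "(\<lambda>q. (lam_minus k q n - c)\<^sup>2 - 2 ^ of_bool (k = n) / (4 * real k) * (qh q)\<^sup>2)
        \<in> O[Qodd_to_0 k](\<lambda>q. qnorm k q ^ 3)"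
      "(\<lambda>q. (lam_plus k q n - c)\<^sup>2 - 2 ^ of_bool (k = n) / (4 * real k) * (qh q)\<^sup>2)
        \<in> O[Qodd_to_0 k](\<lambda>q. qnorm k q ^ 3)"
      by (rule bigo_Qodd_to_0[OF e, of _ _ K], use edge in blast)+
    show "(\<lambda>q. (gap_h k q n)\<^sup>2
        - 2 ^ of_bool (k = n) * real k / (4 * (sin (pi * real n / (2 * real k)))\<^sup>2) * (qh q)\<^sup>2)
        \<in> O[Qodd_to_0 k](\<lambda>q. qnorm k q ^ 4)"
      by (rule bigo_Qodd_to_0[OF e, of _ _ K]) (use gap in blast)
  qed (fact c)+
qed

end
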